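(* Let $R$ be a commutative ring and $I$ an ideal of $R$. Then the sequence $$\mathrm{K_1Sp}(R,I)\xrightarrow{\ f\ }\mathrm{SK_1}(R,I)\xrightarrow{\ H\ }W_E(R,I)$$ is exact (at $\mathrm{SK_1}(R,I)$), where $f$ is induced by the inclusions $\operatorname{Sp}_{2n}(R,I)\subset\operatorname{SL}_{2n}(R,I)$ and $H([\alpha])=[\alpha^T\chi_n\alpha]$ for $\alpha\in\operatorname{SL}_{2n}(R,I)$.
   Context: Let $\chi_1=\begin{pmatrix}0&1\\-1&0\end{pmatrix}$, $\chi_{n+1}=\chi_n\perp\chi_1$ (block diagonal sum). $\operatorname{GL}_n(R,I)=\ker(\operatorname{GL}_n(R)\to\operatorname{GL}_n(R/I))$, $\operatorname{SL}_n(R,I)$ its determinant-$1$ subgroup, $\operatorname{E}_n(R,I)$ the group generated by all $\alpha e_{ij}(a)\alpha^{-1}$ with $\alpha$ in the elementary group $\operatorname{E}_n(R)$, $a\in I$, $i\ne j$. $\operatorname{Sp}_{2n}(R,I)=\{\alpha\in\operatorname{GL}_{2n}(R,I):\alpha^T\chi_n\alpha=\chi_n\}$. With $\sigma(2i)=2i-1$, $\sigma(2i-1)=2i$, set $se_{ij}(\lambda)=\mathrm I+\lambda E_{ij}$ if $i=\sigma(j)$ and $se_{ij}(\lambda)=\mathrm I+\lambda E_{ij}-(-1)^{i+j}\lambda E_{\sigma(j)\sigma(i)}$ if $i\ne j,\sigma(j)$; $\operatorname{ESp}_{2n}(R)$ is generated by all $se_{ij}(\lambda)$, $\lambda\in R$,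 and $\operatorname{ESp}_{2n}(R,I)$ by all $\alpha\,se_{ij}(x)\alpha^{-1}$, $\alpha\in\operatorname{ESp}_{2n}(R)$, $x\in I$. Stabilizing by $\alpha\mapsto 1\perp\alpha$ (linear) and $\alpha\mapsto\mathrm I_2\perp\alpha$ (symplectic), $\mathrm{SK_1}(R,I)=\operatorname{SL}(R,I)/\operatorname{E}(R,I)$ and $\mathrm{K_1Sp}(R,I)=\operatorname{Sp}(R,I)/\operatorname{ESp}(R,I)$, where symbols without index denote direct limits. A matrix is alternating if it is skew-symmetric with zero diagonal. $\operatorname{Alt}_{2n}(R,I)$ is the set of alternating $\alpha\in\operatorname{GL}_{2n}(R)$ with Pfaffian $1$ and $\alpha\equiv\chi_n\pmod I$. For $\alpha\in\operatorname{Alt}_{2m}(R,I)$, $\beta\in\operatorname{Alt}_{2n}(R,I)$, write $\alpha\sim_I\beta$ if there are $t\in\mathbb N$ and $\varepsilon\in\operatorname{E}_{2(m+n+t)}(R,I)$ with $\alpha\perp\chi_{n+t}=\varepsilon^T(\beta\perp\chi_{m+t})\varepsilon$. $W_E(R,I)$ is the set of $\sim_I$-classes of $\bigcup_n\operatorname{Alt}_{2n}(R,I)$ (with $\alpha$ identified with $\alpha\perp\chi_r$); it is an abelian group under $[\alpha][\beta]=[\alpha\perp\beta]$ with identity $[\chi_1]$. *)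

theory Defs
  imports Jordan_Normal_Form.VS_Connect "HOL-Algebra.Generated_Groups" "HOL-Algebra.Ideal"
begin

text \<open>
  Matrix indices are 0-based, so rows and columns \<open>i\<close>, \<open>j\<close> below are \<open>i + 1\<close>, \<open>j + 1\<close> in the usual
  1-based notation.  All families indexed by \<open>n\<close> also contain the degenerate member \<open>n = 0\<close>
  (matrices without rows and columns); it changes none of the stable objects.
\<close>

definition mat_sum :: "'a::zero mat \<Rightarrow> 'a mat \<Rightarrow> 'a mat"  (infixl \<open>\<bottom>\<close> 65) where
  "A \<bottom> B = four_block_mat A (0\<^sub>m (dim_row A) (dim_col B)) (0\<^sub>m (dim_row B) (dim_col A)) B"

definition mat_unit :: "nat \<Rightarrow> nat \<Rightarrow> nat \<Rightarrow> 'a::zero_neq_one mat" where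
  "mat_unit n i j = mat n n (\<lambda>p. if p = (i, j) then 1 else 0)"

definition chi1 :: "'a::comm_ring_1 mat" where
  "chi1 = mat_of_rows_list 2 [[0, 1], [- 1, 0]]"

primrec chi :: "nat \<Rightarrow> 'a::comm_ring_1 mat" where
  "chi 0 = 1\<^sub>m 0"
| "chi (Suc n) = chi n \<bottom> chi1"

definition mat_cong :: "'a::comm_ring_1 set \<Rightarrow> 'a mat \<Rightarrow> 'a mat \<Rightarrow> bool" where
  "mat_cong I A B \<longleftrightarrow> dim_row A = dim_row B \<and> dim_col A = dim_col B \<and>
     (\<forall>i<dim_row A. \<forall>j<dim_col A. A $$ (i, j) - B $$ (i, j) \<in> I)"


section \<open>Linear groups\<close>

abbreviation GL :: "nat \<Rightarrow> 'a::comm_ring_1 mat monoid" where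
  "GL n \<equiv> units_of (ring_mat TYPE('a) n ())"

text \<open>\<open>\<alpha>\<close> is in the kernel of \<open>GL\<^sub>n(R) \<rightarrow> GL\<^sub>n(R/I)\<close> iff it is entrywise congruent to the identity.\<close>

definition GL_rel :: "nat \<Rightarrow> 'a::comm_ring_1 set \<Rightarrow> 'a mat set" where
  "GL_rel n I = {A \<in> carrier (GL n). mat_cong I A (1\<^sub>m n)}"

definition SL_rel :: "nat \<Rightarrow> 'a::comm_ring_1 set \<Rightarrow> 'a mat set" where
  "SL_rel n I = {A \<in> GL_rel n I. det A = 1}"

definition elem_mat :: "nat \<Rightarrow> nat \<Rightarrow> nat \<Rightarrow> 'a::comm_ring_1 \<Rightarrow> 'a mat" where
  "elem_mat n i j a = 1\<^sub>m n + a \<cdot>\<^sub>m mat_unit n i j"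

definition E :: "nat \<Rightarrow> 'a::comm_ring_1 mat set" where
  "E n = generate (GL n) {elem_mat n i j a | i j a. i < n \<and> j < n \<and> i \<noteq> j}"

definition E_rel :: "nat \<Rightarrow> 'a::comm_ring_1 set \<Rightarrow> 'a mat set" where
  "E_rel n I = generate (GL n)
     {\<alpha> * elem_mat n i j a * inv\<^bsub>GL n\<^esub> \<alpha> | \<alpha> i j a. \<alpha> \<in> E n \<and> i < n \<and> j < n \<and> i \<noteq> j \<and> a \<in> I}"


section \<open>Symplectic groups\<close>

definition Sp_rel :: "nat \<Rightarrow> 'a::comm_ring_1 set \<Rightarrow> 'a mat set" where
  "Sp_rel n I = {A \<in> GL_rel (2 * n) I. transpose_mat A * chi n * A = chi n}"

text \<open>The involution \<open>2i \<leftrightarrow> 2i - 1\<close> on 1-based indices.\<close>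

definition sigma :: "nat \<Rightarrow> nat" where
  "sigma i = (if even i then i + 1 else i - 1)"

text \<open>Used only for \<open>i \<noteq> j\<close>.  The parity of \<open>i + j\<close> is the same for 0-based and 1-based indices.\<close>

definition symp_elem_mat :: "nat \<Rightarrow> nat \<Rightarrow> nat \<Rightarrow> 'a::comm_ring_1 \<Rightarrow> 'a mat" where
  "symp_elem_mat n i j a =
     (if i = sigma j then 1\<^sub>m (2 * n) + a \<cdot>\<^sub>m mat_unit (2 * n) i j
      else 1\<^sub>m (2 * n) + a \<cdot>\<^sub>m mat_unit (2 * n) i j
             - ((- 1) ^ (i + j) * a) \<cdot>\<^sub>m mat_unit (2 * n) (sigma j) (sigma i))"

definition ESp :: "nat \<Rightarrow> 'a::comm_ring_1 mat set" where
  "ESp n = generate (GL (2 * n)) {symp_elem_mat n i j a | i j a. i < 2 * n \<and> j < 2 * n \<and> i \<noteq> j}"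

definition ESp_rel :: "nat \<Rightarrow> 'a::comm_ring_1 set \<Rightarrow> 'a mat set" where
  "ESp_rel n I = generate (GL (2 * n))
     {\<alpha> * symp_elem_mat n i j a * inv\<^bsub>GL (2 * n)\<^esub> \<alpha>
       | \<alpha> i j a. \<alpha> \<in> ESp n \<and> i < 2 * n \<and> j < 2 * n \<and> i \<noteq> j \<and> a \<in> I}"


section \<open>Stabilisation\<close>

text \<open>
  The stabilisation maps \<open>\<alpha> \<mapsto> 1 \<bottom> \<alpha>\<close> are injective.  The element of the direct limit \<open>GL(R)\<close>
  represented by \<open>\<alpha>\<close> is the set of all matrices that agree with \<open>\<alpha>\<close> after stabilisation.  As the
  symplectic map \<open>\<alpha> \<mapsto> 1\<^sub>2 \<bottom> \<alpha>\<close> is the linear one applied twice, the limits of all subgroups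
  considered here, linear or symplectic, are unions inside \<open>GL(R)\<close>.
\<close>

definition stab_class :: "'a::comm_ring_1 mat \<Rightarrow> 'a mat set" where
  "stab_class A = {B. \<exists>k l. 1\<^sub>m k \<bottom> A = 1\<^sub>m l \<bottom> B}"

definition stable :: "(nat \<Rightarrow> 'a::comm_ring_1 mat set) \<Rightarrow> 'a mat set set" where
  "stable G = (\<Union>n. stab_class ` G n)"

text \<open>Two classes are multiplied by multiplying representatives of the same size.\<close>

definition GL_stable :: "'a::comm_ring_1 mat set monoid" where
  "GL_stable = \<lparr>
     carrier = stable (\<lambda>n. carrier (GL n)),
     mult = (\<lambda>X Y. \<Union> {stab_class (A * B) | A B n. A \<in> X \<inter> carrier_mat n n \<and> B \<in> Y \<inter> carrier_mat n n}),
     one = stab_class (1\<^sub>m 1)\<rparr>"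

abbreviation "SL_st I \<equiv> stable (\<lambda>n. SL_rel n I)"
abbreviation "E_st I \<equiv> stable (\<lambda>n. E_rel n I)"
abbreviation "Sp_st I \<equiv> stable (\<lambda>n. Sp_rel n I)"
abbreviation "ESp_st I \<equiv> stable (\<lambda>n. ESp_rel n I)"

definition SK1 :: "'a::comm_ring_1 set \<Rightarrow> 'a mat set set monoid" where
  "SK1 I = GL_stable\<lparr>carrier := SL_st I\<rparr> Mod E_st I"

definition K1Sp :: "'a::comm_ring_1 set \<Rightarrow> 'a mat set set monoid" where
  "K1Sp I = GL_stable\<lparr>carrier := Sp_st I\<rparr> Mod ESp_st I"


section \<open>The elementary symplectic Witt group\<close>

definition alternating :: "'a::comm_ring_1 mat \<Rightarrow> bool" where
  "alternating A \<longleftrightarrow> transpose_mat A = - A \<and> (\<forall>i<dim_row A. A $$ (i, i) = 0)"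

text \<open>
  The Pfaffian of an alternating \<open>2n \<times> 2n\<close> matrix, by expansion along the first row.  Deleting row
  and column \<open>j\<close> before row and column \<open>0\<close> keeps the remaining indices in order.
\<close>

primrec pfaffian :: "nat \<Rightarrow> 'a::comm_ring_1 mat \<Rightarrow> 'a" where
  "pfaffian 0 A = 1"
| "pfaffian (Suc n) A =
     (\<Sum>j = 1..2 * n + 1. (- 1) ^ (j + 1) * A $$ (0, j) * pfaffian n (mat_delete (mat_delete A j j) 0 0))"

definition Alt :: "nat \<Rightarrow> 'a::comm_ring_1 set \<Rightarrow> 'a mat set" where
  "Alt n I = {A \<in> carrier (GL (2 * n)). alternating A \<and> pfaffian n A = 1 \<and> mat_cong I A (chi n)}"

definition W_rel :: "'a::comm_ring_1 set \<Rightarrow> ('a mat \<times> 'a mat) set" where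
  "W_rel I = {(A, B). \<exists>m n t. A \<in> Alt m I \<and> B \<in> Alt n I \<and>
     (\<exists>\<epsilon> \<in> E_rel (2 * (m + n + t)) I.
        A \<bottom> chi (n + t) = transpose_mat \<epsilon> * (B \<bottom> chi (m + t)) * \<epsilon>)}"

abbreviation W_class :: "'a::comm_ring_1 set \<Rightarrow> 'a mat \<Rightarrow> 'a mat set" where
  "W_class I A \<equiv> W_rel I `` {A}"

text \<open>
  Identifying \<open>A\<close> with \<open>A \<bottom> chi r\<close> needs no separate step: these matrices are related by
  \<open>W_rel I\<close> with \<open>\<epsilon> = 1\<close>.
\<close>

definition W_E :: "'a::comm_ring_1 set \<Rightarrow> 'a mat set monoid" where
  "W_E I = \<lparr>
     carrier = (\<Union>n. Alt n I) // W_rel I,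
     mult = (\<lambda>X Y. \<Union>A\<in>X. \<Union>B\<in>Y. W_class I (A \<bottom> B)),
     one = W_class I (chi 1)\<rparr>"


section \<open>The maps\<close>

text \<open>
  Both maps on cosets are given as the union of the values at all representatives.  Such a union is
  an element of the target only if all those values coincide.
\<close>

definition K1Sp_to_SK1 :: "'a::comm_ring_1 set \<Rightarrow> 'a mat set set \<Rightarrow> 'a mat set set" where
  "K1Sp_to_SK1 I X = (\<Union>\<alpha>\<in>X. E_st I #>\<^bsub>GL_stable\<^esub> \<alpha>)"

definition SK1_to_W_E :: "'a::comm_ring_1 set \<Rightarrow> 'a mat set set \<Rightarrow> 'a mat set" where
  "SK1_to_W_E I X =
     \<Union> {W_class I (transpose_mat A * chi n * A) | A n. A \<in> SL_rel (2 * n) I \<and> stab_class A \<in> X}"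

end

theory Submission
  imports Defs
begin

text \<open>
  Exactness itself is short.  A class in the kernel of \<open>H\<close> is represented by \<open>A\<close> with
  \<open>A\<^sup>T \<chi> A = \<epsilon>\<^sup>T \<chi> \<epsilon>\<close> for a relative elementary \<open>\<epsilon>\<close>, after stabilisation on the right, so
  \<open>A \<epsilon>\<^sup>-\<^sup>1\<close> is symplectic and represents the same class.  The work lies in the groups and maps.

  Normality of the linear elementary group and the comparison of stabilisation on either side rest
  on a relative Whitehead lemma: \<open>a \<bottom> a\<^sup>-\<^sup>1\<close> lies in \<open>E(R, I)\<close> for \<open>a \<in> GL(R, I)\<close>, and
  \<open>1 \<bottom> g e g\<^sup>-\<^sup>1\<close> does for \<open>g \<in> GL(R)\<close>, \<open>e \<in> E(R, I)\<close>.  On the symplectic side, conjugates of elementary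
  matrices are symplectic transvections; one additional hyperbolic plane suffices to factor a
  transvection into relative elementary matrices.

  The Pfaffian satisfies \<open>pf (g\<^sup>T A g) = det g * pf A\<close> because, as a function of \<open>g\<close>, the left side is an
  alternating multilinear form.  Inverses in \<open>W\<^sub>E\<close> come from a sign-twisted copy of \<open>A\<^sup>-\<^sup>1\<close>: explicit
  block unipotent matrices over \<open>I\<close> transform \<open>A \<bottom> A\<^sup>-\<^sup>1\<close> into the same sum for \<open>\<chi>\<close>.
\<close>

section \<open>Block sums\<close>

text \<open>The shape of the proof comes from permutation matrices, which in general are not
  congruent to 1 modulo \<open>I\<close> and so are no candidates for \<open>E_rel\<close>. The
  quotients of matrix groups add identity blocks on the left, the Witt relation adds
  \<open>chi\<close> on the right, and no relative elementary matrix is at hand to move a block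
  across. Two substitutes are used. Conjugation by a monomial matrix preserves \<open>E_rel\<close>
  even when the matrix is not in it, so a known congruence may be permuted on both of its sides at
  once; a sum of copies of \<open>chi\<close> does not notice. And \<open>chi 1 \<bottom> A\<close>
  is identified with \<open>A\<close> by cancelling against an inverse form. A second obstacle is
  the side: a coset provides an elementary factor on the left of a matrix, a congruence of forms
  wants it on the right. Passing it across conjugates it by an invertible matrix, which is harmless
  only after stabilisation. The Pfaffian enters not only through \<open>Alt\<close>: it shows that
  symplectic matrices have determinant 1, so that \<open>f\<close> takes its values in the special
  linear quotient.\<close>

lemma dim_mat_sum [simp]:
  "dim_row (A \<bottom> B) = dim_row A + dim_row B" "dim_col (A \<bottom> B) = dim_col A + dim_col B"
  by (auto simp: mat_sum_def)

lemma mat_sum_carrier [simp, intro]: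
  "A \<in> carrier_mat a b \<Longrightarrow> B \<in> carrier_mat c d \<Longrightarrow> A \<bottom> B \<in> carrier_mat (a + c) (b + d)"
  by (intro carrier_matI) auto

lemma mat_sum_index:
  "i < dim_row A + dim_row B \<Longrightarrow> j < dim_col A + dim_col B \<Longrightarrow>
    (A \<bottom> B) $$ (i, j) = (if i < dim_row A then if j < dim_col A then A $$ (i, j) else 0
      else if j < dim_col A then 0 else B $$ (i - dim_row A, j - dim_col A))"
  by (auto simp: mat_sum_def)

lemma mat_sum_assoc: "(A \<bottom> B) \<bottom> C = A \<bottom> (B \<bottom> C)"
  unfolding mat_sum_def using assoc_four_block_mat[of A B C] by simp

lemma one_mat_sum_one [simp]: "1\<^sub>m a \<bottom> 1\<^sub>m b = 1\<^sub>m (a + b)"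
  by (rule eq_matI) (auto simp: mat_sum_index)

lemma one_mat_sum_one_sum [simp]: "1\<^sub>m a \<bottom> (1\<^sub>m b \<bottom> A) = 1\<^sub>m (a + b) \<bottom> A"
  by (simp add: mat_sum_assoc [symmetric])

lemma one_zero_mat_sum [simp]: "1\<^sub>m 0 \<bottom> A = A" "A \<bottom> 1\<^sub>m 0 = A"
  by (rule eq_matI; auto simp: mat_sum_index)+

lemma transpose_mat_sum [simp]: "transpose_mat (A \<bottom> B) = transpose_mat A \<bottom> transpose_mat B"
  by (rule eq_matI) (auto simp: mat_sum_index)

lemma mat_sum_mult:
  fixes A :: "'a::comm_ring_1 mat"
  assumes "A \<in> carrier_mat a b" "C \<in> carrier_mat b c" "B \<in> carrier_mat d e" "D \<in> carrier_mat e f"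
  shows "(A \<bottom> B) * (C \<bottom> D) = (A * C) \<bottom> (B * D)"
  using assms unfolding mat_sum_def
  by (subst mult_four_block_mat[of _ a b _ e _ d _ _ c _ f]) auto

lemma mat_sum_right_inject:
  assumes "C \<bottom> A = C \<bottom> B" shows "A = B"
proof (rule eq_matI)
  have d: "dim_row A = dim_row B" "dim_col A = dim_col B"
    using arg_cong[OF assms, of dim_row] arg_cong[OF assms, of dim_col] by auto
  show "dim_row A = dim_row B" "dim_col A = dim_col B" by fact+
  fix i j assume "i < dim_row B" "j < dim_col B"
  then show "A $$ (i, j) = B $$ (i, j)"
    using d arg_cong[OF assms, of "\<lambda>M. M $$ (dim_row C + i, dim_col C + j)"] by (simp add: mat_sum_index)
qed

lemma det_one_mat_sum:
  assumes "A \<in> carrier_mat n n"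
  shows "det (1\<^sub>m k \<bottom> A) = (det A :: 'a::comm_ring_1)"
proof (induction k)
  case (Suc k)
  have "1\<^sub>m (Suc k) \<bottom> A = 1\<^sub>m 1 \<bottom> (1\<^sub>m k \<bottom> A)" by simp
  also have "det \<dots> = det (1\<^sub>m 1 :: 'a mat) * det (1\<^sub>m k \<bottom> A)"
    using assms unfolding mat_sum_def[of "1\<^sub>m 1"]
    by (intro det_four_block_mat_lower_left_zero_col[where n = "k + n"]) auto
  finally show ?case using Suc by simp
qed simp


section \<open>Invertible matrices\<close>

lemma GL_carrier:
  "A \<in> carrier (GL n) \<longleftrightarrow>
    A \<in> carrier_mat n n \<and> (\<exists>B \<in> carrier_mat n n. A * B = 1\<^sub>m n \<and> B * (A :: 'a::comm_ring_1 mat) = 1\<^sub>m n)"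
  by (auto simp: units_of_def Units_def ring_mat_simps)

lemma GL_simps [simp]:
  "mult (GL n) A B = A * B" "one (GL n) = 1\<^sub>m n"
  by (auto simp: units_of_def ring_mat_simps)

lemma GL_group: "group (GL n :: 'a::comm_ring_1 mat monoid)"
proof -
  interpret ring "ring_mat TYPE('a) n ()" by (rule ring_mat)
  show ?thesis by (rule units_group)
qed

lemma GL_carrier_mat [simp, intro]: "A \<in> carrier (GL n) \<Longrightarrow> A \<in> carrier_mat n n"
  by (simp add: GL_carrier)

lemma GL_dim: "A \<in> carrier (GL n) \<Longrightarrow> dim_row A = n" "A \<in> carrier (GL n) \<Longrightarrow> dim_col A = n"
  using GL_carrier_mat by blast+

lemma GL_I:
  "A \<in> carrier_mat n n \<Longrightarrow> B \<in> carrier_mat n n \<Longrightarrow> A * B = 1\<^sub>m n \<Longrightarrow> B * A = 1\<^sub>m n \<Longrightarrow> A \<in> carrier (GL n)"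
  unfolding GL_carrier by blast

lemma GL_mult [simp, intro]: "A \<in> carrier (GL n) \<Longrightarrow> B \<in> carrier (GL n) \<Longrightarrow> A * B \<in> carrier (GL n)"
  using monoid.m_closed[OF group.is_monoid[OF GL_group[of n]], of A B] by (simp only: GL_simps)

lemma GL_one [simp, intro]: "1\<^sub>m n \<in> carrier (GL n)"
  by (auto intro: GL_I[of _ _ "1\<^sub>m n"])

lemma GL_inv [simp, intro]: "A \<in> carrier (GL n) \<Longrightarrow> inv\<^bsub>GL n\<^esub> A \<in> carrier (GL n)"
  by (rule group.inv_closed[OF GL_group])

lemma GL_r_inv [simp]: "A \<in> carrier (GL n) \<Longrightarrow> A * inv\<^bsub>GL n\<^esub> A = 1\<^sub>m n"
  using group.r_inv[OF GL_group, of A n] by simp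

lemma GL_l_inv [simp]: "A \<in> carrier (GL n) \<Longrightarrow> inv\<^bsub>GL n\<^esub> A * A = 1\<^sub>m n"
  using group.l_inv[OF GL_group, of A n] by simp

lemma GL_inv_eq:
  "A \<in> carrier_mat n n \<Longrightarrow> B \<in> carrier_mat n n \<Longrightarrow> A * B = 1\<^sub>m n \<Longrightarrow> B * A = 1\<^sub>m n \<Longrightarrow>
    inv\<^bsub>GL n\<^esub> A = (B :: 'a::comm_ring_1 mat)"
  by (rule group.inv_equality[OF GL_group]) (auto intro: GL_I)

lemma mult_left_inverse_cancel:
  "A \<in> carrier_mat n n \<Longrightarrow> B \<in> carrier_mat n n \<Longrightarrow> C \<in> carrier_mat n m \<Longrightarrow> A * B = 1\<^sub>m n \<Longrightarrow>
    A * (B * C) = (C :: 'a::comm_ring_1 mat)"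
  by (simp add: assoc_mult_mat[symmetric, of A n n B n C m])

lemma GL_mat_sum:
  assumes "A \<in> carrier (GL a)" "B \<in> carrier (GL b)"
  shows "A \<bottom> B \<in> carrier (GL (a + b))"
    and "inv\<^bsub>GL (a + b)\<^esub> (A \<bottom> B) = inv\<^bsub>GL a\<^esub> A \<bottom> inv\<^bsub>GL b\<^esub> B"
proof -
  have 1: "(A \<bottom> B) * (inv\<^bsub>GL a\<^esub> A \<bottom> inv\<^bsub>GL b\<^esub> B) = 1\<^sub>m (a + b)"
    "(inv\<^bsub>GL a\<^esub> A \<bottom> inv\<^bsub>GL b\<^esub> B) * (A \<bottom> B) = 1\<^sub>m (a + b)"
    using assms mat_sum_mult[of A a a "inv\<^bsub>GL a\<^esub> A" a B b b "inv\<^bsub>GL b\<^esub> B" b]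
      mat_sum_mult[of "inv\<^bsub>GL a\<^esub> A" a a A a "inv\<^bsub>GL b\<^esub> B" b b B b] by simp_all
  show "A \<bottom> B \<in> carrier (GL (a + b))"
    by (rule GL_I[OF _ _ 1]) (use assms in auto)
  show "inv\<^bsub>GL (a + b)\<^esub> (A \<bottom> B) = inv\<^bsub>GL a\<^esub> A \<bottom> inv\<^bsub>GL b\<^esub> B"
    by (rule GL_inv_eq[OF _ _ 1]) (use assms in auto)
qed

lemma GL_transpose [simp]:
  assumes "A \<in> carrier (GL n)"
  shows "transpose_mat A \<in> carrier (GL n)"
proof (rule GL_I)
  have A: "A \<in> carrier_mat n n" "inv\<^bsub>GL n\<^esub> A \<in> carrier_mat n n" using assms by auto
  show "transpose_mat A * transpose_mat (inv\<^bsub>GL n\<^esub> A) = 1\<^sub>m n"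
    "transpose_mat (inv\<^bsub>GL n\<^esub> A) * transpose_mat A = 1\<^sub>m n"
    using assms transpose_mult[OF A, symmetric] transpose_mult[OF A(2,1), symmetric] by simp_all
qed (use assms in auto)

text \<open>Padding on both sides in one homomorphism: \<open>l = 0\<close> is the stabilisation of
  the matrix groups, \<open>k = 0\<close> the padding used for forms.\<close>

lemma GL_mat_sum_hom:
  "group_hom (GL n) (GL (k + n + l)) (\<lambda>A. 1\<^sub>m k \<bottom> A \<bottom> 1\<^sub>m l :: 'a::comm_ring_1 mat)"
proof (intro group_hom.intro group_hom_axioms.intro GL_group homI)
  fix A B :: "'a mat" assume AB: "A \<in> carrier (GL n)" "B \<in> carrier (GL n)"
  show "1\<^sub>m k \<bottom> A \<bottom> 1\<^sub>m l \<in> carrier (GL (k + n + l))"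
    using AB by (intro GL_mat_sum GL_one)
  have "(1\<^sub>m k \<bottom> A) * (1\<^sub>m k \<bottom> B) = 1\<^sub>m k \<bottom> (A * B)"
    using AB by (subst mat_sum_mult[of _ k k _ k _ n n _ n]) auto
  moreover have "((1\<^sub>m k \<bottom> A) \<bottom> 1\<^sub>m l) * ((1\<^sub>m k \<bottom> B) \<bottom> 1\<^sub>m l) = ((1\<^sub>m k \<bottom> A) * (1\<^sub>m k \<bottom> B)) \<bottom> 1\<^sub>m l"
    using AB by (subst mat_sum_mult[of _ "k + n" "k + n" _ "k + n" _ l l _ l]) auto
  ultimately show "1\<^sub>m k \<bottom> (A \<otimes>\<^bsub>GL n\<^esub> B) \<bottom> 1\<^sub>m l =
      (1\<^sub>m k \<bottom> A \<bottom> 1\<^sub>m l) \<otimes>\<^bsub>GL (k + n + l)\<^esub> (1\<^sub>m k \<bottom> B \<bottom> 1\<^sub>m l)"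
    by simp
qed


section \<open>Congruence modulo an ideal\<close>

text \<open>A bare set with closure properties, so that \<open>UNIV\<close> is an instance; every
  relative result then contains its absolute version.\<close>

locale ideal_set =
  fixes I :: "'a::comm_ring_1 set"
  assumes zero [simp]: "0 \<in> I"
    and add [intro]: "a \<in> I \<Longrightarrow> b \<in> I \<Longrightarrow> a + b \<in> I"
    and mult_left [intro]: "a \<in> I \<Longrightarrow> r * a \<in> I"
begin

lemma mult_right [intro]: "a \<in> I \<Longrightarrow> a * r \<in> I"
  using mult_left[of a r] by (simp add: mult.commute)

lemma uminus [intro]: "a \<in> I \<Longrightarrow> - a \<in> I"
  using mult_left[of a "- 1"] by simp

lemma sum_closed: "(\<And>x. x \<in> X \<Longrightarrow> f x \<in> I) \<Longrightarrow> sum f X \<in> I"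
  by (induction X rule: infinite_finite_induct) auto

lemma mat_cong_refl [simp]: "mat_cong I A A"
  by (simp add: mat_cong_def)

lemma mat_cong_sym: "mat_cong I A B \<Longrightarrow> mat_cong I B A"
  using uminus unfolding mat_cong_def by (metis minus_diff_eq)

lemma mat_cong_transpose: "mat_cong I A B \<Longrightarrow> mat_cong I (transpose_mat A) (transpose_mat B)"
  by (auto simp: mat_cong_def)

lemma mat_cong_mat_sum: "mat_cong I A B \<Longrightarrow> mat_cong I C D \<Longrightarrow> mat_cong I (A \<bottom> C) (B \<bottom> D)"
  by (auto simp: mat_cong_def mat_sum_index)

lemma mat_cong_mult:
  assumes "mat_cong I A B" "mat_cong I C D" "dim_col A = dim_row C"
  shows "mat_cong I (A * C) (B * D)"
  unfolding mat_cong_def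
proof (intro conjI allI impI)
  have d: "dim_row B = dim_row A" "dim_col B = dim_col A" "dim_row D = dim_row C" "dim_col D = dim_col C"
    using assms by (auto simp: mat_cong_def)
  show "dim_row (A * C) = dim_row (B * D)" "dim_col (A * C) = dim_col (B * D)" using d by auto
  fix i j assume ij: "i < dim_row (A * C)" "j < dim_col (A * C)"
  have "(A * C) $$ (i, j) - (B * D) $$ (i, j) =
      (\<Sum>k = 0..<dim_row C. A $$ (i, k) * (C $$ (k, j) - D $$ (k, j)) + (A $$ (i, k) - B $$ (i, k)) * D $$ (k, j))"
    using ij d assms(3) by (simp add: scalar_prod_def sum_subtractf[symmetric] algebra_simps)
  also have "\<dots> \<in> I"
    using assms ij by (intro sum_closed add mult_left mult_right) (auto simp: mat_cong_def)
  finally show "(A * C) $$ (i, j) - (B * D) $$ (i, j) \<in> I" .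
qed

lemma GL_rel_iff: "A \<in> GL_rel n I \<longleftrightarrow> A \<in> carrier (GL n) \<and> mat_cong I A (1\<^sub>m n)"
  by (simp add: GL_rel_def)

lemma GL_rel_inv: "A \<in> GL_rel n I \<Longrightarrow> inv\<^bsub>GL n\<^esub> A \<in> GL_rel n I"
  using mat_cong_mult[of "inv\<^bsub>GL n\<^esub> A" "inv\<^bsub>GL n\<^esub> A" A "1\<^sub>m n"]
    GL_dim[of A n] GL_dim[of "inv\<^bsub>GL n\<^esub> A" n] right_mult_one_mat[OF GL_carrier_mat, of "inv\<^bsub>GL n\<^esub> A" n]
  by (simp add: GL_rel_iff mat_cong_sym)

lemma GL_rel_mult: "A \<in> GL_rel n I \<Longrightarrow> B \<in> GL_rel n I \<Longrightarrow> A * B \<in> GL_rel n I"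
  using mat_cong_mult[of A "1\<^sub>m n" B "1\<^sub>m n"] GL_dim[of A n] GL_dim[of B n]
  by (simp add: GL_rel_iff)

lemma GL_rel_subgroup: "subgroup (GL_rel n I) (GL n)"
  using GL_rel_inv GL_rel_mult by unfold_locales (auto simp: GL_rel_iff)

lemma GL_rel_normalised:
  assumes "A \<in> carrier (GL n)" "B \<in> GL_rel n I"
  shows "A * B * inv\<^bsub>GL n\<^esub> A \<in> GL_rel n I"
proof -
  have "mat_cong I (A * B * inv\<^bsub>GL n\<^esub> A) (A * 1\<^sub>m n * inv\<^bsub>GL n\<^esub> A)"
    using assms GL_dim[of A n] GL_dim[of B n] GL_dim[of "inv\<^bsub>GL n\<^esub> A" n]
    by (intro mat_cong_mult mat_cong_refl) (simp_all add: GL_rel_iff)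
  then show ?thesis
    using assms GL_carrier_mat[OF assms(1)] by (auto simp: GL_rel_iff)
qed

lemma GL_rel_mat_sum: "A \<in> GL_rel m I \<Longrightarrow> B \<in> GL_rel n I \<Longrightarrow> A \<bottom> B \<in> GL_rel (m + n) I"
  using mat_cong_mat_sum[of A "1\<^sub>m m" B "1\<^sub>m n"] by (auto simp: GL_rel_iff GL_mat_sum)

lemma GL_rel_one [simp]: "1\<^sub>m n \<in> GL_rel n I"
  by (simp add: GL_rel_iff)

end

lemma ideal_set_UNIV: "ideal_set UNIV"
  by unfold_locales auto


section \<open>Subgroups generated by conjugates\<close>

text \<open>The common pattern of \<open>E_rel\<close> and \<open>ESp_rel\<close>, where the
  conjugating set \<open>K\<close> is the absolute elementary group and not all of \<open>G\<close>.
  Functoriality and normality are proved once, for an arbitrary group.\<close>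

definition conj_gen :: "('g, 'b) monoid_scheme \<Rightarrow> 'g set \<Rightarrow> 'g set \<Rightarrow> 'g set" where
  "conj_gen G K S = generate G {k \<otimes>\<^bsub>G\<^esub> s \<otimes>\<^bsub>G\<^esub> inv\<^bsub>G\<^esub> k | k s. k \<in> K \<and> s \<in> S}"

context group
begin

lemma conj_gen_subgroup:
  assumes "K \<subseteq> carrier G" "S \<subseteq> carrier G"
  shows "subgroup (conj_gen G K S) G"
  unfolding conj_gen_def using assms by (intro generate_is_subgroup) auto

lemma conj_gen_incl: "S \<subseteq> carrier G \<Longrightarrow> \<one> \<in> K \<Longrightarrow> s \<in> S \<Longrightarrow> s \<in> conj_gen G K S"
  unfolding conj_gen_def
  by (rule generate.incl, intro CollectI exI[of _ "\<one>"] exI[of _ s]) auto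

lemma conj_mult:
  "g \<in> carrier G \<Longrightarrow> a \<in> carrier G \<Longrightarrow> b \<in> carrier G \<Longrightarrow>
    g \<otimes> (a \<otimes> b) \<otimes> inv g = (g \<otimes> a \<otimes> inv g) \<otimes> (g \<otimes> b \<otimes> inv g)"
  by (simp add: m_assoc[symmetric]) (simp add: m_assoc)

lemma conj_inv:
  "g \<in> carrier G \<Longrightarrow> a \<in> carrier G \<Longrightarrow> g \<otimes> inv a \<otimes> inv g = inv (g \<otimes> a \<otimes> inv g)"
  by (simp add: inv_mult_group m_assoc)

lemma conj_conj:
  "g \<in> carrier G \<Longrightarrow> k \<in> carrier G \<Longrightarrow> a \<in> carrier G \<Longrightarrow>
    g \<otimes> (k \<otimes> a \<otimes> inv k) \<otimes> inv g = (g \<otimes> k) \<otimes> a \<otimes> inv (g \<otimes> k)"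
  by (simp add: inv_mult_group m_assoc)

text \<open>Bounds a relative group from above without looking at conjugated generators; applied to
  congruence subgroups, to determinant 1 and to the inclusion of the symplectic in the linear
  group.\<close>

lemma conj_gen_minimal:
  assumes "subgroup P G" "S \<subseteq> P" "\<And>k p. k \<in> K \<Longrightarrow> p \<in> P \<Longrightarrow> k \<otimes> p \<otimes> inv k \<in> P"
  shows "conj_gen G K S \<subseteq> P"
  unfolding conj_gen_def using assms by (intro generate_subgroup_incl) auto

end

lemma (in group_hom) conj_gen_img:
  assumes "K \<subseteq> carrier G" "S \<subseteq> carrier G" "h ` K \<subseteq> K'" "h ` S \<subseteq> S'"
    and "K' \<subseteq> carrier H" "S' \<subseteq> carrier H"
    and x: "x \<in> conj_gen G K S"
  shows "h x \<in> conj_gen H K' S'"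
proof -
  let ?A = "{k \<otimes>\<^bsub>G\<^esub> s \<otimes>\<^bsub>G\<^esub> inv\<^bsub>G\<^esub> k | k s. k \<in> K \<and> s \<in> S}"
  let ?B = "{k \<otimes>\<^bsub>H\<^esub> s \<otimes>\<^bsub>H\<^esub> inv\<^bsub>H\<^esub> k | k s. k \<in> K' \<and> s \<in> S'}"
  have A: "?A \<subseteq> carrier G" using assms(1,2) by auto
  have "h ` ?A \<subseteq> ?B"
  proof
    fix y assume "y \<in> h ` ?A"
    then obtain k s where "y = h (k \<otimes>\<^bsub>G\<^esub> s \<otimes>\<^bsub>G\<^esub> inv\<^bsub>G\<^esub> k)" "k \<in> K" "s \<in> S" by auto
    then have "y = h k \<otimes>\<^bsub>H\<^esub> h s \<otimes>\<^bsub>H\<^esub> inv\<^bsub>H\<^esub> (h k)" "h k \<in> K'" "h s \<in> S'"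
      using assms(1-4) by (auto simp: subset_eq)
    then show "y \<in> ?B" by blast
  qed
  moreover have "h x \<in> generate H (h ` ?A)"
    using generate_img[OF A] x unfolding conj_gen_def by auto
  ultimately show ?thesis
    unfolding conj_gen_def using H.mono_generate by blast
qed

text \<open>Since \<open>q (k s k^-1) q^-1 = (q k) s (q k)^-1\<close> and \<open>q k\<close> stays
  in \<open>Q\<close>, the conjugates of bare generators decide about the whole group. The
  homomorphism \<open>h\<close> is there for stabilisation: conjugates may enter the target group
  only after the matrices have been enlarged.\<close>

lemma (in group_hom) conj_gen_conj:
  assumes K: "K \<subseteq> Q" and Q: "subgroup Q G" and S: "S \<subseteq> carrier G" and T: "subgroup T H"
    and gen: "\<And>q s. q \<in> Q \<Longrightarrow> s \<in> S \<Longrightarrow> h (q \<otimes>\<^bsub>G\<^esub> s \<otimes>\<^bsub>G\<^esub> inv\<^bsub>G\<^esub> q) \<in> T"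
    and q: "q \<in> Q" and x: "x \<in> conj_gen G K S"
  shows "h (q \<otimes>\<^bsub>G\<^esub> x \<otimes>\<^bsub>G\<^esub> inv\<^bsub>G\<^esub> q) \<in> T"
proof -
  let ?A = "{k \<otimes>\<^bsub>G\<^esub> s \<otimes>\<^bsub>G\<^esub> inv\<^bsub>G\<^esub> k | k s. k \<in> K \<and> s \<in> S}"
  interpret Q: subgroup Q G by (rule Q)
  interpret T: subgroup T H by (rule T)
  have c: "q \<in> carrier G" using q by (rule Q.mem_carrier)
  have KG: "K \<subseteq> carrier G" using K Q.subset by blast
  then have A: "?A \<subseteq> carrier G" using S by auto
  have base: "h (q \<otimes>\<^bsub>G\<^esub> y \<otimes>\<^bsub>G\<^esub> inv\<^bsub>G\<^esub> q) \<in> T" if y: "y \<in> ?A" for y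
  proof -
    obtain k s where ks: "y = k \<otimes>\<^bsub>G\<^esub> s \<otimes>\<^bsub>G\<^esub> inv\<^bsub>G\<^esub> k" "k \<in> K" "s \<in> S" using y by auto
    then have "k \<in> Q" "k \<in> carrier G" "s \<in> carrier G" using K S Q.subset by auto
    then show ?thesis
      using gen[of "q \<otimes>\<^bsub>G\<^esub> k" s] ks q c by (simp add: G.conj_conj Q.m_closed)
  qed
  show ?thesis
    using x[unfolded conj_gen_def]
  proof (induction rule: generate.induct)
    case one
    show ?case using c T.one_closed by simp
  next
    case (incl y)
    then show ?case by (rule base)
  next
    case (inv y)
    have "y \<in> carrier G" using inv A by blast
    then have "h (q \<otimes>\<^bsub>G\<^esub> inv\<^bsub>G\<^esub> y \<otimes>\<^bsub>G\<^esub> inv\<^bsub>G\<^esub> q) = inv\<^bsub>H\<^esub> h (q \<otimes>\<^bsub>G\<^esub> y \<otimes>\<^bsub>G\<^esub> inv\<^bsub>G\<^esub> q)"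
      using c by (subst G.conj_inv) (simp_all only: hom_inv G.m_closed G.inv_closed)
    then show ?case using T.m_inv_closed[OF base[OF inv]] by (simp only:)
  next
    case (eng y z)
    have "y \<in> carrier G" "z \<in> carrier G" using eng(1,2) G.generate_in_carrier[OF A] by blast+
    then have "h (q \<otimes>\<^bsub>G\<^esub> (y \<otimes>\<^bsub>G\<^esub> z) \<otimes>\<^bsub>G\<^esub> inv\<^bsub>G\<^esub> q) =
        h (q \<otimes>\<^bsub>G\<^esub> y \<otimes>\<^bsub>G\<^esub> inv\<^bsub>G\<^esub> q) \<otimes>\<^bsub>H\<^esub> h (q \<otimes>\<^bsub>G\<^esub> z \<otimes>\<^bsub>G\<^esub> inv\<^bsub>G\<^esub> q)"
      using c by (subst G.conj_mult) (simp_all only: hom_mult G.m_closed G.inv_closed)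
    then show ?case using T.m_closed[OF eng.IH] by (simp only:)
  qed
qed

lemma (in group) conj_gen_normalised:
  assumes "subgroup K G" "S \<subseteq> carrier G" "k \<in> K" "x \<in> conj_gen G K S"
  shows "k \<otimes> x \<otimes> inv k \<in> conj_gen G K S"
proof -
  interpret id: group_hom G G "\<lambda>x. x" by unfold_locales (simp add: hom_def)
  have "q \<otimes> s \<otimes> inv q \<in> conj_gen G K S" if "q \<in> K" "s \<in> S" for q s
    unfolding conj_gen_def using that by (intro generate.incl) blast
  then show ?thesis
    by (rule id.conj_gen_conj[OF order_refl assms(1,2) conj_gen_subgroup[OF subgroup.subset[OF assms(1)] assms(2)] _ assms(3,4)])
qed

section \<open>Elementary matrices\<close>

lemma mat_unit_carrier [simp]: "mat_unit n i j \<in> carrier_mat n n"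
  by (simp add: mat_unit_def)

lemma elem_mat_carrier [simp]: "elem_mat n i j a \<in> carrier_mat n n"
  by (simp add: elem_mat_def)

lemma elem_mat_index:
  "k < n \<Longrightarrow> l < n \<Longrightarrow>
    elem_mat n i j a $$ (k, l) = (if k = l then 1 else 0) + (if k = i \<and> l = j then a else 0)"
  by (simp add: elem_mat_def mat_unit_def)

lemma elem_mat_dim [simp]: "dim_row (elem_mat n i j a) = n" "dim_col (elem_mat n i j a) = n"
  by (simp_all add: elem_mat_def mat_unit_def)

lemma det_elem_mat:
  assumes "i < n" "j < n" "i \<noteq> j"
  shows "det (elem_mat n i j a) = 1"
proof -
  have "elem_mat n i j a = addrow_mat n a i j"
    using assms by (intro eq_matI) (auto simp: elem_mat_index)
  then show ?thesis using assms by (simp add: det_addrow_mat)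
qed

lemma elem_mat_mult_right:
  assumes "A \<in> carrier_mat n n" "i < n" "j < n" "k < n" "l < n"
  shows "(A * elem_mat n i j a) $$ (k, l) = A $$ (k, l) + (if l = j then A $$ (k, i) * a else 0)"
proof -
  have "(A * elem_mat n i j a) $$ (k, l) =
      (\<Sum>m = 0..<n. A $$ (k, m) * ((if m = l then 1 else 0) + (if m = i \<and> l = j then a else 0)))"
    using assms by (simp add: scalar_prod_def elem_mat_index)
  also have "\<dots> = (\<Sum>m = 0..<n. (if m = l then A $$ (k, m) else 0)) +
      (\<Sum>m = 0..<n. if m = i then (if l = j then A $$ (k, m) * a else 0) else 0)"
    unfolding sum.distrib[symmetric] by (intro sum.cong) (auto simp: algebra_simps)
  finally show ?thesis using assms by simp
qed

definition elem_set :: "nat \<Rightarrow> 'a::comm_ring_1 set \<Rightarrow> 'a mat set" where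
  "elem_set n I = {elem_mat n i j a | i j a. i < n \<and> j < n \<and> i \<noteq> j \<and> a \<in> I}"

lemma elem_mat_GL:
  assumes "i < n" "j < n" "i \<noteq> j"
  shows "elem_mat n i j a \<in> carrier (GL n)"
proof -
  have "elem_mat n i j a * elem_mat n i j (- a) = 1\<^sub>m n" for a :: 'a
    using assms by (intro eq_matI) (auto simp: elem_mat_mult_right elem_mat_index simp del: index_mult_mat(1))
  from this[of a] this[of "- a"] show ?thesis by (intro GL_I) auto
qed

lemma elem_set_GL: "elem_set n I \<subseteq> carrier (GL n)"
  by (auto simp: elem_set_def elem_mat_GL)

lemma E_generate: "E n = generate (GL n) (elem_set n UNIV)"
  by (simp add: E_def elem_set_def)

lemma E_subgroup: "subgroup (E n) (GL n)"
  unfolding E_generate by (rule group.generate_is_subgroup[OF GL_group elem_set_GL])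

lemma E_GL: "E n \<subseteq> carrier (GL n)"
  by (rule subgroup.subset[OF E_subgroup])

lemma E_rel_conj_gen: "E_rel n I = conj_gen (GL n) (E n) (elem_set n I)"
  unfolding E_rel_def conj_gen_def elem_set_def
  by (rule arg_cong[where f = "generate (GL n)"]) (simp, blast)

lemma E_rel_subgroup: "subgroup (E_rel n I) (GL n)"
  unfolding E_rel_conj_gen by (rule group.conj_gen_subgroup[OF GL_group E_GL elem_set_GL])

lemma E_rel_GL: "E_rel n I \<subseteq> carrier (GL n)"
  by (rule subgroup.subset[OF E_rel_subgroup])

lemma E_rel_mult: "A \<in> E_rel n I \<Longrightarrow> B \<in> E_rel n I \<Longrightarrow> A * B \<in> E_rel n I"
  using subgroup.m_closed[OF E_rel_subgroup, of A n I B] by simp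

lemma E_rel_inv: "A \<in> E_rel n I \<Longrightarrow> inv\<^bsub>GL n\<^esub> A \<in> E_rel n I"
  by (rule subgroup.m_inv_closed[OF E_rel_subgroup])

lemma E_rel_one [simp]: "1\<^sub>m n \<in> E_rel n I"
  using subgroup.one_closed[OF E_rel_subgroup, of n I] by simp

lemma E_rel_carrier_mat: "A \<in> E_rel n I \<Longrightarrow> A \<in> carrier_mat n n"
  using E_rel_GL by blast

lemma elem_mat_E_rel:
  assumes "i < n" "j < n" "i \<noteq> j" "a \<in> I"
  shows "elem_mat n i j a \<in> E_rel n I"
  unfolding E_rel_conj_gen
  by (rule group.conj_gen_incl[OF GL_group elem_set_GL])
    (use assms subgroup.one_closed[OF E_subgroup, of n] in \<open>auto simp: elem_set_def\<close>)

lemma E_rel_normalised: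
  "A \<in> E n \<Longrightarrow> B \<in> E_rel n I \<Longrightarrow> A * B * inv\<^bsub>GL n\<^esub> A \<in> E_rel n I"
  using group.conj_gen_normalised[OF GL_group E_subgroup elem_set_GL, of A n B I]
  by (simp add: E_rel_conj_gen)

lemma E_rel_UNIV: "E_rel n UNIV = E n"
proof
  show "E_rel n UNIV \<subseteq> E n"
    unfolding E_rel_conj_gen
  proof (rule group.conj_gen_minimal[OF GL_group E_subgroup])
    show "elem_set n UNIV \<subseteq> E n"
      unfolding E_generate by (auto intro: generate.incl)
    show "k \<otimes>\<^bsub>GL n\<^esub> p \<otimes>\<^bsub>GL n\<^esub> inv\<^bsub>GL n\<^esub> k \<in> E n"
      if "k \<in> E n" "p \<in> E n" for k p
      using that subgroup.m_closed[OF E_subgroup] subgroup.m_inv_closed[OF E_subgroup] by blast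
  qed
  show "E n \<subseteq> E_rel n UNIV"
    unfolding E_generate
    by (rule group.generate_subgroup_incl[OF GL_group _ E_rel_subgroup])
      (auto simp: elem_set_def intro: elem_mat_E_rel)
qed

text \<open>The condition on generators serves two sets: \<open>UNIV\<close> for the conjugating
  matrices, \<open>I\<close> for the conjugated ones.\<close>

lemma E_conj_img:
  assumes h: "group_hom (GL m) (GL n) h" and S: "\<And>I. h ` elem_set m I \<subseteq> elem_set n I"
    and x: "x \<in> E_rel m I"
  shows "h x \<in> E_rel n I"
proof -
  have "h ` E m \<subseteq> E n"
  proof -
    have "h ` E m = generate (GL n) (h ` elem_set m UNIV)"
      unfolding E_generate by (rule group_hom.generate_img[OF h elem_set_GL, symmetric])
    also have "\<dots> \<subseteq> E n"
      unfolding E_generate by (rule group.mono_generate[OF GL_group S])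
    finally show ?thesis .
  qed
  from group_hom.conj_gen_img[OF h E_GL elem_set_GL this S E_GL elem_set_GL] show ?thesis
    using x unfolding E_rel_conj_gen by blast
qed

lemma mat_sum_elem_mat:
  assumes "i < n" "j < n"
  shows "1\<^sub>m k \<bottom> elem_mat n i j a \<bottom> 1\<^sub>m l = elem_mat (k + n + l) (k + i) (k + j) a"
proof (rule eq_matI)
  fix r c assume "r < dim_row (elem_mat (k + n + l) (k + i) (k + j) a)"
    "c < dim_col (elem_mat (k + n + l) (k + i) (k + j) a)"
  then have rc: "r < k + n + l" "c < k + n + l" by simp_all
  have e: "r - k = i \<longleftrightarrow> r = k + i" "c - k = j \<longleftrightarrow> c = k + j" "r - k = c - k \<longleftrightarrow> r = c"
    if "k \<le> r" "k \<le> c"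
    using that by auto
  have "r < k \<Longrightarrow> r \<noteq> k + i" "c < k \<Longrightarrow> c \<noteq> k + j" "k + n \<le> r \<Longrightarrow> r \<noteq> k + i" "k + n \<le> c \<Longrightarrow> c \<noteq> k + j"
    using assms by auto
  note ne = this
  have e': "r - (k + n) = c - (k + n) \<longleftrightarrow> r = c" if "k + n \<le> r" "k + n \<le> c"
    using that by auto
  consider "r < k" | "k + n \<le> r" | "k \<le> r" "r < k + n" by linarith
  note r_cases = this
  consider "c < k" | "k + n \<le> c" | "k \<le> c" "c < k + n" by linarith
  then show "(1\<^sub>m k \<bottom> elem_mat n i j a \<bottom> 1\<^sub>m l) $$ (r, c) = elem_mat (k + n + l) (k + i) (k + j) a $$ (r, c)"
    by (cases; cases rule: r_cases)
      (use rc ne in \<open>simp_all add: mat_sum_index elem_mat_index e e'\<close>)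
qed simp_all

lemma E_rel_mat_sum:
  assumes "A \<in> E_rel n I"
  shows "1\<^sub>m k \<bottom> A \<bottom> 1\<^sub>m l \<in> E_rel (k + n + l) I"
proof (rule E_conj_img[OF GL_mat_sum_hom _ assms])
  fix I :: "'a set"
  show "(\<lambda>A. 1\<^sub>m k \<bottom> A \<bottom> 1\<^sub>m l) ` elem_set n I \<subseteq> elem_set (k + n + l) I"
  proof clarify
    fix A assume "A \<in> elem_set n I"
    then obtain i j a where "A = elem_mat n i j a" "i < n" "j < n" "i \<noteq> j" "a \<in> I"
      by (auto simp: elem_set_def)
    then have "1\<^sub>m k \<bottom> A \<bottom> 1\<^sub>m l = elem_mat (k + n + l) (k + i) (k + j) a"
      "k + i < k + n + l" "k + j < k + n + l" "k + i \<noteq> k + j" "a \<in> I"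
      by (simp_all add: mat_sum_elem_mat)
    then show "1\<^sub>m k \<bottom> A \<bottom> 1\<^sub>m l \<in> elem_set (k + n + l) I"
      unfolding elem_set_def by blast
  qed
qed

lemma E_rel_one_sum: "A \<in> E_rel n I \<Longrightarrow> 1\<^sub>m k \<bottom> A \<in> E_rel (k + n) I"
  using E_rel_mat_sum[of A n I k 0] by simp

text \<open>Conjugation by the monomial matrix with signs \<open>d\<close> and permutation \<open>p\<close>.  As its inverse is its
  transpose, the same formula transforms endomorphisms and bilinear forms.\<close>

definition monomial_conj :: "nat \<Rightarrow> (nat \<Rightarrow> nat) \<Rightarrow> (nat \<Rightarrow> 'a::comm_ring_1) \<Rightarrow> 'a mat \<Rightarrow> 'a mat" where
  "monomial_conj n p d A = mat n n (\<lambda>(i, j). d i * d j * A $$ (p i, p j))"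

lemma monomial_conj_carrier [simp]: "monomial_conj n p d A \<in> carrier_mat n n"
  by (simp add: monomial_conj_def)

locale monomial =
  fixes n :: nat and p :: "nat \<Rightarrow> nat" and d :: "nat \<Rightarrow> 'a::comm_ring_1"
  assumes perm: "bij_betw p {0..<n} {0..<n}" and sign: "d i * d i = 1"
begin

lemma p_less [simp]: "i < n \<Longrightarrow> p i < n"
  using bij_betwE[OF perm] by simp

lemma p_inj: "i < n \<Longrightarrow> j < n \<Longrightarrow> p i = p j \<longleftrightarrow> i = j"
  using inj_on_eq_iff[OF bij_betw_imp_inj_on[OF perm]] by simp

lemma monomial_conj_one: "monomial_conj n p d (1\<^sub>m n) = 1\<^sub>m n"
  by (rule eq_matI) (auto simp: monomial_conj_def p_inj sign)

lemma monomial_conj_transpose: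
  "A \<in> carrier_mat n n \<Longrightarrow> transpose_mat (monomial_conj n p d A) = monomial_conj n p d (transpose_mat A)"
  by (rule eq_matI) (auto simp: monomial_conj_def mult.commute)

lemma monomial_conj_mult:
  assumes "A \<in> carrier_mat n n" "B \<in> carrier_mat n n"
  shows "monomial_conj n p d (A * B) = monomial_conj n p d A * monomial_conj n p d B"
proof (rule eq_matI)
  fix i j assume "i < dim_row (monomial_conj n p d A * monomial_conj n p d B)"
    "j < dim_col (monomial_conj n p d A * monomial_conj n p d B)"
  then have ij: "i < n" "j < n" by (auto simp: monomial_conj_def)
  have "(monomial_conj n p d A * monomial_conj n p d B) $$ (i, j) =
      (\<Sum>k = 0..<n. (d k * d k) * (d i * d j * (A $$ (p i, p k) * B $$ (p k, p j))))"
    using ij assms by (simp add: monomial_conj_def scalar_prod_def ac_simps)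
  also have "\<dots> = (\<Sum>k = 0..<n. d i * d j * (A $$ (p i, p k) * B $$ (p k, p j)))"
    by (simp only: sign mult_1_left)
  also have "\<dots> = d i * d j * (\<Sum>k = 0..<n. A $$ (p i, k) * B $$ (k, p j))"
    unfolding sum_distrib_left[symmetric]
    by (subst sum.reindex_bij_betw[OF perm, of "\<lambda>k. A $$ (p i, k) * B $$ (k, p j)"]) simp
  also have "\<dots> = monomial_conj n p d (A * B) $$ (i, j)"
    using ij assms by (simp add: monomial_conj_def scalar_prod_def)
  finally show "monomial_conj n p d (A * B) $$ (i, j) =
      (monomial_conj n p d A * monomial_conj n p d B) $$ (i, j)" by simp
qed (auto simp: monomial_conj_def)

lemma monomial_conj_hom: "group_hom (GL n) (GL n) (monomial_conj n p d)"
proof (intro group_hom.intro group_hom_axioms.intro GL_group homI)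
  fix A :: "'a mat" assume A: "A \<in> carrier (GL n)"
  have c: "A \<in> carrier_mat n n" "inv\<^bsub>GL n\<^esub> A \<in> carrier_mat n n"
    using A GL_inv[OF A] by (blast intro: GL_carrier_mat)+
  show "monomial_conj n p d A \<in> carrier (GL n)"
    by (rule GL_I[where B = "monomial_conj n p d (inv\<^bsub>GL n\<^esub> A)"])
      (simp_all add: A c monomial_conj_mult[symmetric] monomial_conj_one)
qed (simp add: monomial_conj_mult)

lemma monomial_conj_elem_mat:
  assumes "i < n" "j < n" "i \<noteq> j"
  shows "monomial_conj n p d (elem_mat n (p i) (p j) a) = elem_mat n i j (d i * d j * a)"
  using assms by (intro eq_matI) (auto simp: monomial_conj_def elem_mat_index p_inj sign)

text \<open>Such a conjugation permutes the elementary matrices and rescales their entries by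
  \<open>d i * d j\<close>, so generators go to generators and conjugators to conjugators. The
  monomial matrix itself may lie outside \<open>E n\<close>.\<close>

lemma monomial_conj_E_rel:
  assumes "ideal_set I" "A \<in> E_rel n I"
  shows "monomial_conj n p d A \<in> E_rel n I"
proof -
  have *: "monomial_conj n p d A \<in> elem_set n J" if J: "ideal_set J" and A: "A \<in> elem_set n J" for A J
  proof -
    interpret J: ideal_set J by fact
    obtain i j a where A: "A = elem_mat n i j a" and ij: "i < n" "j < n" "i \<noteq> j" "a \<in> J"
      using A by (auto simp: elem_set_def)
    have "p ` {0..<n} = {0..<n}" using perm by (simp add: bij_betw_def)
    then have "i \<in> p ` {0..<n}" "j \<in> p ` {0..<n}" using ij by auto
    then obtain i' j' where i: "i = p i'" "j = p j'" "i' < n" "j' < n" by auto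
    have "i' \<noteq> j'" using i ij by auto
    moreover have "monomial_conj n p d A = elem_mat n i' j' (d i' * d j' * a)"
      using i \<open>i' \<noteq> j'\<close> by (simp add: A monomial_conj_elem_mat)
    moreover have "d i' * d j' * a \<in> J" using ij by auto
    ultimately show ?thesis using i unfolding elem_set_def by blast
  qed
  interpret group_hom "GL n" "GL n" "monomial_conj n p d" by (rule monomial_conj_hom)
  have "monomial_conj n p d ` E n \<subseteq> E n"
  proof -
    have "monomial_conj n p d ` E n = generate (GL n) (monomial_conj n p d ` elem_set n UNIV)"
      unfolding E_generate by (rule generate_img[OF elem_set_GL, symmetric])
    also have "\<dots> \<subseteq> E n"
      unfolding E_generate using *[OF ideal_set_UNIV] by (intro group.mono_generate[OF GL_group]) blast
    finally show ?thesis .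
  qed
  then show ?thesis
    using assms *[OF assms(1)] unfolding E_rel_conj_gen
    by (intro conj_gen_img[OF E_GL elem_set_GL _ _ E_GL elem_set_GL]) blast+
qed

end

context ideal_set
begin

lemma elem_set_GL_rel: "elem_set n I \<subseteq> GL_rel n I"
proof
  fix A assume "A \<in> elem_set n I"
  then obtain i j a where "A = elem_mat n i j a" "i < n" "j < n" "i \<noteq> j" "a \<in> I"
    by (auto simp: elem_set_def)
  then show "A \<in> GL_rel n I"
    by (auto simp: GL_rel_iff elem_mat_GL mat_cong_def elem_mat_index)
qed

lemma E_rel_subset_GL_rel: "E_rel n I \<subseteq> GL_rel n I"
  unfolding E_rel_conj_gen
proof (rule group.conj_gen_minimal[OF GL_group GL_rel_subgroup elem_set_GL_rel])
  show "k \<otimes>\<^bsub>GL n\<^esub> p \<otimes>\<^bsub>GL n\<^esub> inv\<^bsub>GL n\<^esub> k \<in> GL_rel n I" if "k \<in> E n" "p \<in> GL_rel n I" for k p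
    using GL_rel_normalised[of k n p] that E_GL by auto
qed

end

lemma GL_det_inv:
  assumes "A \<in> carrier (GL n)"
  shows "det A * det (inv\<^bsub>GL n\<^esub> A) = 1"
  using det_mult[of A n "inv\<^bsub>GL n\<^esub> A"] GL_carrier_mat[OF assms] GL_carrier_mat[OF GL_inv[OF assms]] assms
  by simp

lemma SL_subgroup: "subgroup {A \<in> carrier (GL n). det A = (1::'a::comm_ring_1)} (GL n)"
proof -
  interpret group "GL n :: 'a mat monoid" by (rule GL_group)
  show ?thesis
  proof (intro subgroupI)
    fix A :: "'a mat" assume A: "A \<in> {A \<in> carrier (GL n). det A = 1}"
    then show "inv\<^bsub>GL n\<^esub> A \<in> {A \<in> carrier (GL n). det A = 1}"
      using GL_det_inv[of A n] by simp
    fix B :: "'a mat" assume "B \<in> {A \<in> carrier (GL n). det A = 1}"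
    then show "A \<otimes>\<^bsub>GL n\<^esub> B \<in> {A \<in> carrier (GL n). det A = 1}"
      using A det_mult[of A n B] by auto
  qed (use GL_one[of n] in \<open>auto intro!: exI[of _ "1\<^sub>m n"]\<close>)
qed

lemma det_E_rel: "A \<in> E_rel n I \<Longrightarrow> det A = 1"
proof -
  have "E_rel n I \<subseteq> {A \<in> carrier (GL n). det A = 1}"
    unfolding E_rel_conj_gen
  proof (rule group.conj_gen_minimal[OF GL_group SL_subgroup])
    show "elem_set n I \<subseteq> {A \<in> carrier (GL n). det A = 1}"
      using elem_set_GL[of n I] by (auto simp: elem_set_def det_elem_mat)
    show "k \<otimes>\<^bsub>GL n\<^esub> p \<otimes>\<^bsub>GL n\<^esub> inv\<^bsub>GL n\<^esub> k \<in> {A \<in> carrier (GL n). det A = 1}"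
      if "k \<in> E n" "p \<in> {A \<in> carrier (GL n). det A = 1}" for k p :: "'a mat"
    proof -
      have k: "k \<in> carrier (GL n)" "p \<in> carrier (GL n)" "det p = 1" using that E_GL by auto
      then have "det (k * p * inv\<^bsub>GL n\<^esub> k) = det k * det p * det (inv\<^bsub>GL n\<^esub> k)"
        by (subst det_mult[of _ n], auto)+
      then show ?thesis using k GL_det_inv[OF k(1)] by simp
    qed
  qed
  then show "A \<in> E_rel n I \<Longrightarrow> det A = 1" by auto
qed


section \<open>The relative Whitehead lemma\<close>

context ideal_set
begin

text \<open>With rows in \<open>P\<close> and columns outside \<open>P\<close> no row index of an
  entry is a column index of another, so the entries can be written in one by one, each by a single
  elementary factor.\<close>

lemma one_plus_in_E_rel:
  assumes X: "X \<in> carrier_mat n n" "\<And>i j. i < n \<Longrightarrow> j < n \<Longrightarrow> X $$ (i, j) \<in> I"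
    and supp: "\<And>i j. i < n \<Longrightarrow> j < n \<Longrightarrow> X $$ (i, j) \<noteq> 0 \<Longrightarrow> i \<in> P \<and> j \<notin> P"
  shows "1\<^sub>m n + X \<in> E_rel n I"
proof -
  define part where "part F = mat n n (\<lambda>q. (if fst q = snd q then 1 else 0) + (if q \<in> F then X $$ q else 0))" for F
  have "part F \<in> E_rel n I" if "finite F" "F \<subseteq> (P \<inter> {0..<n}) \<times> ({0..<n} - P)" for F
    using that
  proof (induction F rule: finite_induct)
    case empty
    have "part {} = 1\<^sub>m n" by (rule eq_matI) (auto simp: part_def)
    then show ?case by simp
  next
    case (insert q F)
    obtain i j where q: "q = (i, j)" by fastforce
    have ij: "i < n" "j < n" "i \<in> P" "j \<notin> P" "i \<noteq> j" using insert q by auto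
    \<comment> \<open>Column \<open>i\<close> of \<open>part F\<close> is still a unit column
      because \<open>i \<in> P\<close>; hence right multiplication by the elementary matrix changes
      nothing but the entry \<open>(i, j)\<close>.\<close>
    have "(k, i) \<notin> F" for k using insert.prems ij by auto
    then have "part (insert q F) = part F * elem_mat n i j (X $$ (i, j))"
      using insert.hyps ij
      by (intro eq_matI)
        (auto simp: part_def q elem_mat_mult_right simp del: index_mult_mat(1))
    moreover have "elem_mat n i j (X $$ (i, j)) \<in> E_rel n I"
      using ij X by (intro elem_mat_E_rel) auto
    ultimately show ?case using insert by (auto intro: E_rel_mult)
  qed
  from this[OF _ order_refl] have "part ((P \<inter> {0..<n}) \<times> ({0..<n} - P)) \<in> E_rel n I" by simp
  moreover have "part ((P \<inter> {0..<n}) \<times> ({0..<n} - P)) = 1\<^sub>m n + X"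
    using X supp by (intro eq_matI) (auto simp: part_def)
  ultimately show ?thesis by simp
qed

lemma upper_block_E_rel:
  assumes "X \<in> carrier_mat p q" "\<And>i j. i < p \<Longrightarrow> j < q \<Longrightarrow> X $$ (i, j) \<in> I"
  shows "four_block_mat (1\<^sub>m p) X (0\<^sub>m q p) (1\<^sub>m q) \<in> E_rel (p + q) I"
proof -
  have "four_block_mat (1\<^sub>m p) X (0\<^sub>m q p) (1\<^sub>m q) =
      1\<^sub>m (p + q) + four_block_mat (0\<^sub>m p p) X (0\<^sub>m q p) (0\<^sub>m q q)"
    using assms by (intro eq_matI) auto
  also have "\<dots> \<in> E_rel (p + q) I"
    by (rule one_plus_in_E_rel[where P = "{0..<p}"]) (use assms in \<open>auto split: if_splits\<close>)
  finally show ?thesis .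
qed

lemma lower_block_E_rel:
  assumes "X \<in> carrier_mat q p" "\<And>i j. i < q \<Longrightarrow> j < p \<Longrightarrow> X $$ (i, j) \<in> I"
  shows "four_block_mat (1\<^sub>m p) (0\<^sub>m p q) X (1\<^sub>m q) \<in> E_rel (p + q) I"
proof -
  have "four_block_mat (1\<^sub>m p) (0\<^sub>m p q) X (1\<^sub>m q) =
      1\<^sub>m (p + q) + four_block_mat (0\<^sub>m p p) (0\<^sub>m p q) X (0\<^sub>m q q)"
    using assms by (intro eq_matI) auto
  also have "\<dots> \<in> E_rel (p + q) I"
    by (rule one_plus_in_E_rel[where P = "{p..}"]) (use assms in \<open>auto split: if_splits\<close>)
  finally show ?thesis .
qed

end

section \<open>Block unipotent matrices\<close>

lemma add_uminus_mat [simp]: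
  "X + - X = (0\<^sub>m (dim_row X) (dim_col X) :: 'a::comm_ring_1 mat)"
  "- X + X = (0\<^sub>m (dim_row X) (dim_col X) :: 'a::comm_ring_1 mat)"
  by (auto intro!: eq_matI)

lemma square_mult_closed:
  "A \<in> carrier_mat n n \<Longrightarrow> B \<in> carrier_mat n n \<Longrightarrow> A * B \<in> carrier_mat n n"
  by simp

lemma square_mult_assoc:
  "A \<in> carrier_mat n n \<Longrightarrow> B \<in> carrier_mat n n \<Longrightarrow> C \<in> carrier_mat n n \<Longrightarrow>
    (A * B) * C = A * (B * (C :: 'a::comm_ring_1 mat))"
  by (rule assoc_mult_mat)

definition upper_block :: "nat \<Rightarrow> 'a::comm_ring_1 mat \<Rightarrow> 'a mat" where
  "upper_block n X = four_block_mat (1\<^sub>m n) X (0\<^sub>m n n) (1\<^sub>m n)"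

definition lower_block :: "nat \<Rightarrow> 'a::comm_ring_1 mat \<Rightarrow> 'a mat" where
  "lower_block n X = four_block_mat (1\<^sub>m n) (0\<^sub>m n n) X (1\<^sub>m n)"

lemma block_carrier [simp]:
  "X \<in> carrier_mat n n \<Longrightarrow> upper_block n X \<in> carrier_mat (n + n) (n + n)"
  "X \<in> carrier_mat n n \<Longrightarrow> lower_block n X \<in> carrier_mat (n + n) (n + n)"
  by (simp_all add: upper_block_def lower_block_def)

lemma upper_block_mult:
  assumes "X \<in> carrier_mat n n" "Y \<in> carrier_mat n n"
  shows "upper_block n X * upper_block n Y = upper_block n (X + Y)"
  unfolding upper_block_def using assms
  by (subst mult_four_block_mat[of _ n n _ n _ n _ _ n _ n]) (auto simp: comm_add_mat[of X n n Y])

lemma lower_block_mult: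
  assumes "X \<in> carrier_mat n n" "Y \<in> carrier_mat n n"
  shows "lower_block n X * lower_block n Y = lower_block n (X + Y)"
  unfolding lower_block_def using assms
  by (subst mult_four_block_mat[of _ n n _ n _ n _ _ n _ n]) auto

lemma block_zero: "upper_block n (0\<^sub>m n n) = 1\<^sub>m (n + n)" "lower_block n (0\<^sub>m n n) = 1\<^sub>m (n + n)"
  by (simp_all add: upper_block_def lower_block_def)

context ideal_set
begin

lemma block_E_rel:
  assumes "X \<in> carrier_mat n n" "\<And>i j. i < n \<Longrightarrow> j < n \<Longrightarrow> X $$ (i, j) \<in> I"
  shows "upper_block n X \<in> E_rel (n + n) I" "lower_block n X \<in> E_rel (n + n) I"
  using upper_block_E_rel[OF assms] lower_block_E_rel[OF assms]
  by (simp_all add: upper_block_def lower_block_def)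

end

lemma block_E:
  assumes "X \<in> carrier_mat n n"
  shows "upper_block n X \<in> E (n + n)" "lower_block n X \<in> E (n + n)"
  using ideal_set.block_E_rel[OF ideal_set_UNIV assms] by (simp_all add: E_rel_UNIV)

text \<open>\<open>U(a) L(-b) U(a)\<close> is the block matrix with rows \<open>(0, a)\<close> and
  \<open>(-b, 0)\<close>, and \<open>U(-1) L(1) U(-1)\<close> the one with rows
  \<open>(0, -1)\<close> and \<open>(1, 0)\<close>; their product is \<open>a \<bottom> b\<close>.
  Merging the two adjacent upper factors into \<open>U(a - 1)\<close> exposes a factor over
  \<open>I\<close> when \<open>a\<close> is congruent to 1.\<close>

lemma mat_sum_inverse_eq:
  fixes a b :: "'a::comm_ring_1 mat"
  assumes a: "a \<in> carrier_mat n n" and b: "b \<in> carrier_mat n n"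
    and ab: "a * b = 1\<^sub>m n" and ba: "b * a = 1\<^sub>m n"
  shows "a \<bottom> b = upper_block n a * lower_block n (- b) * upper_block n (a - 1\<^sub>m n) *
    lower_block n (1\<^sub>m n) * upper_block n (- 1\<^sub>m n)"
proof -
  have 1: "upper_block n a * lower_block n (- b) = four_block_mat (0\<^sub>m n n) a (- b) (1\<^sub>m n)"
    unfolding upper_block_def lower_block_def using a b
    by (subst mult_four_block_mat[of _ n n _ n _ n _ _ n _ n]) (auto simp: ab)
  have x: "a - 1\<^sub>m n \<in> carrier_mat n n" using a by (simp add: minus_carrier_mat)
  have e: "1\<^sub>m n + (a - 1\<^sub>m n) = a" "- a + (a - 1\<^sub>m n) = - 1\<^sub>m n"
    using a by (auto intro!: eq_matI)
  have 2: "upper_block n (a - 1\<^sub>m n) * lower_block n (1\<^sub>m n) =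
      four_block_mat a (a - 1\<^sub>m n) (1\<^sub>m n) (1\<^sub>m n)"
    unfolding upper_block_def lower_block_def using x
    by (subst mult_four_block_mat[of _ n n _ n _ n _ _ n _ n]) (auto simp: e)
  have 3: "four_block_mat a (a - 1\<^sub>m n) (1\<^sub>m n) (1\<^sub>m n) * upper_block n (- 1\<^sub>m n) =
      four_block_mat a (- 1\<^sub>m n) (1\<^sub>m n) (0\<^sub>m n n)"
    unfolding upper_block_def using x a
    by (subst mult_four_block_mat[of _ n n _ n _ n _ _ n _ n]) (auto simp: e)
  have 4: "four_block_mat (0\<^sub>m n n) a (- b) (1\<^sub>m n) * four_block_mat a (- 1\<^sub>m n) (1\<^sub>m n) (0\<^sub>m n n) = a \<bottom> b"
    unfolding mat_sum_def using a b
    by (subst mult_four_block_mat[of _ n n _ n _ n _ _ n _ n]) (auto simp: ba)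
  have "upper_block n a * lower_block n (- b) * upper_block n (a - 1\<^sub>m n) *
      lower_block n (1\<^sub>m n) * upper_block n (- 1\<^sub>m n) =
    (upper_block n a * lower_block n (- b)) *
      ((upper_block n (a - 1\<^sub>m n) * lower_block n (1\<^sub>m n)) * upper_block n (- 1\<^sub>m n))"
    using a b x by (simp add: square_mult_assoc[where n = "n + n"] square_mult_closed)
  also have "\<dots> = a \<bottom> b"
    unfolding 1 2 3 4 ..
  finally show ?thesis by simp
qed

context ideal_set
begin

lemma conj_E_rel:
  assumes "k \<in> E n" "l \<in> carrier_mat n n" "k * l = 1\<^sub>m n" "l * k = 1\<^sub>m n" "x \<in> E_rel n I"
  shows "k * x * l \<in> E_rel n I"
proof -
  have "k \<in> carrier (GL n)" using assms(1) E_GL by auto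
  then have "inv\<^bsub>GL n\<^esub> k = l" using assms by (intro GL_inv_eq) auto
  then show ?thesis using E_rel_normalised[OF assms(1,5)] by simp
qed

text \<open>Write \<open>a = 1 + x\<close>, \<open>a\<^sup>-\<^sup>1 = 1 + y\<close> in the factorisation of \<open>a \<bottom> a\<^sup>-\<^sup>1\<close>; the factors without
  \<open>x\<close> and \<open>y\<close> cancel up to conjugation.\<close>

lemma relative_whitehead:
  assumes "a \<in> GL_rel n I"
  shows "a \<bottom> inv\<^bsub>GL n\<^esub> a \<in> E_rel (n + n) I"
proof -
  define b where "b = inv\<^bsub>GL n\<^esub> a"
  let ?u = "upper_block n" and ?l = "lower_block n" and ?o = "1\<^sub>m n :: 'a mat"
  have G: "a \<in> carrier (GL n)" "b \<in> GL_rel n I" "b \<in> carrier (GL n)"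
    using assms GL_rel_inv unfolding b_def by (auto simp: GL_rel_iff)
  have c: "a \<in> carrier_mat n n" "b \<in> carrier_mat n n" using G by auto
  define x y where "x = a - ?o" and "y = b - ?o"
  have xy: "x \<in> carrier_mat n n" "y \<in> carrier_mat n n" "- y \<in> carrier_mat n n" "- ?o \<in> carrier_mat n n"
    using c by (auto simp: x_def y_def)
  have xI: "i < n \<Longrightarrow> j < n \<Longrightarrow> x $$ (i, j) \<in> I" "i < n \<Longrightarrow> j < n \<Longrightarrow> (- y) $$ (i, j) \<in> I" for i j
    using assms G c uminus[of "b $$ (i, j) - ?o $$ (i, j)"] unfolding x_def y_def GL_rel_iff mat_cong_def by auto
  have A: "?u x \<in> E_rel (n + n) I" "?l (- y) \<in> E_rel (n + n) I"
    using block_E_rel xy xI by blast+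
  have "?l (- ?o) * ?l ?o = 1\<^sub>m (n + n)" "?l ?o * ?l (- ?o) = 1\<^sub>m (n + n)"
    "?u (- ?o) * ?u ?o = 1\<^sub>m (n + n)" "?u ?o * ?u (- ?o) = 1\<^sub>m (n + n)"
    using xy by (simp_all add: lower_block_mult upper_block_mult block_zero)
  note inverses = this
  have B: "?l (- ?o) * (?l (- y) * ?u x) * ?l ?o \<in> E_rel (n + n) I"
    by (rule conj_E_rel[OF block_E(2) _ inverses(1,2) E_rel_mult[OF A(2,1)]]) (use xy in simp_all)
  have C: "?u ?o * (?u x * (?l (- ?o) * (?l (- y) * ?u x) * ?l ?o)) * ?u (- ?o) \<in> E_rel (n + n) I"
    by (rule conj_E_rel[OF block_E(1) _ inverses(4,3) E_rel_mult[OF A(1) B]]) (use xy in simp_all)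
  have e: "?o + x = a" "- ?o + - y = - b"
    using c by (auto intro!: eq_matI simp: x_def y_def)
  have "?u ?o * (?u x * (?l (- ?o) * (?l (- y) * ?u x) * ?l ?o)) * ?u (- ?o) =
      (?u ?o * ?u x) * (?l (- ?o) * ?l (- y)) * ?u x * ?l ?o * ?u (- ?o)"
    using xy by (simp add: square_mult_assoc[where n = "n + n"] square_mult_closed)
  also have "?u ?o * ?u x = ?u a"
    using xy e by (simp add: upper_block_mult)
  also have "?l (- ?o) * ?l (- y) = ?l (- b)"
    using xy e by (simp add: lower_block_mult)
  also have "?u a * ?l (- b) * ?u x * ?l ?o * ?u (- ?o) = a \<bottom> b"
    unfolding x_def by (rule mat_sum_inverse_eq[symmetric]) (use c G assms in \<open>auto simp: b_def GL_rel_iff\<close>)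
  finally show ?thesis using C by (simp add: b_def)
qed

lemma relative_whitehead':
  assumes "a \<in> GL_rel n I"
  shows "inv\<^bsub>GL n\<^esub> a \<bottom> a \<in> E_rel (n + n) I"
proof -
  have "inv\<^bsub>GL n\<^esub> (inv\<^bsub>GL n\<^esub> a) = a"
    using assms by (intro group.inv_inv[OF GL_group]) (simp add: GL_rel_iff)
  then show ?thesis using relative_whitehead[OF GL_rel_inv[OF assms]] by simp
qed

end

text \<open>By the absolute Whitehead lemma \<open>inv g \<bottom> g\<close> lies in
  \<open>E\<close>, for any invertible \<open>g\<close>, and therefore normalises
  \<open>E_rel\<close>; its first block acts on an identity block and drops out.\<close>

lemma E_rel_stably_normal:
  fixes g :: "'a::comm_ring_1 mat"
  assumes g: "g \<in> carrier (GL n)" and x: "x \<in> E_rel n I"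
  shows "1\<^sub>m n \<bottom> (g * x * inv\<^bsub>GL n\<^esub> g) \<in> E_rel (n + n) I"
proof -
  have "g \<in> GL_rel n UNIV" using g by (simp add: GL_rel_def mat_cong_def GL_dim)
  then have "inv\<^bsub>GL n\<^esub> g \<bottom> g \<in> E (n + n)"
    using ideal_set.relative_whitehead'[OF ideal_set_UNIV] by (simp add: E_rel_UNIV)
  then have "(inv\<^bsub>GL n\<^esub> g \<bottom> g) * (1\<^sub>m n \<bottom> x) * inv\<^bsub>GL (n + n)\<^esub> (inv\<^bsub>GL n\<^esub> g \<bottom> g) \<in> E_rel (n + n) I"
    by (rule E_rel_normalised) (rule E_rel_one_sum[OF x])
  moreover have "(inv\<^bsub>GL n\<^esub> g \<bottom> g) * (1\<^sub>m n \<bottom> x) * (g \<bottom> inv\<^bsub>GL n\<^esub> g) = 1\<^sub>m n \<bottom> (g * x * inv\<^bsub>GL n\<^esub> g)"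
  proof -
    have c: "g \<in> carrier_mat n n" "inv\<^bsub>GL n\<^esub> g \<in> carrier_mat n n" "x \<in> carrier_mat n n"
      using g GL_inv[OF g] E_rel_carrier_mat[OF x] by auto
    have "(inv\<^bsub>GL n\<^esub> g \<bottom> g) * (1\<^sub>m n \<bottom> x) = inv\<^bsub>GL n\<^esub> g \<bottom> (g * x)"
      using mat_sum_mult[OF c(2) one_carrier_mat c(1,3)] right_mult_one_mat[OF c(2)] by simp
    then show ?thesis
      using mat_sum_mult[OF c(2,1) square_mult_closed[OF c(1,3)] c(2)] g by simp
  qed
  ultimately show ?thesis
    using g GL_inv[OF g] by (simp add: GL_mat_sum group.inv_inv[OF GL_group])
qed

section \<open>Alternating multilinear forms\<close>

abbreviation unit_fun :: "nat \<Rightarrow> nat \<Rightarrow> 'a::comm_ring_1" where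
  "unit_fun k \<equiv> (\<lambda>x. if x = k then 1 else 0)"

text \<open>Vectors come as an infinite family of which \<open>cong\<close> lets only the first
  \<open>N\<close> count; omitting an argument is then a shift of indices. Alternation is demanded
  for neighbours only, which is what an expansion along the first row can deliver by
  induction.\<close>

locale alternating_form =
  fixes N :: nat and f :: "(nat \<Rightarrow> nat \<Rightarrow> 'a::comm_ring_1) \<Rightarrow> 'a"
  assumes cong: "(\<And>i. i < N \<Longrightarrow> v i = v' i) \<Longrightarrow> f v = f v'"
    and linear: "k < N \<Longrightarrow> f (v(k := (\<lambda>x. c * u x + w x))) = c * f (v(k := u)) + f (v(k := w))"
    and adjacent: "Suc k < N \<Longrightarrow> v k = v (Suc k) \<Longrightarrow> f v = 0"
begin

lemma additive: "k < N \<Longrightarrow> f (v(k := (\<lambda>x. u x + w x))) = f (v(k := u)) + f (v(k := w))"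
  using linear[of k v 1 u w] by simp

lemma zero: "k < N \<Longrightarrow> f (v(k := (\<lambda>x. 0))) = 0"
  using linear[of k v "- 1" "\<lambda>x. 0" "\<lambda>x. 0"] by simp

text \<open>Polarisation at \<open>v i + v j\<close>. Alternation at \<open>i\<close>,
  \<open>j\<close> is a premise since its general case is derived from this lemma for
  neighbours.\<close>

lemma swap_sign:
  assumes ij: "i < N" "j < N" "i \<noteq> j" and alt: "\<And>w. w i = w j \<Longrightarrow> f w = 0"
  shows "f (v(i := v j, j := v i)) = - f v"
proof -
  let ?s = "\<lambda>x. v i x + v j x"
  have "0 = f (v(i := ?s, j := ?s))"
    using ij by (intro alt[symmetric]) simp
  also have "\<dots> = f (v(i := v i, j := ?s)) + f (v(i := v j, j := ?s))"
    using additive[OF ij(1), of "v(j := ?s)" "v i" "v j"] ij by (simp add: fun_upd_twist)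
  also have "\<dots> = (f (v(i := v i, j := v i)) + f (v(i := v i, j := v j))) +
      (f (v(i := v j, j := v i)) + f (v(i := v j, j := v j)))"
    using additive[OF ij(2), of "v(i := v i)" "v i" "v j"] additive[OF ij(2), of "v(i := v j)" "v i" "v j"]
    by simp
  finally have "0 = \<dots>" .
  moreover have "f (v(i := v i, j := v i)) = 0" "f (v(i := v j, j := v j)) = 0"
    by (rule alt; use ij in simp)+
  moreover have "v(i := v i, j := v j) = v" by simp
  ultimately show ?thesis by (simp add: eq_neg_iff_add_eq_0 add.commute)
qed

text \<open>Exchanging the neighbours \<open>j\<close> and \<open>Suc j\<close> costs a sign and
  brings the two equal arguments one step closer.\<close>

lemma equal_zero: "i < j \<Longrightarrow> j < N \<Longrightarrow> v i = v j \<Longrightarrow> f v = 0"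
proof (induction j arbitrary: v)
  case (Suc j)
  show ?case
  proof (cases "i = j")
    case True
    then show ?thesis using Suc.prems adjacent by blast
  next
    case False
    define w where "w = v(j := v (Suc j), Suc j := v j)"
    have "w i = w j" using False Suc.prems by (simp add: w_def)
    then have "f w = 0" using Suc False by simp
    moreover have "f w = - f v"
      unfolding w_def using Suc.prems adjacent by (intro swap_sign) auto
    ultimately show ?thesis by simp
  qed
qed simp

lemma equal_zero': "i \<noteq> j \<Longrightarrow> i < N \<Longrightarrow> j < N \<Longrightarrow> v i = v j \<Longrightarrow> f v = 0"
  using equal_zero[of i j v] equal_zero[of j i v] by (cases i j rule: linorder_cases) auto

lemma transpose_sign:
  assumes "i < N" "j < N" "i \<noteq> j"
  shows "f (v \<circ> Transposition.transpose i j) = - f v"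
proof -
  have "v \<circ> Transposition.transpose i j = v(i := v j, j := v i)"
    by (auto simp: fun_eq_iff Transposition.transpose_def)
  then show ?thesis using swap_sign[OF assms, of v] equal_zero'[OF assms(3,1,2)] by auto
qed

lemma permutation_sign:
  assumes "p permutes {0..<N}"
  shows "f (v \<circ> p) = signof p * f v"
proof -
  have "finite {0..<N}" by simp
  from assms this show ?thesis
  proof (induction arbitrary: v rule: permutes_induct)
    case id
    show ?case by simp
  next
    case (swap a b p)
    have perm: "permutation p" using swap permutation_permutes by blast
    have "f (v \<circ> (Transposition.transpose a b \<circ> p)) = signof p * f (v \<circ> Transposition.transpose a b)"
      using swap.IH[of "v \<circ> Transposition.transpose a b"] by (simp only: o_assoc)
    also have "\<dots> = signof (Transposition.transpose a b \<circ> p) * f v"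
    proof (cases "a = b")
      case False
      then show ?thesis
        using swap transpose_sign[of a b v] perm
        by (simp add: sign_compose permutation_swap_id sign_swap_id)
    qed simp
    finally show ?case .
  qed
qed

lemma sum_linear:
  assumes "k < N" "finite S"
  shows "f (v(k := (\<lambda>x. \<Sum>j\<in>S. a j * u j x))) = (\<Sum>j\<in>S. a j * f (v(k := u j)))"
  using assms(2)
proof (induction S rule: finite_induct)
  case empty
  show ?case unfolding sum.empty by (rule zero[OF assms(1)])
next
  case (insert j S)
  then show ?case unfolding sum.insert[OF insert.hyps] by (simp only: linear[OF assms(1)])
qed

text \<open>Induction on \<open>m\<close> expands one argument after the other in the vectors
  \<open>e\<close>; \<open>\<phi>\<close> records the vector chosen in each expanded
  argument.\<close>

lemma expansion:
  assumes v: "\<And>i. i < N \<Longrightarrow> v i = (\<lambda>x. \<Sum>k\<in>{0..<N}. g k i * e k x)" and "m \<le> N"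
  shows "f v = (\<Sum>\<phi>\<in>{0..<m} \<rightarrow>\<^sub>E {0..<N}. (\<Prod>i = 0..<m. g (\<phi> i) i) * f (\<lambda>i. if i < m then e (\<phi> i) else v i))"
  using assms(2)
proof (induction m)
  case 0
  show ?case by simp
next
  case (Suc m)
  let ?F = "\<lambda>m \<phi>. (\<Prod>i = 0..<m. g (\<phi> i) i) * f (\<lambda>i. if i < m then e (\<phi> i) else v i)"
  have step: "?F m \<phi> = (\<Sum>k = 0..<N. ?F (Suc m) (\<phi>(m := k)))" for \<phi>
  proof -
    let ?v = "\<lambda>i. if i < m then e (\<phi> i) else v i"
    have "f ?v = f (?v(m := (\<lambda>x. \<Sum>k\<in>{0..<N}. g k m * e k x)))"
      using v[of m] Suc.prems by (intro cong) auto
    also have "\<dots> = (\<Sum>k\<in>{0..<N}. g k m * f (?v(m := e k)))"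
      using Suc.prems by (intro sum_linear) auto
    also have "(\<lambda>k. ?v(m := e k)) = (\<lambda>k i. if i < Suc m then e ((\<phi>(m := k)) i) else v i)"
      by (auto simp: fun_eq_iff)
    finally have "?F m \<phi> = (\<Prod>i = 0..<m. g (\<phi> i) i) *
        (\<Sum>k\<in>{0..<N}. g k m * f (\<lambda>i. if i < Suc m then e ((\<phi>(m := k)) i) else v i))"
      by (simp add: fun_eq_iff)
    moreover have "(\<Prod>i = 0..<m. g ((\<phi>(m := k)) i) i) = (\<Prod>i = 0..<m. g (\<phi> i) i)" for k
      by (intro prod.cong) auto
    ultimately show ?thesis
      by (simp add: sum_distrib_left mult.assoc)
  qed
  \<comment> \<open>A choice for \<open>Suc m\<close> arguments is a choice for \<open>m\<close> of
    them together with its value at \<open>m\<close>.\<close>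
  have combine: "(\<Sum>(k, \<phi>)\<in>{0..<N} \<times> ({0..<m} \<rightarrow>\<^sub>E {0..<N}). G (\<phi>(m := k))) =
      (\<Sum>\<phi>\<in>(\<lambda>(k, \<phi>). \<phi>(m := k)) ` ({0..<N} \<times> ({0..<m} \<rightarrow>\<^sub>E {0..<N})). G \<phi>)" for G :: "(nat \<Rightarrow> nat) \<Rightarrow> 'a"
    by (subst sum.reindex[OF inj_combinator]) (auto intro!: sum.cong)
  have "f v = (\<Sum>\<phi>\<in>{0..<m} \<rightarrow>\<^sub>E {0..<N}. ?F m \<phi>)" using Suc by simp
  also have "\<dots> = (\<Sum>\<phi>\<in>{0..<m} \<rightarrow>\<^sub>E {0..<N}. \<Sum>k = 0..<N. ?F (Suc m) (\<phi>(m := k)))"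
    by (simp only: step)
  also have "\<dots> = (\<Sum>k = 0..<N. \<Sum>\<phi>\<in>{0..<m} \<rightarrow>\<^sub>E {0..<N}. ?F (Suc m) (\<phi>(m := k)))"
    by (rule sum.swap)
  also have "\<dots> = (\<Sum>(k, \<phi>)\<in>{0..<N} \<times> ({0..<m} \<rightarrow>\<^sub>E {0..<N}). ?F (Suc m) (\<phi>(m := k)))"
    by (rule sum.cartesian_product)
  also have "\<dots> = (\<Sum>\<phi>\<in>(\<lambda>(k, \<phi>). \<phi>(m := k)) ` ({0..<N} \<times> ({0..<m} \<rightarrow>\<^sub>E {0..<N})). ?F (Suc m) \<phi>)"
    by (rule combine)
  also have "(\<lambda>(k, \<phi>). \<phi>(m := k)) ` ({0..<N} \<times> ({0..<m} \<rightarrow>\<^sub>E {0..<N})) = {0..<Suc m} \<rightarrow>\<^sub>E {0..<N}"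
    using PiE_insert_eq[of m "{0..<m}" "\<lambda>_. {0..<N}"] by (simp add: atLeast0_lessThan_Suc)
  finally show ?case .
qed

text \<open>Uniqueness of the determinant: in the full expansion a choice with a repeated value
  contributes 0, and the remaining ones are the permutations.\<close>

theorem eq_det:
  assumes g: "g \<in> carrier_mat N N"
    and v: "\<And>i. i < N \<Longrightarrow> v i = (\<lambda>x. \<Sum>k\<in>{0..<N}. g $$ (k, i) * e k x)"
  shows "f v = det g * f e"
proof -
  let ?P = "{0..<N} \<rightarrow>\<^sub>E {0..<N}"
  let ?Q = "{\<phi> \<in> ?P. inj_on \<phi> {0..<N}}"
  let ?F = "\<lambda>\<phi>. (\<Prod>i = 0..<N. g $$ (\<phi> i, i)) * f (\<lambda>i. if i < N then e (\<phi> i) else v i)"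
  have "f v = (\<Sum>\<phi>\<in>?P. ?F \<phi>)"
    using expansion[of v "\<lambda>k i. g $$ (k, i)" e N] v by simp
  also have "\<dots> = (\<Sum>\<phi>\<in>?Q. ?F \<phi>)"
  proof (rule sum.mono_neutral_right)
    show "\<forall>\<phi>\<in>?P - ?Q. ?F \<phi> = 0"
    proof
      fix \<phi> assume "\<phi> \<in> ?P - ?Q"
      then obtain i j where "i < N" "j < N" "i \<noteq> j" "\<phi> i = \<phi> j" by (auto simp: inj_on_def)
      then have "f (\<lambda>i. if i < N then e (\<phi> i) else v i) = 0" by (intro equal_zero'[of i j]) auto
      then show "?F \<phi> = 0" by simp
    qed
  qed (auto intro: finite_PiE)
  \<comment> \<open>The coefficients run down the columns of \<open>g\<close>, the determinant
    formula along rows, whence the transpose.\<close>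
  also have "\<dots> = (\<Sum>p | p permutes {0..<N}. signof p * (\<Prod>i = 0..<N. transpose_mat g $$ (i, p i)) * f e)"
  proof (rule sum.reindex_bij_witness[where j = "\<lambda>\<phi> i. if i < N then \<phi> i else i" and i = "\<lambda>p. restrict p {0..<N}"])
    fix \<phi> assume "\<phi> \<in> ?Q"
    then have \<phi>: "\<phi> \<in> ?P" "inj_on \<phi> {0..<N}" by auto
    let ?p = "\<lambda>i. if i < N then \<phi> i else i"
    show "restrict ?p {0..<N} = \<phi>"
      using \<phi> by (auto simp: fun_eq_iff PiE_def extensional_def)
    have "inj_on ?p {0..<N}" using \<phi>(2) by (auto simp: inj_on_def)
    then show "?p \<in> {p. p permutes {0..<N}}"
      using \<phi> by (auto intro!: inj_on_nat_permutes simp: PiE_def Pi_def)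
    then have "f (e \<circ> ?p) = signof ?p * f e" by (intro permutation_sign) simp
    moreover have "f (\<lambda>i. if i < N then e (\<phi> i) else v i) = f (e \<circ> ?p)" by (rule cong) simp
    moreover have "(\<Prod>i = 0..<N. transpose_mat g $$ (i, ?p i)) = (\<Prod>i = 0..<N. g $$ (\<phi> i, i))"
      using \<phi> g by (intro prod.cong) (auto simp: PiE_def Pi_def)
    ultimately show "signof ?p * (\<Prod>i = 0..<N. transpose_mat g $$ (i, ?p i)) * f e = ?F \<phi>"
      by (simp add: ac_simps)
  next
    fix p assume "p \<in> {p. p permutes {0..<N}}"
    then have p: "p permutes {0..<N}" by simp
    show "(\<lambda>i. if i < N then restrict p {0..<N} i else i) = p"
      using permutes_not_in[OF p] by (auto simp: fun_eq_iff)
    show "restrict p {0..<N} \<in> ?Q"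
      using permutes_in_image[OF p] permutes_inj_on[OF p] by auto
  qed
  also have "\<dots> = det (transpose_mat g) * f e"
    using g by (simp add: det_def'[of _ N] sum_distrib_right)
  finally show ?thesis using g by (simp add: det_transpose)
qed

end


section \<open>The Pfaffian\<close>

definition skip :: "nat \<Rightarrow> (nat \<Rightarrow> 'v) \<Rightarrow> nat \<Rightarrow> 'v" where
  "skip j v = (\<lambda>i. if i < j then v i else v (Suc i))"

text \<open>The Pfaffian of the Gram matrix of the vectors \<open>v i\<close> under
  \<open>b\<close>, as a function of the vectors. Deleting a row and its column becomes omitting a
  vector.\<close>

primrec pfaffian_form :: "('v \<Rightarrow> 'v \<Rightarrow> 'a::comm_ring_1) \<Rightarrow> nat \<Rightarrow> (nat \<Rightarrow> 'v) \<Rightarrow> 'a" where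
  "pfaffian_form b 0 v = 1"
| "pfaffian_form b (Suc n) v =
    (\<Sum>j = 1..2 * n + 1. (- 1) ^ (j + 1) * b (v 0) (v j) * pfaffian_form b n (skip 0 (skip j v)))"

lemma pfaffian_mat:
  "pfaffian n (mat (2 * n) (2 * n) (\<lambda>(i, j). b (v i) (v j))) = pfaffian_form b n v"
proof (induction n arbitrary: v)
  case (Suc n)
  have "mat_delete (mat_delete (mat (2 * Suc n) (2 * Suc n) (\<lambda>(i, j). b (v i) (v j))) j j) 0 0 =
      mat (2 * n) (2 * n) (\<lambda>(i, i'). b (skip 0 (skip j v) i) (skip 0 (skip j v) i'))"
    if "j \<in> {1..2 * n + 1}" for j
    using that by (intro eq_matI) (auto simp: mat_delete_def skip_def)
  then show ?case using Suc by simp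
qed simp

lemma pfaffian_form_cong:
  "(\<And>i. i < 2 * n \<Longrightarrow> v i = w i) \<Longrightarrow> pfaffian_form b n v = pfaffian_form b n w"
proof (induction n arbitrary: v w)
  case (Suc n)
  have "pfaffian_form b n (skip 0 (skip j v)) = pfaffian_form b n (skip 0 (skip j w))" for j
    using Suc.prems by (intro Suc.IH) (auto simp: skip_def)
  then show ?case using Suc.prems by (auto intro!: sum.cong)
qed simp

lemma skip_skip_update:
  assumes "1 \<le> j" "1 \<le> k" "j \<noteq> k"
  shows "skip 0 (skip j (v(k := u))) = (skip 0 (skip j v))((if k < j then k - 1 else k - 2) := u)"
  using assms by (auto simp: skip_def fun_eq_iff)

lemma skip_skip_update_same:
  "1 \<le> k \<Longrightarrow> skip 0 (skip k (v(k := u))) = skip 0 (skip k v)"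
  "1 \<le> k \<Longrightarrow> skip 0 (skip k (v(0 := u))) = skip 0 (skip k v)"
  by (auto simp: skip_def fun_eq_iff)

locale alternating_bilinear =
  fixes b :: "(nat \<Rightarrow> 'a::comm_ring_1) \<Rightarrow> (nat \<Rightarrow> 'a) \<Rightarrow> 'a"
  assumes linear_left: "b (\<lambda>x. c * u x + w x) z = c * b u z + b w z"
    and linear_right: "b z (\<lambda>x. c * u x + w x) = c * b z u + b z w"
    and alternating: "b z z = 0"
begin

text \<open>In each summand of the expansion the argument \<open>k\<close> enters exactly one
  factor: for \<open>k = 0\<close> the value of \<open>b\<close>, otherwise that value if
  \<open>j = k\<close> and the smaller Pfaffian if not.\<close>

lemma pfaffian_form_linear:
  "k < 2 * n \<Longrightarrow> pfaffian_form b n (v(k := (\<lambda>x. c * u x + w x))) =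
    c * pfaffian_form b n (v(k := u)) + pfaffian_form b n (v(k := w))"
proof (induction n arbitrary: k v)
  case (Suc n)
  show ?case
  proof (cases "k = 0")
    case True
    show ?thesis
      unfolding True pfaffian_form.simps sum_distrib_left sum.distrib[symmetric]
      by (intro sum.cong refl) (simp add: skip_skip_update_same linear_left, simp add: algebra_simps)
  next
    case False
    let ?k = "\<lambda>j. if k < j then k - 1 else k - 2"
    let ?T = "\<lambda>v j. (- 1) ^ (j + 1) * b (v 0) (v j) * pfaffian_form b n (skip 0 (skip j v))"
    have "?T (v(k := \<lambda>x. c * u x + w x)) j = c * ?T (v(k := u)) j + ?T (v(k := w)) j"
      if j: "j \<in> {1..2 * n + 1}" for j
      proof (cases "j = k")
        case True
        then show ?thesis
          using False j by (simp add: skip_skip_update_same linear_right, simp add: algebra_simps)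
      next
        case jk: False
        have "?k j < 2 * n" using False jk j Suc.prems by auto
        then have "pfaffian_form b n ((skip 0 (skip j v))(?k j := \<lambda>x. c * u x + w x)) =
            c * pfaffian_form b n ((skip 0 (skip j v))(?k j := u)) +
            pfaffian_form b n ((skip 0 (skip j v))(?k j := w))"
          by (rule Suc.IH)
        moreover have "skip 0 (skip j (v(k := z))) = (skip 0 (skip j v))(?k j := z)" for z
          using False jk j by (intro skip_skip_update) auto
        ultimately show ?thesis
          using False jk by (simp add: algebra_simps)
    qed
    then show ?thesis
      unfolding pfaffian_form.simps sum_distrib_left sum.distrib[symmetric] by (rule sum.cong[OF refl])
  qed
qed simp

text \<open>Expanding twice assigns partners to \<open>v 0\<close> and to \<open>v 1\<close>. As
  these vectors agree, exchanging their partners keeps the product and only changes the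
  sign.\<close>

lemma pfaffian_form_first_two:
  assumes v: "v 0 = v 1"
  shows "pfaffian_form b (Suc n) v = 0"
proof (cases n)
  case 0
  then show ?thesis using v by (simp add: alternating)
next
  case (Suc m)
  define F where "F = (\<lambda>(j, k). (- 1) ^ (j + 1) * b (v 0) (v j) *
    ((- 1) ^ (k + 1) * b (v 1) (skip 0 (skip j v) k) *
      pfaffian_form b m (skip 0 (skip k (skip 0 (skip j v))))))"
  let ?X = "{2..2 * m + 3} \<times> {1..2 * m + 1}"
  have "pfaffian_form b (Suc n) v =
      (\<Sum>j = 1..2 * n + 1. (- 1) ^ (j + 1) * b (v 0) (v j) * pfaffian_form b n (skip 0 (skip j v)))"
    by simp
  \<comment> \<open>The summand \<open>j = 1\<close> pairs \<open>v 0\<close> with an equal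
    vector.\<close>
  also have "\<dots> = (\<Sum>j = 2..2 * n + 1. (- 1) ^ (j + 1) * b (v 0) (v j) * pfaffian_form b n (skip 0 (skip j v)))"
    using v by (subst sum.atLeast_Suc_atMost) (auto simp: alternating numeral_2_eq_2)
  also have "\<dots> = (\<Sum>j = 2..2 * m + 3. \<Sum>k = 1..2 * m + 1. F (j, k))"
  proof (intro sum.cong)
    fix j assume j: "j \<in> {2..2 * m + 3}"
    have "skip 0 (skip j v) 0 = v 1" using j by (simp add: skip_def)
    then show "(- 1) ^ (j + 1) * b (v 0) (v j) * pfaffian_form b n (skip 0 (skip j v)) =
        (\<Sum>k = 1..2 * m + 1. F (j, k))"
      unfolding Suc pfaffian_form.simps F_def prod.case sum_distrib_left by (simp only:)
  qed (simp add: Suc)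
  also have "\<dots> = sum F ?X"
    by (subst sum.cartesian_product) (simp only: case_prod_eta)
  also have "?X = {x \<in> ?X. snd x + 1 < fst x} \<union> {x \<in> ?X. \<not> snd x + 1 < fst x}" by auto
  also have "sum F \<dots> = sum F {x \<in> ?X. snd x + 1 < fst x} + sum F {x \<in> ?X. \<not> snd x + 1 < fst x}"
    by (rule sum.union_disjoint) auto
  also have "sum F {x \<in> ?X. snd x + 1 < fst x} = sum (\<lambda>x. - F x) {x \<in> ?X. \<not> snd x + 1 < fst x}"
  \<comment> \<open>In this half \<open>v 0\<close> has partner \<open>v j\<close> and
    \<open>v 1\<close> has partner \<open>v (k + 1)\<close>, since deleting 0 and \<open>j\<close>
    shifts \<open>k\<close> by one. After the exchange the partner \<open>v j\<close> of
    \<open>v 1\<close> lies beyond the deleted \<open>k + 1\<close>, hence at position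
    \<open>j - 2\<close>; the sum of the two expansion indices changes parity.\<close>
  proof (rule sum.reindex_bij_witness[where j = "\<lambda>(j, k). (k + 1, j - 2)" and i = "\<lambda>(j, k). (k + 2, j - 1)"])
    fix x assume "x \<in> {x \<in> ?X. snd x + 1 < fst x}"
    then obtain j k where x: "x = (j, k)" "j \<in> {2..2 * m + 3}" "k \<in> {1..2 * m + 1}" "k + 1 < j" by auto
    define i where "i = j - 2"
    have j: "j = Suc (Suc i)" "k \<le> i" using x unfolding i_def by auto
    have "skip 0 (skip k (skip 0 (skip j v))) = skip 0 (skip i (skip 0 (skip (k + 1) v)))"
      using j(2) by (auto simp: skip_def fun_eq_iff j(1))
    moreover have "skip 0 (skip j v) k = v (k + 1)" "skip 0 (skip (k + 1) v) i = v j"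
      using j(2) by (auto simp: skip_def j(1))
    ultimately show "- F (case x of (j, k) \<Rightarrow> (k + 1, j - 2)) = F x"
      by (simp add: x(1) j(1) F_def v)
  qed auto
  finally show ?thesis by (simp add: sum_negf)
qed

text \<open>Away from \<open>k = 0\<close>, a summand with \<open>j\<close> outside
  \<open>{k, Suc k}\<close> keeps the equal vectors as neighbours and vanishes by induction; the two
  others have the same minor and opposite signs.\<close>

lemma pfaffian_form_adjacent:
  "Suc k < 2 * n \<Longrightarrow> v k = v (Suc k) \<Longrightarrow> pfaffian_form b n v = 0"
proof (induction n arbitrary: k v)
  case (Suc n)
  show ?case
  proof (cases "k = 0")
    case True
    then show ?thesis by (intro pfaffian_form_first_two) (use Suc.prems in simp)
  next
    case False
    let ?T = "\<lambda>j. (- 1) ^ (j + 1) * b (v 0) (v j) * pfaffian_form b n (skip 0 (skip j v))"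
    have "?T j = 0" if "j \<in> {1..2 * n + 1} - {k, Suc k}" for j
    proof -
      have "pfaffian_form b n (skip 0 (skip j v)) = 0"
      proof (cases "k < j")
        case True
        obtain l where l: "k = Suc l" using False by (cases k) auto
        show ?thesis
          using that True Suc.prems by (intro Suc.IH[of l]) (auto simp: skip_def l)
      next
        case kj: False
        then have "k - 2 = l \<Longrightarrow> k = Suc (Suc l)" for l using that False by auto
        then obtain l where l: "k = Suc (Suc l)" by blast
        show ?thesis
          using that kj Suc.prems by (intro Suc.IH[of l]) (auto simp: skip_def l)
      qed
      then show ?thesis by simp
    qed
    then have "pfaffian_form b (Suc n) v = (\<Sum>j\<in>{k, Suc k}. ?T j)"
      unfolding pfaffian_form.simps using False Suc.prems by (intro sum.mono_neutral_right) auto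
    moreover have "skip 0 (skip k v) = skip 0 (skip (Suc k) v)"
      using Suc.prems False by (auto simp: skip_def fun_eq_iff not_less less_Suc_eq)
    ultimately show ?thesis using Suc.prems by (simp add: algebra_simps)
  qed
qed simp

sublocale alternating_form "2 * n" "pfaffian_form b n" for n
  by unfold_locales (auto intro: pfaffian_form_cong simp: pfaffian_form_linear pfaffian_form_adjacent)

end

section \<open>Congruence of alternating matrices\<close>

lemma alternating_iff:
  fixes A :: "'a::comm_ring_1 mat"
  assumes "A \<in> carrier_mat n n"
  shows "alternating A \<longleftrightarrow> (\<forall>i<n. \<forall>j<n. A $$ (j, i) = - A $$ (i, j)) \<and> (\<forall>i<n. A $$ (i, i) = 0)"
  using assms unfolding alternating_def by (auto simp: mat_eq_iff)

lemma alternating_skew: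
  fixes A :: "'a::comm_ring_1 mat"
  assumes "A \<in> carrier_mat n n" "alternating A" "i < n" "j < n"
  shows "A $$ (j, i) = - A $$ (i, j)"
  using assms alternating_iff[OF assms(1)] by blast

lemma alternating_diag:
  fixes A :: "'a::comm_ring_1 mat"
  assumes "A \<in> carrier_mat n n" "alternating A" "i < n"
  shows "A $$ (i, i) = 0"
  using assms alternating_iff[OF assms(1)] by blast

text \<open>The terms at \<open>(k, l)\<close> and \<open>(l, k)\<close> cancel and the diagonal is
  zero. The explicit pairing matters when 2 is a zero divisor: skewness by itself only shows that
  twice the sum is 0.\<close>

lemma sum_alternating:
  fixes A :: "'a::comm_ring_1 mat"
  assumes A: "A \<in> carrier_mat n n" "alternating A"
  shows "(\<Sum>k = 0..<n. \<Sum>l = 0..<n. u k * A $$ (k, l) * u l) = 0"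
proof -
  let ?F = "\<lambda>(k, l). u k * A $$ (k, l) * u l"
  let ?X = "{0..<n} \<times> {0..<n}"
  have skew: "A $$ (j, i) = - A $$ (i, j)" and diag: "A $$ (i, i) = 0" if "i < n" "j < n" for i j
    using alternating_skew[OF A that] alternating_diag[OF A that(1)] .
  have "(\<Sum>k = 0..<n. \<Sum>l = 0..<n. u k * A $$ (k, l) * u l) = sum ?F ?X"
    by (simp add: sum.cartesian_product)
  also have "\<dots> = sum ?F ({x \<in> ?X. fst x < snd x} \<union> {x \<in> ?X. fst x \<ge> snd x})"
    by (rule arg_cong[where f = "sum ?F"]) auto
  also have "\<dots> = sum ?F {x \<in> ?X. fst x < snd x} + sum ?F {x \<in> ?X. fst x \<ge> snd x}"
    by (rule sum.union_disjoint) auto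
  also have "sum ?F {x \<in> ?X. fst x \<ge> snd x} = sum ?F {x \<in> ?X. fst x > snd x}"
    by (rule sum.mono_neutral_right) (auto simp: diag le_less)
  also have "\<dots> = sum (\<lambda>x. - ?F x) {x \<in> ?X. fst x < snd x}"
  proof (rule sum.reindex_bij_witness[where i = prod.swap and j = prod.swap])
    fix x assume "x \<in> {x \<in> ?X. fst x > snd x}"
    then obtain i j where "x = (i, j)" "i < n" "j < n" by auto
    then show "- ?F (prod.swap x) = ?F x" using skew[of j i] by (simp add: ac_simps)
  qed auto
  finally show ?thesis by (simp add: sum_negf)
qed

lemma congruence_index:
  fixes g A :: "'a::comm_ring_1 mat"
  assumes "g \<in> carrier_mat n n" "A \<in> carrier_mat n n" "i < n" "j < n"
  shows "(transpose_mat g * A * g) $$ (i, j) =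
    (\<Sum>k = 0..<n. \<Sum>l = 0..<n. g $$ (k, i) * A $$ (k, l) * g $$ (l, j))"
proof -
  have "(transpose_mat g * A * g) $$ (i, j) =
      (\<Sum>l = 0..<n. (\<Sum>k = 0..<n. g $$ (k, i) * A $$ (k, l)) * g $$ (l, j))"
    using assms by (simp add: scalar_prod_def del: assoc_mult_mat)
  also have "\<dots> = (\<Sum>l = 0..<n. \<Sum>k = 0..<n. g $$ (k, i) * A $$ (k, l) * g $$ (l, j))"
    by (simp only: sum_distrib_right)
  also have "\<dots> = (\<Sum>k = 0..<n. \<Sum>l = 0..<n. g $$ (k, i) * A $$ (k, l) * g $$ (l, j))"
    by (rule sum.swap)
  finally show ?thesis .
qed

lemma alternating_congruence:
  fixes g A :: "'a::comm_ring_1 mat"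
  assumes g: "g \<in> carrier_mat n n" and A: "A \<in> carrier_mat n n" "alternating A"
  shows "alternating (transpose_mat g * A * g)"
proof -
  have a: "A $$ (j, i) = - A $$ (i, j)" if "i < n" "j < n" for i j
    using alternating_skew[OF A that] .
  have c: "transpose_mat g * A * g \<in> carrier_mat n n" using g A by auto
  have "(transpose_mat g * A * g) $$ (j, i) = - (transpose_mat g * A * g) $$ (i, j)" if "i < n" "j < n" for i j
  proof -
    have "(transpose_mat g * A * g) $$ (j, i) = (\<Sum>l = 0..<n. \<Sum>k = 0..<n. g $$ (k, j) * A $$ (k, l) * g $$ (l, i))"
      unfolding congruence_index[OF g A(1) that(2,1)] by (rule sum.swap)
    also have "\<dots> = (\<Sum>l = 0..<n. \<Sum>k = 0..<n. - (g $$ (l, i) * A $$ (l, k) * g $$ (k, j)))"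
    proof (intro sum.cong refl)
      fix l k assume "l \<in> {0..<n}" "k \<in> {0..<n}"
      then show "g $$ (k, j) * A $$ (k, l) * g $$ (l, i) = - (g $$ (l, i) * A $$ (l, k) * g $$ (k, j))"
        using a[of l k] by (simp add: mult_ac)
    qed
    finally show ?thesis
      unfolding congruence_index[OF g A(1) that] sum_negf .
  qed
  moreover have "(transpose_mat g * A * g) $$ (i, i) = 0" if "i < n" for i
    unfolding congruence_index[OF g A(1) that that] by (rule sum_alternating[OF A])
  ultimately show ?thesis unfolding alternating_iff[OF c] by (intro conjI allI impI)
qed

theorem pfaffian_congruence:
  fixes g A :: "'a::comm_ring_1 mat"
  assumes g: "g \<in> carrier_mat (2 * n) (2 * n)" and A: "A \<in> carrier_mat (2 * n) (2 * n)" "alternating A"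
  shows "pfaffian n (transpose_mat g * A * g) = det g * pfaffian n A"
proof -
  let ?N = "2 * n"
  define b where "b u w = (\<Sum>k = 0..<?N. \<Sum>l = 0..<?N. u k * A $$ (k, l) * w l)" for u w
  interpret alternating_bilinear b
  proof
    show "b (\<lambda>x. c * u x + w x) z = c * b u z + b w z" for c u w z
      unfolding b_def sum_distrib_left sum.distrib[symmetric]
      by (intro sum.cong refl) (simp add: algebra_simps)
    show "b z (\<lambda>x. c * u x + w x) = c * b z u + b z w" for c u w z
      unfolding b_def sum_distrib_left sum.distrib[symmetric]
      by (intro sum.cong refl) (simp add: algebra_simps)
    show "b z z = 0" for z
      unfolding b_def by (rule sum_alternating[OF A])
  qed
  \<comment> \<open>Column \<open>i\<close> of \<open>g\<close> as a combination of unit vectors, in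
    the form that \<open>eq_det\<close> asks for; coordinates from \<open>2 * n\<close> on are 0 and
    are not seen by \<open>b\<close>.\<close>
  define v where "v i = (\<lambda>x. \<Sum>k\<in>{0..<?N}. g $$ (k, i) * unit_fun k x)" for i
  have v: "v i x = g $$ (x, i)" if "x < ?N" for i x
  proof -
    have "v i x = (\<Sum>k\<in>{0..<?N}. if k = x then g $$ (x, i) else 0)"
      unfolding v_def by (intro sum.cong) auto
    then show ?thesis using that by simp
  qed
  have "transpose_mat g * A * g = mat ?N ?N (\<lambda>(i, j). b (v i) (v j))"
    using g A(1) by (intro eq_matI) (simp_all add: congruence_index b_def v del: index_mult_mat(1) assoc_mult_mat)
  then have "pfaffian n (transpose_mat g * A * g) = pfaffian_form b n v"
    by (simp add: pfaffian_mat)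
  also have "\<dots> = det g * pfaffian_form b n unit_fun"
    by (rule eq_det[OF g]) (simp add: v_def)
  also have "pfaffian_form b n unit_fun = pfaffian n (mat ?N ?N (\<lambda>(i, j). b (unit_fun i) (unit_fun j)))"
    by (rule pfaffian_mat[symmetric])
  also have "mat ?N ?N (\<lambda>(i, j). b (unit_fun i) (unit_fun j)) = A"
  proof (rule eq_matI)
    fix i j assume "i < dim_row A" "j < dim_col A"
    then have ij: "i < ?N" "j < ?N" using A by auto
    have "b (unit_fun i) (unit_fun j) =
        (\<Sum>k = 0..<?N. if k = i then (\<Sum>l = 0..<?N. if l = j then A $$ (i, j) else 0) else 0)"
      unfolding b_def
    proof (intro sum.cong refl)
      fix k assume "k \<in> {0..<?N}"
      have "(\<Sum>l = 0..<?N. unit_fun i k * A $$ (k, l) * unit_fun j l) =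
          (\<Sum>l = 0..<?N. if l = j then unit_fun i k * A $$ (k, j) else 0)"
        by (intro sum.cong refl) simp
      then show "(\<Sum>l = 0..<?N. unit_fun i k * A $$ (k, l) * unit_fun j l) =
          (if k = i then (\<Sum>l = 0..<?N. if l = j then A $$ (i, j) else 0) else 0)"
        by simp
    qed
    then show "mat ?N ?N (\<lambda>(i, j). b (unit_fun i) (unit_fun j)) $$ (i, j) = A $$ (i, j)"
      using ij by simp
  qed (use A in auto)
  finally show ?thesis .
qed

text \<open>As long as \<open>A\<close> is nonempty, row 0 belongs to it, so the expansion deletes
  only indices of \<open>A\<close> and carries \<open>B\<close> along.\<close>

lemma pfaffian_mat_sum:
  assumes "A \<in> carrier_mat (2 * m) (2 * m)" "B \<in> carrier_mat (2 * n) (2 * n)"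
  shows "pfaffian (m + n) (A \<bottom> B) = pfaffian m A * pfaffian n B"
  using assms(1)
proof (induction m arbitrary: A)
  case 0
  then have "A \<bottom> B = B" by (intro eq_matI) (auto simp: mat_sum_index)
  then show ?case by simp
next
  case (Suc m)
  let ?D = "\<lambda>A j. mat_delete (mat_delete A j j) 0 0"
  let ?T = "\<lambda>j. (- 1) ^ (j + 1) * (A \<bottom> B) $$ (0, j) * pfaffian (m + n) (?D (A \<bottom> B) j)"
  have d: "dim_row A = 2 * m + 2" "dim_col A = 2 * m + 2" "dim_row B = 2 * n" "dim_col B = 2 * n"
    using Suc.prems assms(2) by auto
  have "pfaffian (Suc m + n) (A \<bottom> B) = (\<Sum>j = 1..2 * (m + n) + 1. ?T j)" by simp
  also have "\<dots> = (\<Sum>j = 1..2 * m + 1. ?T j)"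
    using d by (intro sum.mono_neutral_right) (auto simp: mat_sum_index)
  also have "\<dots> = (\<Sum>j = 1..2 * m + 1. (- 1) ^ (j + 1) * A $$ (0, j) * (pfaffian m (?D A j) * pfaffian n B))"
  proof (intro sum.cong refl)
    fix j assume j: "j \<in> {1..2 * m + 1}"
    have "?D (A \<bottom> B) j = ?D A j \<bottom> B"
    proof (rule eq_matI)
      fix r c assume "r < dim_row (?D A j \<bottom> B)" "c < dim_col (?D A j \<bottom> B)"
      then have rc: "r < 2 * m + 2 * n" "c < 2 * m + 2 * n" using d by auto
      \<comment> \<open>\<open>s\<close> recovers the index before the deletion of 0 and
        \<open>j\<close>.\<close>
      define s where "s r = (if Suc r < j then Suc r else Suc (Suc r))" for r
      have s: "s r < 2 * m + 2 * n + 2" "s c < 2 * m + 2 * n + 2"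
        "s r < 2 * m + 2 \<longleftrightarrow> r < 2 * m" "s c < 2 * m + 2 \<longleftrightarrow> c < 2 * m"
        "\<not> r < 2 * m \<Longrightarrow> s r - (2 * m + 2) = r - 2 * m" "\<not> c < 2 * m \<Longrightarrow> s c - (2 * m + 2) = c - 2 * m"
        using j rc by (auto simp: s_def)
      have "?D (A \<bottom> B) j $$ (r, c) = (A \<bottom> B) $$ (s r, s c)"
        using rc d unfolding mat_delete_def s_def by simp
      moreover have "?D A j $$ (r, c) = A $$ (s r, s c)" if "r < 2 * m" "c < 2 * m"
        using that d unfolding mat_delete_def s_def by simp
      ultimately show "?D (A \<bottom> B) j $$ (r, c) = (?D A j \<bottom> B) $$ (r, c)"
        using rc d s by (simp add: mat_sum_index)
    qed (use d in auto)
    moreover have "pfaffian (m + n) (?D A j \<bottom> B) = pfaffian m (?D A j) * pfaffian n B"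
      using d by (intro Suc.IH) auto
    moreover have "(A \<bottom> B) $$ (0, j) = A $$ (0, j)"
      using d j by (simp add: mat_sum_index)
    ultimately show "?T j = (- 1) ^ (j + 1) * A $$ (0, j) * (pfaffian m (?D A j) * pfaffian n B)" by simp
  qed
  also have "\<dots> = pfaffian (Suc m) A * pfaffian n B"
    unfolding pfaffian.simps sum_distrib_right by (intro sum.cong refl) (simp only: mult.assoc)
  finally show ?case .
qed

section \<open>The standard alternating form\<close>

lemma chi1_carrier [simp]: "chi1 \<in> carrier_mat 2 2"
  unfolding chi1_def by (simp add: mat_of_rows_list_def numeral_2_eq_2)

lemma chi1_dim [simp]: "dim_row chi1 = 2" "dim_col chi1 = 2"
  using chi1_carrier by (simp_all del: chi1_carrier add: chi1_def mat_of_rows_list_def)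

lemma chi1_index:
  "i < 2 \<Longrightarrow> j < 2 \<Longrightarrow> chi1 $$ (i, j) = (if i = 0 \<and> j = 1 then 1 else if i = 1 \<and> j = 0 then - 1 else 0)"
  by (auto simp: chi1_def mat_of_rows_list_def less_2_cases_iff)

lemma chi_carrier [simp]: "chi n \<in> carrier_mat (2 * n) (2 * n)"
  by (induction n) (auto intro!: carrier_matI)

lemma chi_dim [simp]: "dim_row (chi n) = 2 * n" "dim_col (chi n) = 2 * n"
  using chi_carrier[of n] by blast+

lemma chi_add: "chi m \<bottom> chi n = chi (m + n)"
  by (induction n) (simp_all add: mat_sum_assoc[symmetric])

lemma sigma_sigma [simp]: "sigma (sigma i) = i"
  by (auto simp: sigma_def)

lemma sigma_inject [simp]: "sigma i = sigma j \<longleftrightarrow> i = j"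
  by (metis sigma_sigma)

lemma sigma_eq: "sigma i = j \<longleftrightarrow> i = sigma j"
  by (metis sigma_sigma)

lemma sigma_neq [simp]: "sigma i \<noteq> i" "i \<noteq> sigma i"
  by (auto simp: sigma_def elim: oddE)

lemma even_sigma [simp]: "even (sigma i) \<longleftrightarrow> odd i"
  by (auto simp: sigma_def)

lemma sigma_less [simp]: "i < 2 * n \<Longrightarrow> sigma i < 2 * n"
  unfolding sigma_def by presburger

lemma sigma_add: "sigma (2 * k + i) = 2 * k + sigma i"
  by (auto simp: sigma_def elim: oddE)

lemma sigma_less_iff: "sigma i < 2 * k \<longleftrightarrow> i < 2 * k"
  by (metis sigma_less sigma_sigma)

text \<open>The single nonzero entry of column \<open>j\<close> of \<open>chi\<close>, in row
  \<open>sigma j\<close>; with 0-based indices it is \<open>(- 1) ^ (j + 1)\<close>.\<close>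

definition plane_sign :: "nat \<Rightarrow> 'a::comm_ring_1" where
  "plane_sign j = (if odd j then 1 else - 1)"

lemma plane_sign_simps [simp]:
  "plane_sign j * plane_sign j = 1" "plane_sign j * (plane_sign j * x) = x"
  "plane_sign (sigma j) = - plane_sign j" "plane_sign (2 * k + j) = plane_sign j"
  by (auto simp: plane_sign_def)

lemma chi_index:
  "i < 2 * n \<Longrightarrow> j < 2 * n \<Longrightarrow>
    chi n $$ (i, j) = (if i = sigma j then plane_sign j else 0 :: 'a::comm_ring_1)"
proof (induction n)
  case (Suc n)
  show ?case
  proof (cases "i < 2 * n")
    case True
    then show ?thesis
      using Suc sigma_less_iff[of j n] by (auto simp: mat_sum_index)
  next
    case False
    show ?thesis
    proof (cases "j < 2 * n")
      case True
      then show ?thesis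
        using Suc False sigma_less[of j n] by (auto simp: mat_sum_index)
    next
      case jn: False
      define a b where "a = i - 2 * n" and "b = j - 2 * n"
      have ij: "i = 2 * n + a" "j = 2 * n + b" "a < 2" "b < 2"
        using False jn Suc.prems by (auto simp: a_def b_def)
      have "chi1 $$ (a, b) = (if a = sigma b then plane_sign b else 0 :: 'a)"
        using ij(3,4) by (auto simp: chi1_index less_2_cases_iff sigma_def plane_sign_def)
      then show ?thesis
        by (simp add: mat_sum_index ij sigma_add)
    qed
  qed
qed simp

lemma chi_transpose: "transpose_mat (chi n) = - chi n"
  by (rule eq_matI) (auto simp: chi_index)

lemma chi_alternating: "alternating (chi n)"
  unfolding alternating_def by (auto simp: chi_transpose chi_index)

lemma mult_chi_index:
  assumes "A \<in> carrier_mat m (2 * n)" "i < m" "j < 2 * n"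
  shows "(A * chi n) $$ (i, j) = plane_sign j * A $$ (i, sigma j)"
proof -
  have "(A * chi n) $$ (i, j) = (\<Sum>k = 0..<2 * n. A $$ (i, k) * chi n $$ (k, j))"
    using assms by (simp add: scalar_prod_def)
  also have "\<dots> = (\<Sum>k = 0..<2 * n. if k = sigma j then plane_sign j * A $$ (i, sigma j) else 0)"
    using assms by (intro sum.cong refl) (auto simp: chi_index)
  also have "\<dots> = plane_sign j * A $$ (i, sigma j)" using assms by simp
  finally show ?thesis .
qed

lemma chi_mult_index:
  assumes "A \<in> carrier_mat (2 * n) m" "i < 2 * n" "j < m"
  shows "(chi n * A) $$ (i, j) = - (plane_sign i * A $$ (sigma i, j))"
proof -
  have "(chi n * A) $$ (i, j) = (\<Sum>k = 0..<2 * n. chi n $$ (i, k) * A $$ (k, j))"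
    using assms by (simp add: scalar_prod_def)
  also have "\<dots> = (\<Sum>k = 0..<2 * n. if k = sigma i then - (plane_sign i * A $$ (sigma i, j)) else 0)"
    using assms by (intro sum.cong refl) (auto simp: chi_index)
  also have "\<dots> = - (plane_sign i * A $$ (sigma i, j))" using assms by simp
  finally show ?thesis .
qed

lemma chi_chi: "chi n * chi n = - 1\<^sub>m (2 * n)"
  by (rule eq_matI) (auto simp: mult_chi_index[OF chi_carrier] chi_index simp del: index_mult_mat(1))

lemma chi_inverse: "chi n * - chi n = 1\<^sub>m (2 * n)" "- chi n * chi n = 1\<^sub>m (2 * n)"
  by (simp_all add: chi_chi)

lemma chi_GL: "chi n \<in> carrier (GL (2 * n))"
  by (rule GL_I[OF _ _ chi_inverse]) auto

lemma pfaffian_chi: "pfaffian n (chi n) = (1 :: 'a::comm_ring_1)"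
proof (induction n)
  case (Suc n)
  have "pfaffian (Suc 0) (chi1 :: 'a mat) = 1" by (simp add: chi1_index)
  moreover have "pfaffian (n + Suc 0) (chi n \<bottom> chi1 :: 'a mat) = pfaffian n (chi n) * pfaffian (Suc 0) chi1"
    by (rule pfaffian_mat_sum) simp_all
  ultimately show ?case using Suc by (simp del: pfaffian.simps)
qed simp


section \<open>Symplectic transvections\<close>

definition omega :: "nat \<Rightarrow> (nat \<Rightarrow> 'a::comm_ring_1) \<Rightarrow> (nat \<Rightarrow> 'a) \<Rightarrow> 'a" where
  "omega n u w = (\<Sum>k = 0..<2 * n. \<Sum>l = 0..<2 * n. u k * chi n $$ (k, l) * w l)"

lemma omega_add:
  "omega n (\<lambda>i. u i + w i) z = omega n u z + omega n w z"
  "omega n z (\<lambda>i. u i + w i) = omega n z u + omega n z w"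
  unfolding omega_def sum.distrib[symmetric] by (simp_all add: algebra_simps)

lemma omega_self [simp]: "omega n u u = 0"
  unfolding omega_def by (rule sum_alternating[OF chi_carrier chi_alternating])

lemma omega_skew: "omega n u w = - omega n w u"
  using omega_self[of n "\<lambda>i. u i + w i"] by (simp add: omega_add eq_neg_iff_add_eq_0 del: omega_self) simp

lemma omega_unit:
  assumes "a < 2 * n"
  shows "omega n w (unit_fun a) = plane_sign a * w (sigma a)"
proof -
  have inner: "(\<Sum>l = 0..<2 * n. w k * chi n $$ (k, l) * unit_fun a l) = (if k = sigma a then plane_sign a * w k else 0)"
    if "k < 2 * n" for k
  proof -
    have "(\<Sum>l = 0..<2 * n. w k * chi n $$ (k, l) * unit_fun a l) =
        (\<Sum>l = 0..<2 * n. if l = a then w k * chi n $$ (k, a) else 0)"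
      by (rule sum.cong) auto
    also have "\<dots> = (if k = sigma a then plane_sign a * w k else 0)"
      using assms that by (simp add: chi_index)
    finally show ?thesis .
  qed
  have "omega n w (unit_fun a) = (\<Sum>k = 0..<2 * n. if k = sigma a then plane_sign a * w k else 0)"
    unfolding omega_def by (rule sum.cong) (auto simp: inner)
  also have "\<dots> = plane_sign a * w (sigma a)"
    using assms by simp
  finally show ?thesis .
qed

text \<open>\<open>transvection n s\<close> is \<open>1 + S * chi n\<close> for the matrix \<open>S\<close> with entries \<open>s i j\<close>, and
  \<open>chi_comp n s t\<close> gives the entries of \<open>S * chi n * T\<close>.\<close>

definition transvection :: "nat \<Rightarrow> (nat \<Rightarrow> nat \<Rightarrow> 'a::comm_ring_1) \<Rightarrow> 'a mat" where
  "transvection n s = 1\<^sub>m (2 * n) + mat (2 * n) (2 * n) (\<lambda>(i, j). s i j) * chi n"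

definition chi_comp ::
  "nat \<Rightarrow> (nat \<Rightarrow> nat \<Rightarrow> 'a::comm_ring_1) \<Rightarrow> (nat \<Rightarrow> nat \<Rightarrow> 'a) \<Rightarrow> nat \<Rightarrow> nat \<Rightarrow> 'a" where
  "chi_comp n s t i j = (\<Sum>k = 0..<2 * n. \<Sum>l = 0..<2 * n. s i k * chi n $$ (k, l) * t l j)"

lemma transvection_carrier [simp]: "transvection n s \<in> carrier_mat (2 * n) (2 * n)"
  unfolding transvection_def by (intro add_carrier_mat mult_carrier_mat[OF mat_carrier chi_carrier])

lemma transvection_dim [simp]:
  "dim_row (transvection n s) = 2 * n" "dim_col (transvection n s) = 2 * n"
  using carrier_matD[OF transvection_carrier[of n s]] by simp_all

lemma transvection_index:
  "i < 2 * n \<Longrightarrow> j < 2 * n \<Longrightarrow>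
    transvection n s $$ (i, j) = (if i = j then 1 else 0) + plane_sign j * s i (sigma j)"
  unfolding transvection_def
  by (simp add: mult_chi_index[of _ "2 * n"] del: index_mult_mat(1))

lemma transvection_cong:
  "(\<And>i j. i < 2 * n \<Longrightarrow> j < 2 * n \<Longrightarrow> s i j = t i j) \<Longrightarrow> transvection n s = transvection n t"
  unfolding transvection_def by (intro arg_cong2[where f = "(+)"] arg_cong2[where f = "(*)"] eq_matI) auto

lemma transvection_zero: "transvection n (\<lambda>i j. 0) = 1\<^sub>m (2 * n)"
  by (rule eq_matI) (auto simp: transvection_index transvection_def[symmetric] simp del: index_mult_mat(1))

text \<open>With \<open>chi\<close> split off on the right,
  \<open>(1 + S chi)(1 + T chi) = 1 + (S + T + S chi T) chi\<close>, so identities between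
  transvections reduce to identities between entry functions.\<close>

lemma transvection_mult:
  "transvection n s * transvection n t = transvection n (\<lambda>i j. s i j + t i j + chi_comp n s t i j)"
proof -
  let ?N = "2 * n"
  let ?M = "\<lambda>s. mat ?N ?N (\<lambda>(i, j). s i j)"
  have M: "?M s \<in> carrier_mat ?N ?N" for s :: "nat \<Rightarrow> nat \<Rightarrow> 'a" by simp
  have c: "?M s * chi n \<in> carrier_mat ?N ?N" for s :: "nat \<Rightarrow> nat \<Rightarrow> 'a"
    using M chi_carrier by (rule mult_carrier_mat)
  have comp: "?M s * chi n * ?M t = ?M (chi_comp n s t)"
  proof (rule eq_matI)
    fix i j assume "i < dim_row (?M (chi_comp n s t))" "j < dim_col (?M (chi_comp n s t))"
    then have ij: "i < ?N" "j < ?N" by auto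
    have "(?M s * chi n * ?M t) $$ (i, j) = (\<Sum>l = 0..<?N. (\<Sum>k = 0..<?N. s i k * chi n $$ (k, l)) * t l j)"
      using ij by (simp add: scalar_prod_def del: assoc_mult_mat)
    also have "\<dots> = chi_comp n s t i j"
      unfolding chi_comp_def sum_distrib_right by (rule sum.swap)
    finally show "(?M s * chi n * ?M t) $$ (i, j) = ?M (chi_comp n s t) $$ (i, j)" using ij by simp
  qed auto
  have "transvection n s * transvection n t =
      1\<^sub>m ?N + ?M s * chi n + (1\<^sub>m ?N + ?M s * chi n) * (?M t * chi n)"
    unfolding transvection_def using c
    by (subst mult_add_distrib_mat[of _ ?N ?N _ ?N]) (simp_all add: right_mult_one_mat[of _ ?N ?N])
  also have "(1\<^sub>m ?N + ?M s * chi n) * (?M t * chi n) = ?M t * chi n + ?M s * chi n * (?M t * chi n)"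
    using c by (subst add_mult_distrib_mat[of _ ?N ?N _ _ ?N]) (simp_all add: left_mult_one_mat[of _ ?N ?N])
  also have "?M s * chi n * (?M t * chi n) = ?M (chi_comp n s t) * chi n"
    unfolding comp[symmetric] by (rule assoc_mult_mat[symmetric, OF c M chi_carrier])
  finally show ?thesis
    unfolding transvection_def
    by (intro eq_matI)
      (simp_all add: mult_chi_index[of _ ?N] distrib_left add.assoc del: index_mult_mat(1) assoc_mult_mat)
qed

lemma chi_comp_add:
  "chi_comp n (\<lambda>i j. s i j + s' i j) t = (\<lambda>i j. chi_comp n s t i j + chi_comp n s' t i j)"
  "chi_comp n t (\<lambda>i j. s i j + s' i j) = (\<lambda>i j. chi_comp n t s i j + chi_comp n t s' i j)"
  unfolding chi_comp_def sum.distrib[symmetric] by (simp_all add: algebra_simps fun_eq_iff)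

text \<open>\<open>u w^T chi y z^T = omega(w, y) u z^T\<close>: composing functions of rank one only
  involves values of \<open>omega\<close>, which turns the identities below into polynomial
  ones.\<close>

lemma chi_comp_outer:
  "chi_comp n (\<lambda>i j. c * (u i * w j)) (\<lambda>i j. d * (y i * z j)) = (\<lambda>i j. c * d * omega n w y * (u i * z j))"
  unfolding chi_comp_def omega_def by (simp add: sum_distrib_left sum_distrib_right ac_simps fun_eq_iff)

text \<open>As a map this is \<open>x \<mapsto> x + c omega(u, x) u\<close>, and
  \<open>short_transvection\<close> is
  \<open>x \<mapsto> x + c omega(w, x) u + c omega(u, x) w\<close>. For suitable unit vectors they
  are the long and short root elements of the symplectic group.\<close>

definition long_transvection :: "nat \<Rightarrow> 'a::comm_ring_1 \<Rightarrow> (nat \<Rightarrow> 'a) \<Rightarrow> 'a mat" where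
  "long_transvection n c u = transvection n (\<lambda>i j. c * (u i * u j))"

definition short_transvection :: "nat \<Rightarrow> 'a::comm_ring_1 \<Rightarrow> (nat \<Rightarrow> 'a) \<Rightarrow> (nat \<Rightarrow> 'a) \<Rightarrow> 'a mat" where
  "short_transvection n c u w = transvection n (\<lambda>i j. c * (u i * w j) + c * (w i * u j))"

lemmas transvection_calculus =
  long_transvection_def short_transvection_def transvection_mult chi_comp_add chi_comp_outer omega_add

lemma long_transvection_add:
  "long_transvection n c (\<lambda>i. u i + w i) = transvection n (\<lambda>i j.
    c * (u i * u j) + c * (u i * w j) + c * (w i * u j) + c * (w i * w j))"
  unfolding long_transvection_def by (simp add: algebra_simps)

text \<open>\<open>(u + w)(u + w)^T\<close> consists of \<open>u u^T\<close>, \<open>w w^T\<close>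
  and a mixed part. For orthogonal \<open>u\<close>, \<open>w\<close> all compositions of these
  parts through \<open>chi\<close> vanish, so the sum of entry functions becomes a product of
  transvections.\<close>

lemma long_transvection_split:
  assumes "omega n u w = 0"
  shows "long_transvection n c (\<lambda>i. u i + w i) =
    long_transvection n c u * long_transvection n c w * short_transvection n c u w"
  using assms omega_skew[of n w u]
  by (simp add: transvection_calculus) (simp add: algebra_simps)

text \<open>The two short factors compose to an extra \<open>c * c * omega n v w\<close> times
  \<open>u u^T\<close>; the long factor along \<open>u\<close> removes it.\<close>

lemma short_transvection_split:
  assumes "omega n u v = 0" "omega n u w = 0"
  shows "short_transvection n c u (\<lambda>i. v i + w i) =
    short_transvection n c u v * short_transvection n c u w * long_transvection n (- (c * c * omega n v w)) u"
  using assms omega_skew[of n v u] omega_skew[of n w u]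
  unfolding transvection_calculus by (simp add: algebra_simps)

lemma long_transvection_inverse: "long_transvection n c u * long_transvection n (- c) u = 1\<^sub>m (2 * n)"
  unfolding transvection_calculus by (simp add: transvection_zero)

lemma short_transvection_inverse:
  "omega n u w = 0 \<Longrightarrow> short_transvection n c u w * short_transvection n (- c) u w = 1\<^sub>m (2 * n)"
  using omega_skew[of n w u] unfolding transvection_calculus by (simp add: transvection_zero)

text \<open>Conjugating a transvection applies the symplectic map to its vector, and
  \<open>f\<close> goes to \<open>f + v\<close> because \<open>omega n e f = 1\<close>. Written
  without inverses this is a polynomial identity.\<close>

lemma short_transvection_conj:
  assumes "omega n e f = 1" "omega n e v = 0" "omega n f v = 0"
  shows "short_transvection n 1 e v * long_transvection n c f =
    long_transvection n c (\<lambda>i. f i + v i) * short_transvection n 1 e v"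
  using assms omega_skew[of n f e] omega_skew[of n v e] omega_skew[of n v f]
  unfolding long_transvection_add unfolding transvection_calculus by (simp add: algebra_simps)

text \<open>Symmetry of \<open>S\<close> gives \<open>T^T chi = chi (1 - S chi)\<close> for
  \<open>T = 1 + S chi\<close>, and \<open>(1 - S chi)(1 + S chi) = 1\<close> as
  \<open>S chi S = 0\<close>.\<close>

lemma transvection_symplectic:
  assumes sym: "\<And>i j. s i j = s j i" and iso: "chi_comp n s s = (\<lambda>i j. 0)"
  shows "transpose_mat (transvection n s) * chi n * transvection n s = chi n"
proof -
  let ?N = "2 * n"
  let ?T = "transvection n s" and ?T' = "transvection n (\<lambda>i j. - s i j)"
  have neg: "chi_comp n (\<lambda>i j. - s i j) s = (\<lambda>i j. 0)"
    using iso unfolding chi_comp_def by (simp add: fun_eq_iff sum_negf)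
  have "transpose_mat ?T * chi n = chi n * ?T'"
  proof (rule eq_matI)
    fix i j assume "i < dim_row (chi n * ?T')" "j < dim_col (chi n * ?T')"
    then have ij: "i < ?N" "j < ?N" by auto
    then show "(transpose_mat ?T * chi n) $$ (i, j) = (chi n * ?T') $$ (i, j)"
      using sym[of "sigma i" "sigma j"]
      by (auto simp: mult_chi_index[of _ ?N] chi_mult_index[of _ n ?N] transvection_index sigma_eq
          distrib_left simp del: index_mult_mat(1))
  qed auto
  then have "transpose_mat ?T * chi n * ?T = chi n * (?T' * ?T)"
    using assoc_mult_mat[OF chi_carrier transvection_carrier transvection_carrier, of n "\<lambda>i j. - s i j" s] by simp
  also have "?T' * ?T = 1\<^sub>m ?N"
    by (simp add: transvection_mult neg transvection_zero)
  finally show ?thesis by simp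
qed

section \<open>Elementary symplectic groups\<close>

lemma symp_elem_mat_dim [simp]:
  "dim_row (symp_elem_mat n i j a) = 2 * n" "dim_col (symp_elem_mat n i j a) = 2 * n"
  by (simp_all add: symp_elem_mat_def mat_unit_def)

lemma symp_elem_mat_index:
  "r < 2 * n \<Longrightarrow> c < 2 * n \<Longrightarrow> symp_elem_mat n i j a $$ (r, c) =
    (if r = c then 1 else 0) + (if r = i \<and> c = j then a else 0) -
    (if i \<noteq> sigma j \<and> r = sigma j \<and> c = sigma i then (- 1) ^ (i + j) * a else 0)"
  by (cases "i = sigma j") (auto simp: symp_elem_mat_def mat_unit_def)

lemma plane_sign_mult: "plane_sign i * plane_sign j = (- 1) ^ (i + j)"
  by (auto simp: plane_sign_def)

text \<open>The factor \<open>plane_sign j\<close> undoes the entry of \<open>chi\<close> by which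
  \<open>transvection\<close> multiplies column \<open>j\<close>.\<close>

lemma symp_elem_mat_long:
  "symp_elem_mat n (sigma j) j a = long_transvection n (plane_sign j * a) (unit_fun (sigma j))"
  unfolding long_transvection_def
  by (intro eq_matI) (auto simp: symp_elem_mat_index transvection_index)

lemma symp_elem_mat_short:
  assumes "i \<noteq> sigma j"
  shows "symp_elem_mat n i j a = short_transvection n (plane_sign j * a) (unit_fun i) (unit_fun (sigma j))"
  unfolding short_transvection_def
proof (intro eq_matI)
  fix r c assume "r < dim_row (transvection n (\<lambda>r c. plane_sign j * a * (unit_fun i r * unit_fun (sigma j) c) +
      plane_sign j * a * (unit_fun (sigma j) r * unit_fun i c)))"
    "c < dim_col (transvection n (\<lambda>r c. plane_sign j * a * (unit_fun i r * unit_fun (sigma j) c) +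
      plane_sign j * a * (unit_fun (sigma j) r * unit_fun i c)))"
  then have rc: "r < 2 * n" "c < 2 * n" by simp_all
  have "plane_sign c * (plane_sign j * a * (unit_fun i r * unit_fun (sigma j) (sigma c))) =
      (if r = i \<and> c = j then a else 0)"
    by auto
  moreover have "plane_sign c * (plane_sign j * a * (unit_fun (sigma j) r * unit_fun i (sigma c))) =
      - (if r = sigma j \<and> c = sigma i then (- 1) ^ (i + j) * a else 0)"
    by (auto simp: sigma_eq plane_sign_mult[symmetric])
  ultimately show "symp_elem_mat n i j a $$ (r, c) =
    transvection n (\<lambda>r c. plane_sign j * a * (unit_fun i r * unit_fun (sigma j) c) +
      plane_sign j * a * (unit_fun (sigma j) r * unit_fun i c)) $$ (r, c)"
    using rc assms by (simp add: symp_elem_mat_index transvection_index distrib_left)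
qed simp_all

lemma long_transvection_symplectic:
  "transpose_mat (long_transvection n c u) * chi n * long_transvection n c u = chi n"
  unfolding long_transvection_def
  by (rule transvection_symplectic) (simp_all add: chi_comp_outer mult.commute)

lemma short_transvection_symplectic:
  assumes "omega n u w = 0"
  shows "transpose_mat (short_transvection n c u w) * chi n * short_transvection n c u w = chi n"
  unfolding short_transvection_def
proof (rule transvection_symplectic)
  show "chi_comp n (\<lambda>i j. c * (u i * w j) + c * (w i * u j)) (\<lambda>i j. c * (u i * w j) + c * (w i * u j)) = (\<lambda>i j. 0)"
    unfolding chi_comp_add chi_comp_outer using assms omega_skew[of n w u] by simp
qed (simp add: ac_simps)

lemma transvection_GL:
  "long_transvection n c u \<in> carrier (GL (2 * n))"
  "omega n u w = 0 \<Longrightarrow> short_transvection n c u w \<in> carrier (GL (2 * n))"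
proof -
  show "long_transvection n c u \<in> carrier (GL (2 * n))"
    using long_transvection_inverse[of n c u] long_transvection_inverse[of n "- c" u]
    by (intro GL_I[where B = "long_transvection n (- c) u"]) (simp_all add: long_transvection_def)
  show "short_transvection n c u w \<in> carrier (GL (2 * n))" if "omega n u w = 0"
    using short_transvection_inverse[OF that, of c] short_transvection_inverse[OF that, of "- c"]
    by (intro GL_I[where B = "short_transvection n (- c) u w"]) (simp_all add: short_transvection_def)
qed

lemma omega_unit_unit:
  "a < 2 * n \<Longrightarrow> sigma a \<noteq> b \<Longrightarrow> omega n (unit_fun b) (unit_fun a) = 0"
  by (simp add: omega_unit)

definition symp_set :: "nat \<Rightarrow> 'a::comm_ring_1 set \<Rightarrow> 'a mat set" where
  "symp_set n I = {symp_elem_mat n i j a | i j a. i < 2 * n \<and> j < 2 * n \<and> i \<noteq> j \<and> a \<in> I}"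

lemma symp_set_cases:
  assumes "A \<in> symp_set n I" "ideal_set I"
  obtains (long) i a where "i < 2 * n" "a \<in> I" "A = long_transvection n a (unit_fun i)"
  | (short) i k a where "i < 2 * n" "k < 2 * n" "i \<noteq> k" "k \<noteq> sigma i" "a \<in> I"
      "A = short_transvection n a (unit_fun i) (unit_fun k)"
proof -
  interpret ideal_set I by fact
  obtain i j a where A: "A = symp_elem_mat n i j a" "i < 2 * n" "j < 2 * n" "i \<noteq> j" "a \<in> I"
    using assms(1) by (auto simp: symp_set_def)
  show ?thesis
  proof (cases "i = sigma j")
    case True
    then show ?thesis using A long[of i "plane_sign j * a"] symp_elem_mat_long[of n j a] by auto
  next
    case False
    then show ?thesis
      using A short[of i "sigma j" "plane_sign j * a"] symp_elem_mat_short[OF False, of n a] by auto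
  qed
qed

lemma long_symp_set:
  assumes "i < 2 * n" "a \<in> I" "ideal_set I"
  shows "long_transvection n a (unit_fun i) \<in> symp_set n I"
proof -
  interpret ideal_set I by fact
  have "long_transvection n a (unit_fun i) = symp_elem_mat n i (sigma i) (plane_sign (sigma i) * a)"
    using symp_elem_mat_long[of n "sigma i" "plane_sign (sigma i) * a"] by simp
  moreover have "plane_sign (sigma i) * a \<in> I" using assms by auto
  ultimately show ?thesis using assms unfolding symp_set_def by fastforce
qed

lemma short_symp_set:
  assumes "i < 2 * n" "k < 2 * n" "i \<noteq> k" "k \<noteq> sigma i" "a \<in> I" "ideal_set I"
  shows "short_transvection n a (unit_fun i) (unit_fun k) \<in> symp_set n I"
proof -
  interpret ideal_set I by fact
  have "short_transvection n a (unit_fun i) (unit_fun k) = symp_elem_mat n i (sigma k) (plane_sign (sigma k) * a)"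
    using symp_elem_mat_short[of i "sigma k" n "plane_sign (sigma k) * a"] assms by simp
  moreover have "plane_sign (sigma k) * a \<in> I" "i \<noteq> sigma k" using assms by (auto simp: sigma_eq)
  ultimately show ?thesis using assms unfolding symp_set_def by fastforce
qed

lemma symp_set_symplectic:
  assumes "A \<in> symp_set n I"
  shows "A \<in> carrier (GL (2 * n))" "transpose_mat A * chi n * A = chi n"
proof -
  have "A \<in> symp_set n UNIV" using assms by (auto simp: symp_set_def)
  then show "A \<in> carrier (GL (2 * n))"
    using ideal_set_UNIV
    by (cases rule: symp_set_cases) (auto intro!: transvection_GL omega_unit_unit simp: sigma_eq)
  show "transpose_mat A * chi n * A = chi n"
    using \<open>A \<in> symp_set n UNIV\<close> ideal_set_UNIV
    by (cases rule: symp_set_cases)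
      (auto intro!: long_transvection_symplectic short_transvection_symplectic omega_unit_unit simp: sigma_eq)
qed

lemma symp_set_GL: "symp_set n I \<subseteq> carrier (GL (2 * n))"
  using symp_set_symplectic by blast

lemma ESp_generate: "ESp n = generate (GL (2 * n)) (symp_set n UNIV)"
  by (simp add: ESp_def symp_set_def)

lemma ESp_subgroup: "subgroup (ESp n) (GL (2 * n))"
  unfolding ESp_generate by (rule group.generate_is_subgroup[OF GL_group symp_set_GL])

lemma ESp_GL: "ESp n \<subseteq> carrier (GL (2 * n))"
  by (rule subgroup.subset[OF ESp_subgroup])

lemma ESp_rel_conj_gen: "ESp_rel n I = conj_gen (GL (2 * n)) (ESp n) (symp_set n I)"
  unfolding ESp_rel_def conj_gen_def symp_set_def
  by (rule arg_cong[where f = "generate (GL (2 * n))"]) (simp, blast)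

lemma ESp_rel_subgroup: "subgroup (ESp_rel n I) (GL (2 * n))"
  unfolding ESp_rel_conj_gen by (rule group.conj_gen_subgroup[OF GL_group ESp_GL symp_set_GL])

lemma ESp_rel_mult: "A \<in> ESp_rel n I \<Longrightarrow> B \<in> ESp_rel n I \<Longrightarrow> A * B \<in> ESp_rel n I"
  using subgroup.m_closed[OF ESp_rel_subgroup, of A n I B] by simp

lemma symp_set_ESp_rel: "symp_set n I \<subseteq> ESp_rel n I"
  unfolding ESp_rel_conj_gen
  using group.conj_gen_incl[OF GL_group symp_set_GL subgroup.one_closed[OF ESp_subgroup]] by blast

lemma ESp_rel_normalised:
  "A \<in> ESp n \<Longrightarrow> B \<in> ESp_rel n I \<Longrightarrow> A * B * inv\<^bsub>GL (2 * n)\<^esub> A \<in> ESp_rel n I"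
  using group.conj_gen_normalised[OF GL_group ESp_subgroup symp_set_GL, of A n B I]
  by (simp add: ESp_rel_conj_gen)

lemma ESp_rel_UNIV: "ESp_rel n UNIV = ESp n"
proof
  show "ESp_rel n UNIV \<subseteq> ESp n"
    unfolding ESp_rel_conj_gen
  proof (rule group.conj_gen_minimal[OF GL_group ESp_subgroup])
    show "symp_set n UNIV \<subseteq> ESp n"
      unfolding ESp_generate by (auto intro: generate.incl)
    show "k \<otimes>\<^bsub>GL (2 * n)\<^esub> p \<otimes>\<^bsub>GL (2 * n)\<^esub> inv\<^bsub>GL (2 * n)\<^esub> k \<in> ESp n"
      if "k \<in> ESp n" "p \<in> ESp n" for k p
      using that subgroup.m_closed[OF ESp_subgroup] subgroup.m_inv_closed[OF ESp_subgroup] by blast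
  qed
  show "ESp n \<subseteq> ESp_rel n UNIV"
    unfolding ESp_generate
    by (rule group.generate_subgroup_incl[OF GL_group symp_set_ESp_rel ESp_rel_subgroup])
qed

lemma symp_elem_mat_product:
  assumes "i < 2 * n" "j < 2 * n" "i \<noteq> j" "i \<noteq> sigma j"
  shows "symp_elem_mat n i j a = elem_mat (2 * n) i j a * elem_mat (2 * n) (sigma j) (sigma i) (- ((- 1) ^ (i + j) * a))"
  using assms
  by (intro eq_matI)
    (auto simp: symp_elem_mat_index elem_mat_mult_right elem_mat_index sigma_eq simp del: index_mult_mat(1))

lemma symp_set_E_rel:
  assumes "ideal_set I"
  shows "symp_set n I \<subseteq> E_rel (2 * n) I"
proof
  interpret ideal_set I by fact
  fix A assume "A \<in> symp_set n I"
  then obtain i j a where A: "A = symp_elem_mat n i j a" and ij: "i < 2 * n" "j < 2 * n" "i \<noteq> j" "a \<in> I"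
    by (auto simp: symp_set_def)
  show "A \<in> E_rel (2 * n) I"
  proof (cases "i = sigma j")
    case True
    then have "A = elem_mat (2 * n) i j a" unfolding A symp_elem_mat_def elem_mat_def by simp
    then show ?thesis using ij by (simp add: elem_mat_E_rel)
  next
    case False
    then have "sigma j \<noteq> sigma i" using ij by simp
    then show ?thesis
      unfolding A symp_elem_mat_product[OF ij(1-3) False]
      using ij by (intro E_rel_mult elem_mat_E_rel) auto
  qed
qed

lemma ESp_E: "ESp n \<subseteq> E (2 * n)"
  unfolding ESp_generate using symp_set_E_rel[OF ideal_set_UNIV, of n] E_subgroup[of "2 * n"]
  by (intro group.generate_subgroup_incl[OF GL_group]) (simp_all add: E_rel_UNIV)

lemma ESp_rel_E_rel:
  assumes "ideal_set I"
  shows "ESp_rel n I \<subseteq> E_rel (2 * n) I"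
  unfolding ESp_rel_conj_gen
proof (rule group.conj_gen_minimal[OF GL_group E_rel_subgroup symp_set_E_rel[OF assms]])
  show "k \<otimes>\<^bsub>GL (2 * n)\<^esub> p \<otimes>\<^bsub>GL (2 * n)\<^esub> inv\<^bsub>GL (2 * n)\<^esub> k \<in> E_rel (2 * n) I"
    if "k \<in> ESp n" "p \<in> E_rel (2 * n) I" for k p
    using E_rel_normalised[of k "2 * n" p I] that ESp_E by auto
qed

section \<open>Symplectic groups and their stabilisation\<close>

definition Sp :: "nat \<Rightarrow> 'a::comm_ring_1 mat set" where
  "Sp n = {A \<in> carrier (GL (2 * n)). transpose_mat A * chi n * A = chi n}"

lemma congruence_mult:
  fixes A B C :: "'a::comm_ring_1 mat"
  assumes "A \<in> carrier_mat n n" "B \<in> carrier_mat n n" "C \<in> carrier_mat n n"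
  shows "transpose_mat (A * B) * C * (A * B) = transpose_mat B * (transpose_mat A * C * A) * B"
proof -
  have c: "transpose_mat A \<in> carrier_mat n n" "transpose_mat B \<in> carrier_mat n n" using assms by auto
  show ?thesis
    unfolding transpose_mult[OF assms(1,2)]
    using assms c by (simp add: square_mult_assoc[where n = n] square_mult_closed del: assoc_mult_mat)
qed

lemma congruence_inverse:
  fixes A C D :: "'a::comm_ring_1 mat"
  assumes A: "A \<in> carrier (GL n)" and C: "C \<in> carrier_mat n n" and D: "transpose_mat A * C * A = D"
  shows "transpose_mat (inv\<^bsub>GL n\<^esub> A) * D * inv\<^bsub>GL n\<^esub> A = C"
proof -
  have c: "A \<in> carrier_mat n n" "inv\<^bsub>GL n\<^esub> A \<in> carrier_mat n n" using A GL_inv[OF A] by blast+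
  show ?thesis
    unfolding D[symmetric] congruence_mult[OF c C, symmetric] using A C by simp
qed

lemma Sp_subgroup: "subgroup (Sp n) (GL (2 * n) :: 'a::comm_ring_1 mat monoid)"
proof -
  interpret group "GL (2 * n) :: 'a mat monoid" by (rule GL_group)
  show ?thesis
  proof (intro subgroupI)
    show "Sp n \<subseteq> carrier (GL (2 * n) :: 'a mat monoid)" by (auto simp: Sp_def)
    have "1\<^sub>m (2 * n) \<in> (Sp n :: 'a mat set)"
      unfolding Sp_def using left_mult_one_mat[OF chi_carrier] right_mult_one_mat[OF chi_carrier]
      by simp
    then show "Sp n \<noteq> ({} :: 'a mat set)" by blast
    fix A B :: "'a mat" assume A: "A \<in> Sp n"
    then show "inv\<^bsub>GL (2 * n)\<^esub> A \<in> Sp n"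
      using congruence_inverse[of A "2 * n" "chi n" "chi n"] unfolding Sp_def by simp
    assume B: "B \<in> Sp n"
    have "A \<in> carrier_mat (2 * n) (2 * n)" "B \<in> carrier_mat (2 * n) (2 * n)"
      using A B unfolding Sp_def by blast+
    then have "transpose_mat (A * B) * chi n * (A * B) = chi n"
      using A B congruence_mult[of A "2 * n" B "chi n"] unfolding Sp_def by simp
    then show "A \<otimes>\<^bsub>GL (2 * n)\<^esub> B \<in> Sp n"
      using A B unfolding Sp_def by simp
  qed
qed

lemma Sp_rel_iff: "A \<in> Sp_rel n I \<longleftrightarrow> A \<in> GL_rel (2 * n) I \<and> A \<in> Sp n"
  by (auto simp: Sp_rel_def Sp_def GL_rel_def)

lemma ESp_Sp: "ESp n \<subseteq> Sp n"
  unfolding ESp_generate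
  by (rule group.generate_subgroup_incl[OF GL_group _ Sp_subgroup])
    (use symp_set_symplectic in \<open>auto simp: Sp_def\<close>)

lemma ESp_rel_mono: "I \<subseteq> J \<Longrightarrow> ESp_rel n I \<subseteq> ESp_rel n J"
  unfolding ESp_rel_conj_gen conj_gen_def
  by (rule group.mono_generate[OF GL_group]) (auto simp: symp_set_def, blast)

lemma ESp_rel_ESp: "ESp_rel n I \<subseteq> ESp n"
  using ESp_rel_mono[of I UNIV n] by (simp add: ESp_rel_UNIV)

lemma ESp_rel_Sp_rel:
  assumes "ideal_set I"
  shows "ESp_rel n I \<subseteq> Sp_rel n I"
proof
  fix x assume x: "x \<in> ESp_rel n I"
  have "x \<in> Sp n" using x ESp_rel_ESp ESp_Sp by blast
  moreover have "x \<in> GL_rel (2 * n) I"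
    using x ESp_rel_E_rel[OF assms] ideal_set.E_rel_subset_GL_rel[OF assms] by blast
  ultimately show "x \<in> Sp_rel n I" by (simp add: Sp_rel_iff)
qed

text \<open>Pfaffians of both sides of \<open>A^T chi A = chi\<close>; determinants would only yield
  \<open>det A * det A = 1\<close>.\<close>

lemma det_Sp:
  fixes A :: "'a::comm_ring_1 mat"
  assumes "A \<in> Sp n"
  shows "det A = 1"
proof -
  have "A \<in> carrier_mat (2 * n) (2 * n)" "transpose_mat A * chi n * A = chi n"
    using assms unfolding Sp_def by blast+
  then show ?thesis
    using pfaffian_congruence[OF _ chi_carrier chi_alternating, of A n] by (simp add: pfaffian_chi)
qed

lemma transvection_mat_sum:
  "1\<^sub>m (2 * k) \<bottom> transvection n s =
    transvection (k + n) (\<lambda>i j. if i < 2 * k \<or> j < 2 * k then 0 else s (i - 2 * k) (j - 2 * k))"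
  (is "_ = transvection _ ?s")
proof (rule eq_matI)
  fix i j assume "i < dim_row (transvection (k + n) ?s)" "j < dim_col (transvection (k + n) ?s)"
  then have ij: "i < 2 * (k + n)" "j < 2 * (k + n)" by simp_all
  show "(1\<^sub>m (2 * k) \<bottom> transvection n s) $$ (i, j) = transvection (k + n) ?s $$ (i, j)"
  proof (cases "i < 2 * k \<or> j < 2 * k")
    case True
    then show ?thesis
      using ij sigma_less_iff[of j k] by (auto simp: mat_sum_index transvection_index)
  next
    case False
    obtain a where a: "i = 2 * k + a" using False le_Suc_ex[of "2 * k" i] by auto
    obtain b where b: "j = 2 * k + b" using False le_Suc_ex[of "2 * k" j] by auto
    show ?thesis
      using ij by (simp add: mat_sum_index transvection_index a b sigma_add)
  qed
qed simp_all

lemma long_transvection_mat_sum: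
  "1\<^sub>m (2 * k) \<bottom> long_transvection n c u =
    long_transvection (k + n) c (\<lambda>i. if i < 2 * k then 0 else u (i - 2 * k))"
  unfolding long_transvection_def transvection_mat_sum by (rule transvection_cong) auto

lemma short_transvection_mat_sum:
  "1\<^sub>m (2 * k) \<bottom> short_transvection n c u w =
    short_transvection (k + n) c (\<lambda>i. if i < 2 * k then 0 else u (i - 2 * k))
      (\<lambda>i. if i < 2 * k then 0 else w (i - 2 * k))"
  unfolding short_transvection_def transvection_mat_sum by (rule transvection_cong) auto

lemma mat_sum_symp_set:
  assumes "ideal_set I" "A \<in> symp_set n I"
  shows "1\<^sub>m (2 * k) \<bottom> A \<in> symp_set (k + n) I"
proof -
  have u: "(\<lambda>i. if i < 2 * k then 0 else unit_fun a (i - 2 * k)) = unit_fun (2 * k + a)" for a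
    by (auto simp: fun_eq_iff)
  show ?thesis
    using assms(2,1)
  proof (cases rule: symp_set_cases)
    case (long i a)
    then show ?thesis
      using long_symp_set[of "2 * k + i" "k + n" a I] assms(1) by (simp add: long_transvection_mat_sum u)
  next
    case (short i l a)
    then show ?thesis
      using short_symp_set[of "2 * k + i" "k + n" "2 * k + l" a I] assms(1)
      by (simp add: short_transvection_mat_sum u sigma_add)
  qed
qed

lemma ESp_rel_one_sum:
  assumes I: "ideal_set I" and x: "x \<in> ESp_rel n I"
  shows "1\<^sub>m (2 * k) \<bottom> x \<in> ESp_rel (k + n) I"
proof -
  have h: "group_hom (GL (2 * n)) (GL (2 * (k + n))) (\<lambda>A. 1\<^sub>m (2 * k) \<bottom> A :: 'a mat)"
    using GL_mat_sum_hom[of "2 * n" "2 * k" 0] by (simp add: distrib_left)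
  have S: "(\<lambda>A. 1\<^sub>m (2 * k) \<bottom> A) ` symp_set n J \<subseteq> symp_set (k + n) J" if "ideal_set J" for J :: "'a set"
    using mat_sum_symp_set[OF that] by blast
  have "(\<lambda>A. 1\<^sub>m (2 * k) \<bottom> A) ` ESp n \<subseteq> (ESp (k + n) :: 'a mat set)"
  proof -
    have "(\<lambda>A. 1\<^sub>m (2 * k) \<bottom> A) ` ESp n =
        generate (GL (2 * (k + n))) ((\<lambda>A. 1\<^sub>m (2 * k) \<bottom> A) ` symp_set n (UNIV :: 'a set))"
      unfolding ESp_generate by (rule group_hom.generate_img[OF h symp_set_GL, symmetric])
    also have "\<dots> \<subseteq> ESp (k + n)"
      unfolding ESp_generate by (rule group.mono_generate[OF GL_group S[OF ideal_set_UNIV]])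
    finally show ?thesis .
  qed
  from group_hom.conj_gen_img[OF h ESp_GL symp_set_GL this S[OF I] ESp_GL symp_set_GL]
  show ?thesis using x unfolding ESp_rel_conj_gen by blast
qed

section \<open>Stable normality of the elementary symplectic group\<close>

lemma short_cong:
  "(\<And>i. i < 2 * n \<Longrightarrow> w i = w' i) \<Longrightarrow> short_transvection n c u w = short_transvection n c u w'"
  unfolding short_transvection_def by (rule transvection_cong) simp

lemma transvection_carriers [simp]:
  "long_transvection n c u \<in> carrier_mat (2 * n) (2 * n)"
  "short_transvection n c u w \<in> carrier_mat (2 * n) (2 * n)"
  by (simp_all add: long_transvection_def short_transvection_def)

lemma omega_unit_left: "a < 2 * n \<Longrightarrow> omega n (unit_fun a) w = - (plane_sign a * w (sigma a))"
  using omega_skew[of n "unit_fun a" w] by (simp add: omega_unit)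

context ideal_set
begin

lemma long_unit_ESp_rel: "a < 2 * n \<Longrightarrow> c \<in> I \<Longrightarrow> long_transvection n c (unit_fun a) \<in> ESp_rel n I"
  using long_symp_set[OF _ _ ideal_set_axioms] symp_set_ESp_rel by blast

text \<open>The coordinates of \<open>v\<close> are switched on one at a time. Each new one
  contributes a short generator and a long correction along \<open>unit_fun a\<close>, both with
  coefficients that are multiples of \<open>x\<close>. As \<open>v\<close> vanishes on the first
  plane, \<open>unit_fun a\<close> is orthogonal to every vector that occurs.\<close>

lemma short_unit_ESp_rel:
  assumes a: "a < 2" "a < 2 * n" and v: "v 0 = 0" "v 1 = 0" and x: "x \<in> I"
  shows "short_transvection n x (unit_fun a) v \<in> ESp_rel n I"
proof -
  define t where "t m = (\<lambda>i. if i < m then v i else 0)" for m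
  have sa: "sigma a < 2" using a(1) sigma_less[of a 1] by simp
  have orth: "omega n (unit_fun a) w = 0" if "w 0 = 0" "w 1 = 0" for w :: "nat \<Rightarrow> 'a"
  proof -
    have "w (sigma a) = 0" using sa that by (auto simp: less_2_cases_iff)
    then show ?thesis using a by (simp add: omega_unit_left)
  qed
  have "short_transvection n x (unit_fun a) (t m) \<in> ESp_rel n I" if "m \<le> 2 * n" for m
    using that
  proof (induction m)
    case 0
    have "short_transvection n x (unit_fun a) (t 0) = 1\<^sub>m (2 * n)"
      by (simp add: t_def short_transvection_def transvection_zero)
    then show ?case using subgroup.one_closed[OF ESp_rel_subgroup, of n I] by simp
  next
    case (Suc m)
    show ?case
    proof (cases "m < 2")
      case True
      then have "t (Suc m) = t m" using v by (auto simp: t_def fun_eq_iff less_2_cases_iff less_Suc_eq)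
      then show ?thesis using Suc by simp
    next
      case False
      let ?w = "\<lambda>i. v m * unit_fun m i"
      have t: "t (Suc m) = (\<lambda>i. t m i + ?w i)"
        by (auto simp: t_def fun_eq_iff less_Suc_eq)
      have "omega n (unit_fun a) (t m) = 0" "omega n (unit_fun a) ?w = 0"
        using v False by (intro orth; simp add: t_def)+
      then have "short_transvection n x (unit_fun a) (t (Suc m)) =
          short_transvection n x (unit_fun a) (t m) * short_transvection n x (unit_fun a) ?w *
          long_transvection n (- (x * x * omega n (t m) ?w)) (unit_fun a)"
        unfolding t by (rule short_transvection_split)
      moreover have "short_transvection n x (unit_fun a) ?w = short_transvection n (x * v m) (unit_fun a) (unit_fun m)"
        unfolding short_transvection_def by (rule transvection_cong) (simp add: ac_simps)
      moreover have "short_transvection n (x * v m) (unit_fun a) (unit_fun m) \<in> ESp_rel n I"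
        using symp_set_ESp_rel[of n I] short_symp_set[of a n m "x * v m" I] ideal_set_axioms a sa False x Suc.prems
        by (auto simp del: One_nat_def)
      moreover have "long_transvection n (- (x * x * omega n (t m) ?w)) (unit_fun a) \<in> ESp_rel n I"
        using x by (intro long_unit_ESp_rel a uminus mult_right)
      ultimately show ?thesis using Suc by (auto intro!: ESp_rel_mult)
    qed
  qed
  from this[of "2 * n"] show ?thesis
    using short_cong[of n v "t (2 * n)" x "unit_fun a"] by (simp add: t_def)
qed

end

lemma ESp_rel_conj:
  assumes "k \<in> ESp n" "l \<in> carrier_mat (2 * n) (2 * n)" "k * l = 1\<^sub>m (2 * n)" "l * k = 1\<^sub>m (2 * n)"
    and "x \<in> ESp_rel n I"
  shows "k * x * l \<in> ESp_rel n I"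
proof -
  have "k \<in> carrier (GL (2 * n))" using assms(1) ESp_GL by auto
  then have "inv\<^bsub>GL (2 * n)\<^esub> k = l" using assms by (intro GL_inv_eq) auto
  then show ?thesis using ESp_rel_normalised[OF assms(1,5)] by simp
qed

context ideal_set
begin

text \<open>The transvection \<open>short_transvection n 1 e v\<close> moves the basis vector \<open>f\<close> of the first hyperbolic
  plane to \<open>f + v\<close>; expanding the transvection along \<open>f + v\<close> leaves the one along \<open>v\<close>.\<close>

lemma long_ESp_rel:
  assumes n: "0 < n" and v: "v 0 = 0" "v 1 = 0" and x: "x \<in> I"
  shows "long_transvection n x v \<in> ESp_rel n I"
proof -
  define e f :: "nat \<Rightarrow> 'a" where "e = unit_fun 0" and "f = unit_fun 1"
  have less: "0 < 2 * n" "1 < 2 * n" using n by auto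
  have w: "omega n e f = 1" "omega n e v = 0" "omega n f v = 0"
    using v less unfolding e_def f_def by (simp_all add: omega_unit_left plane_sign_def sigma_def)
  let ?T = "short_transvection n 1 e v" and ?T' = "short_transvection n (- 1) e v"
  note c = transvection_carriers[of n]
  have T: "?T * ?T' = 1\<^sub>m (2 * n)" "?T' * ?T = 1\<^sub>m (2 * n)"
    using short_transvection_inverse[OF w(2), of 1] short_transvection_inverse[OF w(2), of "- 1"] by simp_all
  have "?T \<in> ESp n"
    unfolding ESp_rel_UNIV[symmetric] e_def
    by (rule ideal_set.short_unit_ESp_rel[OF ideal_set_UNIV]) (use less v in auto)
  moreover have f: "long_transvection n y f \<in> ESp_rel n I" if "y \<in> I" for y
    unfolding f_def using less(2) that by (rule long_unit_ESp_rel)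
  ultimately have "?T * long_transvection n x f * ?T' \<in> ESp_rel n I"
    using T x by (intro ESp_rel_conj) auto
  also have "?T * long_transvection n x f * ?T' = long_transvection n x (\<lambda>i. f i + v i) * (?T * ?T')"
    unfolding short_transvection_conj[OF w]
    by (simp add: square_mult_assoc[where n = "2 * n"] del: assoc_mult_mat)
  also have "\<dots> = long_transvection n x f * long_transvection n x v * short_transvection n x f v"
    unfolding T long_transvection_split[OF w(3), of x, symmetric] by (rule right_mult_one_mat[OF c(1)])
  finally have prod: "long_transvection n x f * long_transvection n x v * short_transvection n x f v \<in> ESp_rel n I" .
  have inverses: "long_transvection n (- x) f * long_transvection n x f = 1\<^sub>m (2 * n)"
    "short_transvection n x f v * short_transvection n (- x) f v = 1\<^sub>m (2 * n)"
    using long_transvection_inverse[of n "- x" f] short_transvection_inverse[OF w(3), of x] by simp_all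
  have "short_transvection n (- x) f v \<in> ESp_rel n I"
    unfolding f_def by (rule short_unit_ESp_rel) (use less v x in auto)
  then have "long_transvection n (- x) f * (long_transvection n x f * long_transvection n x v * short_transvection n x f v) *
      short_transvection n (- x) f v \<in> ESp_rel n I"
    by (rule ESp_rel_mult[OF ESp_rel_mult[OF f[OF uminus[OF x]] prod]])
  also have "long_transvection n (- x) f * (long_transvection n x f * long_transvection n x v * short_transvection n x f v) *
      short_transvection n (- x) f v =
    (long_transvection n (- x) f * long_transvection n x f) * long_transvection n x v *
      (short_transvection n x f v * short_transvection n (- x) f v)"
    by (simp add: square_mult_assoc[where n = "2 * n"] square_mult_closed del: assoc_mult_mat)
  also have "\<dots> = long_transvection n x v"
    unfolding inverses left_mult_one_mat[OF c(1)] right_mult_one_mat[OF c(1)] ..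
  finally show ?thesis .
qed

text \<open>The additional plane supplies the two zero coordinates that \<open>long_ESp_rel\<close>
  asks for, so \<open>u\<close> may be arbitrary.\<close>

lemma stable_long_ESp_rel: "x \<in> I \<Longrightarrow> 1\<^sub>m 2 \<bottom> long_transvection n x u \<in> ESp_rel (Suc n) I"
  using long_ESp_rel[of "Suc n" "\<lambda>i. if i < 2 then 0 else u (i - 2)" x] long_transvection_mat_sum[of 1 n x u]
  by (simp only: mult_1_right plus_1_eq_Suc zero_less_Suc) simp

text \<open>\<open>long_transvection_split\<close> solved for its short factor, so that only long
  transvections have to be factored.\<close>

lemma stable_short_ESp_rel:
  assumes "omega n u w = 0" "x \<in> I"
  shows "1\<^sub>m 2 \<bottom> short_transvection n x u w \<in> ESp_rel (Suc n) I"
proof -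
  let ?N = "2 * n"
  note c = transvection_carriers[of n]
  have inverses: "long_transvection n (- x) u * long_transvection n x u = 1\<^sub>m ?N" for u
    using long_transvection_inverse[of n "- x" u] by simp
  have "long_transvection n (- x) w * (long_transvection n (- x) u * long_transvection n x (\<lambda>i. u i + w i)) =
    long_transvection n (- x) w * ((long_transvection n (- x) u * long_transvection n x u) *
      (long_transvection n x w * short_transvection n x u w))"
    unfolding long_transvection_split[OF assms(1)]
    by (simp add: square_mult_assoc[where n = ?N] square_mult_closed del: assoc_mult_mat)
  also have "\<dots> = (long_transvection n (- x) w * long_transvection n x w) * short_transvection n x u w"
    unfolding inverses[of u] left_mult_one_mat[OF square_mult_closed[OF c(1) c(2)]]
    by (rule assoc_mult_mat[OF c(1) c(1) c(2), symmetric])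
  also have "\<dots> = short_transvection n x u w"
    unfolding inverses by (rule left_mult_one_mat[OF c(2)])
  finally have e: "short_transvection n x u w =
      long_transvection n (- x) w * (long_transvection n (- x) u * long_transvection n x (\<lambda>i. u i + w i))" ..
  have s: "1\<^sub>m 2 \<bottom> (A * B) = (1\<^sub>m 2 \<bottom> A) * (1\<^sub>m 2 \<bottom> B)"
    if "A \<in> carrier_mat ?N ?N" "B \<in> carrier_mat ?N ?N" for A B :: "'a mat"
    using that mat_sum_mult[of "1\<^sub>m 2" 2 2 "1\<^sub>m 2" 2 A ?N ?N B ?N] by simp
  have "1\<^sub>m 2 \<bottom> short_transvection n x u w = (1\<^sub>m 2 \<bottom> long_transvection n (- x) w) *
      ((1\<^sub>m 2 \<bottom> long_transvection n (- x) u) * (1\<^sub>m 2 \<bottom> long_transvection n x (\<lambda>i. u i + w i)))"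
    unfolding e using c by (simp add: s square_mult_closed)
  then show ?thesis
    using assms(2) by (auto intro!: ESp_rel_mult stable_long_ESp_rel)
qed

end

text \<open>For symplectic \<open>g\<close> one has \<open>chi g^-1 = g^T chi\<close>, hence
  \<open>g (1 + S chi) g^-1 = 1 + (g S g^T) chi\<close>.\<close>

lemma Sp_conj_transvection:
  fixes g :: "'a::comm_ring_1 mat"
  assumes g: "g \<in> Sp n"
  shows "g * transvection n s * inv\<^bsub>GL (2 * n)\<^esub> g =
    transvection n (\<lambda>i j. \<Sum>k = 0..<2 * n. \<Sum>l = 0..<2 * n. g $$ (i, k) * s k l * g $$ (j, l))"
proof -
  let ?N = "2 * n" and ?g' = "inv\<^bsub>GL (2 * n)\<^esub> g"
  let ?M = "mat ?N ?N (\<lambda>(i, j). s i j)"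
  have G: "g \<in> carrier (GL ?N)" "transpose_mat g * chi n * g = chi n" using g unfolding Sp_def by blast+
  have c: "g \<in> carrier_mat ?N ?N" "?g' \<in> carrier_mat ?N ?N" "transpose_mat g \<in> carrier_mat ?N ?N"
    "?M \<in> carrier_mat ?N ?N" "chi n \<in> carrier_mat ?N ?N"
    using G(1) GL_inv[OF G(1)] by (blast, blast, simp_all add: GL_dim)
  note assoc = square_mult_assoc[where n = ?N] square_mult_closed
  have "transpose_mat g * chi n = transpose_mat g * chi n * (g * ?g')"
    using G(1) c by (simp add: right_mult_one_mat[of _ ?N ?N] square_mult_closed)
  also have "\<dots> = transpose_mat g * chi n * g * ?g'"
    by (rule square_mult_assoc[OF square_mult_closed[OF c(3,5)] c(1,2), symmetric])
  also have "\<dots> = chi n * ?g'"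
    unfolding G(2) ..
  finally have chi: "chi n * ?g' = transpose_mat g * chi n" ..
  have "g * transvection n s * ?g' = (g + g * (?M * chi n)) * ?g'"
    unfolding transvection_def using c
    by (subst mult_add_distrib_mat[of _ ?N ?N _ ?N]) (simp_all add: right_mult_one_mat[of _ ?N ?N] square_mult_closed)
  also have "\<dots> = g * ?g' + g * (?M * chi n) * ?g'"
    using c by (subst add_mult_distrib_mat[of _ ?N ?N _ _ ?N]) (simp_all add: square_mult_closed)
  also have "g * (?M * chi n) * ?g' = g * ?M * (chi n * ?g')"
    using c by (simp add: assoc del: assoc_mult_mat)
  also have "\<dots> = g * ?M * transpose_mat g * chi n"
    unfolding chi using c by (simp add: assoc del: assoc_mult_mat)
  also have "g * ?M * transpose_mat g = transpose_mat (transpose_mat g) * ?M * transpose_mat g" by simp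
  also have "\<dots> = mat ?N ?N (\<lambda>(i, j). \<Sum>k = 0..<2 * n. \<Sum>l = 0..<2 * n. g $$ (i, k) * s k l * g $$ (j, l))"
  proof (rule eq_matI)
    fix i j
    assume "i < dim_row (mat ?N ?N (\<lambda>(i, j). \<Sum>k = 0..<2 * n. \<Sum>l = 0..<2 * n. g $$ (i, k) * s k l * g $$ (j, l)))"
      "j < dim_col (mat ?N ?N (\<lambda>(i, j). \<Sum>k = 0..<2 * n. \<Sum>l = 0..<2 * n. g $$ (i, k) * s k l * g $$ (j, l)))"
    then have ij: "i < ?N" "j < ?N" by auto
    have d: "dim_row g = ?N" "dim_col g = ?N" using c(1) by auto
    show "(transpose_mat (transpose_mat g) * ?M * transpose_mat g) $$ (i, j) =
        mat ?N ?N (\<lambda>(i, j). \<Sum>k = 0..<2 * n. \<Sum>l = 0..<2 * n. g $$ (i, k) * s k l * g $$ (j, l)) $$ (i, j)"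
      unfolding congruence_index[OF c(3,4) ij] using ij d by (auto intro!: sum.cong)
  qed (use c in auto)
  finally show ?thesis
    unfolding transvection_def using G(1) by simp
qed

lemma double_sum_unit:
  fixes c :: "'a::comm_ring_1"
  assumes "p < N" "q < N"
  shows "(\<Sum>k = 0..<N. \<Sum>l = 0..<N. x k * (c * (unit_fun p k * unit_fun q l)) * y l) = c * (x p * y q)"
proof -
  have inner: "(\<Sum>l = 0..<N. x k * (c * (unit_fun p k * unit_fun q l)) * y l) = (if k = p then c * (x p * y q) else 0)" for k
  proof -
    have "(\<Sum>l = 0..<N. x k * (c * (unit_fun p k * unit_fun q l)) * y l) =
        (\<Sum>l = 0..<N. if l = q then x k * (c * unit_fun p k) * y q else 0)"
      by (rule sum.cong) auto
    then show ?thesis using assms by simp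
  qed
  show ?thesis unfolding inner using assms by simp
qed

lemma Sp_conj_long:
  fixes g :: "'a::comm_ring_1 mat"
  assumes "g \<in> Sp n" "a < 2 * n"
  shows "g * long_transvection n c (unit_fun a) * inv\<^bsub>GL (2 * n)\<^esub> g = long_transvection n c (\<lambda>i. g $$ (i, a))"
proof -
  have "(\<Sum>k = 0..<2 * n. \<Sum>l = 0..<2 * n. g $$ (i, k) * (c * (unit_fun a k * unit_fun a l)) * g $$ (j, l)) =
      c * (g $$ (i, a) * g $$ (j, a))" for i j
    using assms(2) by (rule double_sum_unit[OF _ assms(2)])
  then show ?thesis
    unfolding long_transvection_def Sp_conj_transvection[OF assms(1)] by simp
qed

lemma Sp_conj_short:
  fixes g :: "'a::comm_ring_1 mat"
  assumes "g \<in> Sp n" "a < 2 * n" "b < 2 * n"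
  shows "g * short_transvection n c (unit_fun a) (unit_fun b) * inv\<^bsub>GL (2 * n)\<^esub> g =
    short_transvection n c (\<lambda>i. g $$ (i, a)) (\<lambda>i. g $$ (i, b))"
proof -
  show ?thesis
    unfolding short_transvection_def Sp_conj_transvection[OF assms(1)] distrib_left distrib_right sum.distrib
      double_sum_unit[OF assms(2,3)] double_sum_unit[OF assms(3,2)] ..
qed

lemma Sp_omega_columns:
  fixes g :: "'a::comm_ring_1 mat"
  assumes g: "g \<in> Sp n" and ab: "a < 2 * n" "b < 2 * n"
  shows "omega n (\<lambda>i. g $$ (i, a)) (\<lambda>i. g $$ (i, b)) = chi n $$ (a, b)"
proof -
  have "g \<in> carrier_mat (2 * n) (2 * n)" "transpose_mat g * chi n * g = chi n"
    using g unfolding Sp_def by blast+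
  then show ?thesis
    using congruence_index[OF _ chi_carrier ab, of g] unfolding omega_def by simp
qed

context ideal_set
begin

text \<open>\<open>conj_gen_conj\<close> with \<open>Q = Sp n\<close> leaves the conjugates of
  generators. These are transvections along columns of \<open>g\<close>, and the columns are
  orthogonal whenever the corresponding unit vectors are.\<close>

theorem ESp_rel_stably_normal:
  assumes "g \<in> Sp n" "x \<in> ESp_rel n I"
  shows "1\<^sub>m 2 \<bottom> (g * x * inv\<^bsub>GL (2 * n)\<^esub> g) \<in> ESp_rel (Suc n) I"
proof -
  let ?N = "2 * n"
  have h: "group_hom (GL ?N) (GL (2 * Suc n)) (\<lambda>A. 1\<^sub>m 2 \<bottom> A :: 'a mat)"
    using GL_mat_sum_hom[of ?N 2 0] by simp
  have "1\<^sub>m 2 \<bottom> (g \<otimes>\<^bsub>GL ?N\<^esub> A \<otimes>\<^bsub>GL ?N\<^esub> inv\<^bsub>GL ?N\<^esub> g) \<in> ESp_rel (Suc n) I"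
    if g: "g \<in> Sp n" and A: "A \<in> symp_set n I" for g A
    using A ideal_set_axioms
  proof (cases rule: symp_set_cases)
    case (long i a)
    then show ?thesis using g by (simp add: Sp_conj_long stable_long_ESp_rel)
  next
    case (short i k a)
    then have "omega n (\<lambda>j. g $$ (j, i)) (\<lambda>j. g $$ (j, k)) = 0"
      using g by (auto simp: Sp_omega_columns chi_index sigma_eq)
    then show ?thesis using short g by (simp add: Sp_conj_short stable_short_ESp_rel)
  qed
  from group_hom.conj_gen_conj[OF h ESp_Sp Sp_subgroup symp_set_GL ESp_rel_subgroup this assms(1)]
  show ?thesis using assms(2) by (simp add: ESp_rel_conj_gen)
qed

end

section \<open>The elementary symplectic Witt group\<close>

lemma Alt_carrier: "A \<in> Alt n I \<Longrightarrow> A \<in> carrier_mat (2 * n) (2 * n)"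
  by (auto simp: Alt_def)

lemma Alt_dim:
  assumes "A \<in> Alt n I"
  shows "dim_row A = 2 * n" "dim_col A = 2 * n"
  using carrier_matD[OF Alt_carrier[OF assms]] by simp_all

lemma alternating_mat_sum:
  fixes A B :: "'a::comm_ring_1 mat"
  assumes A: "A \<in> carrier_mat m m" "alternating A" and B: "B \<in> carrier_mat n n" "alternating B"
  shows "alternating (A \<bottom> B)"
proof -
  have t: "transpose_mat A = - A" "transpose_mat B = - B" using A B by (auto simp: alternating_def)
  have "- A \<bottom> - B = - (A \<bottom> B)"
    by (rule eq_matI) (auto simp: mat_sum_index)
  then show ?thesis
    using A B unfolding alternating_def by (auto simp: mat_sum_index t)
qed

section \<open>Sign twists and permutations of blocks\<close>

lemma twist_monomial: "monomial n (\<lambda>i. i) (\<lambda>i. (- 1) ^ i)"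
  by unfold_locales (auto simp: bij_betw_def power_add[symmetric])

text \<open>\<open>inv A\<close> is congruent to \<open>- chi n\<close> and so in general not in
  \<open>Alt\<close>. Conjugation by the diagonal matrix of alternating signs negates the entries at
  \<open>(i, j)\<close> with \<open>i + j\<close> odd, and all nonzero entries of \<open>chi\<close>
  are of this kind.\<close>

definition twist :: "nat \<Rightarrow> 'a::comm_ring_1 mat \<Rightarrow> 'a mat" where
  "twist n A = monomial_conj (2 * n) (\<lambda>i. i) (\<lambda>i. (- 1) ^ i) (inv\<^bsub>GL (2 * n)\<^esub> A)"

text \<open>Exchanges the roles of \<open>A\<close> and \<open>twist n A\<close>, and so makes a
  right inverse a left inverse.\<close>

lemma twist_twist:
  fixes A :: "'a::comm_ring_1 mat"
  assumes A: "A \<in> carrier (GL (2 * n))"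
  shows "twist n (twist n A) = A"
proof -
  interpret monomial "2 * n" "\<lambda>i. i" "\<lambda>i. (- 1) ^ i :: 'a" by (rule twist_monomial)
  have "inv\<^bsub>GL (2 * n)\<^esub> (twist n A) = monomial_conj (2 * n) (\<lambda>i. i) (\<lambda>i. (- 1) ^ i) A"
    unfolding twist_def
    using group_hom.hom_inv[OF monomial_conj_hom GL_inv[OF A]] group.inv_inv[OF GL_group A] by simp
  moreover have "(- 1) ^ i * (- 1) ^ j * ((- 1) ^ i * (- 1) ^ j * x) = (x :: 'a)" for i j x
  proof -
    have "(- 1) ^ i * (- 1) ^ j * ((- 1) ^ i * (- 1) ^ j * x) = ((- 1) ^ i * (- 1) ^ i) * (((- 1) ^ j * (- 1) ^ j) * x)"
      by (simp only: ac_simps)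
    then show ?thesis by (simp only: sign mult_1_left)
  qed
  ultimately show ?thesis
    unfolding twist_def[of n "twist n A"]
    using GL_dim[OF A] by (intro eq_matI) (simp_all add: monomial_conj_def)
qed

text \<open>Sends a position in \<open>A \<bottom> C \<bottom> B\<close> to the corresponding one in
  \<open>A \<bottom> B \<bottom> C\<close>, for blocks of sizes \<open>a\<close>, \<open>b\<close>,
  \<open>c\<close>; its inverse on these positions is \<open>block_swap a c b\<close>.\<close>

definition block_swap :: "nat \<Rightarrow> nat \<Rightarrow> nat \<Rightarrow> nat \<Rightarrow> nat" where
  "block_swap a b c i = (if i < a then i else if i < a + c then i + b else i - c)"

lemma block_swap_monomial: "monomial (a + b + c) (block_swap a b c) (\<lambda>i. 1)"
proof
  show "bij_betw (block_swap a b c) {0..<a + b + c} {0..<a + b + c}"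
    by (rule bij_betw_byWitness[where f' = "block_swap a c b"]) (auto simp: block_swap_def)
qed simp

lemma block_swap_mat_sum:
  assumes "A \<in> carrier_mat a a" "B \<in> carrier_mat b b" "C \<in> carrier_mat c c"
  shows "monomial_conj (a + b + c) (block_swap a b c) (\<lambda>i. 1) (A \<bottom> B \<bottom> C) = A \<bottom> C \<bottom> B"
proof (rule eq_matI)
  have d: "dim_row A = a" "dim_col A = a" "dim_row B = b" "dim_col B = b" "dim_row C = c" "dim_col C = c"
    using assms by auto
  show "dim_row (monomial_conj (a + b + c) (block_swap a b c) (\<lambda>i. 1) (A \<bottom> B \<bottom> C)) = dim_row (A \<bottom> C \<bottom> B)"
    "dim_col (monomial_conj (a + b + c) (block_swap a b c) (\<lambda>i. 1) (A \<bottom> B \<bottom> C)) = dim_col (A \<bottom> C \<bottom> B)"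
    using d by (simp_all add: monomial_conj_def)
  fix i j assume "i < dim_row (A \<bottom> C \<bottom> B)" "j < dim_col (A \<bottom> C \<bottom> B)"
  then have ij: "i < a + c + b" "j < a + c + b" using d by simp_all
  have s: "block_swap a b c k < a + b + c"
    "k < a \<Longrightarrow> block_swap a b c k = k" "a \<le> k \<Longrightarrow> \<not> block_swap a b c k < a"
    "a \<le> k \<Longrightarrow> k < a + c \<Longrightarrow> \<not> block_swap a b c k < a + b \<and> block_swap a b c k - (a + b) = k - a"
    "a + c \<le> k \<Longrightarrow> block_swap a b c k < a + b \<and> block_swap a b c k - a = k - (a + c)"
    if "k < a + c + b" for k
    using that by (auto simp: block_swap_def)
  consider "i < a" | "a + c \<le> i" | "a \<le> i" "i < a + c" by linarith
  note i_cases = this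
  consider "j < a" | "a + c \<le> j" | "a \<le> j" "j < a + c" by linarith
  then show "monomial_conj (a + b + c) (block_swap a b c) (\<lambda>i. 1) (A \<bottom> B \<bottom> C) $$ (i, j) = (A \<bottom> C \<bottom> B) $$ (i, j)"
    by (cases; cases rule: i_cases)
      (use ij d s[OF ij(1)] s[OF ij(2)] in \<open>simp_all add: monomial_conj_def mat_sum_index\<close>)
qed

lemma upper_block_congruence:
  fixes X :: "'a::comm_ring_1 mat"
  assumes "X \<in> carrier_mat n n" "A \<in> carrier_mat n n" "B \<in> carrier_mat n n" "C \<in> carrier_mat n n" "D \<in> carrier_mat n n"
  shows "transpose_mat (upper_block n X) * four_block_mat A B C D * upper_block n X =
    four_block_mat A (A * X + B) (transpose_mat X * A + C)
      ((transpose_mat X * A + C) * X + (transpose_mat X * B + D))"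
proof -
  have x: "transpose_mat X \<in> carrier_mat n n" using assms by simp
  have "transpose_mat (upper_block n X) = lower_block n (transpose_mat X)"
    unfolding upper_block_def lower_block_def using assms
    by (subst transpose_four_block_mat[of _ n n _ n _ n]) auto
  then have "transpose_mat (upper_block n X) * four_block_mat A B C D =
      four_block_mat A B (transpose_mat X * A + C) (transpose_mat X * B + D)"
    unfolding lower_block_def using assms x
    by (simp, subst mult_four_block_mat[of _ n n _ n _ n _ _ n _ n]) (auto simp del: transpose_carrier_mat)
  then show ?thesis
    unfolding upper_block_def using assms x
    by (simp, subst mult_four_block_mat[of _ n n _ n _ n _ _ n _ n]) (auto simp del: transpose_carrier_mat)
qed

lemma lower_block_congruence:
  fixes X :: "'a::comm_ring_1 mat"
  assumes "X \<in> carrier_mat n n" "A \<in> carrier_mat n n" "B \<in> carrier_mat n n" "C \<in> carrier_mat n n" "D \<in> carrier_mat n n"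
  shows "transpose_mat (lower_block n X) * four_block_mat A B C D * lower_block n X =
    four_block_mat ((A + transpose_mat X * C) + (B + transpose_mat X * D) * X) (B + transpose_mat X * D) (C + D * X) D"
proof -
  have x: "transpose_mat X \<in> carrier_mat n n" using assms by simp
  have "transpose_mat (lower_block n X) = upper_block n (transpose_mat X)"
    unfolding upper_block_def lower_block_def using assms
    by (subst transpose_four_block_mat[of _ n n _ n _ n]) auto
  then have "transpose_mat (lower_block n X) * four_block_mat A B C D =
      four_block_mat (A + transpose_mat X * C) (B + transpose_mat X * D) C D"
    unfolding upper_block_def using assms x
    by (simp, subst mult_four_block_mat[of _ n n _ n _ n _ _ n _ n]) (auto simp del: transpose_carrier_mat)
  then show ?thesis
    unfolding lower_block_def using assms x
    by (simp, subst mult_four_block_mat[of _ n n _ n _ n _ _ n _ n]) (auto simp del: transpose_carrier_mat)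
qed

text \<open>With \<open>b\<close> the inverse, \<open>b^T A b = b^T\<close>: the transpose of
  \<open>b\<close> is congruent to \<open>A\<close> and inherits its alternation.\<close>

lemma alternating_inverse:
  fixes A :: "'a::comm_ring_1 mat"
  assumes A: "A \<in> carrier (GL n)" "alternating A"
  shows "alternating (inv\<^bsub>GL n\<^esub> A)"
proof -
  let ?b = "inv\<^bsub>GL n\<^esub> A"
  have c: "A \<in> carrier_mat n n" "?b \<in> carrier_mat n n" using A(1) GL_inv[OF A(1)] by blast+
  have "transpose_mat ?b * A * ?b = transpose_mat ?b * (A * ?b)"
    using c by (intro square_mult_assoc) auto
  also have "\<dots> = transpose_mat ?b"
    unfolding GL_r_inv[OF A(1)] using c by (intro right_mult_one_mat) auto
  finally have "alternating (transpose_mat ?b)"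
    using alternating_congruence[OF c(2,1) A(2)] by simp
  then have t: "?b = - transpose_mat ?b" "\<And>i. i < n \<Longrightarrow> ?b $$ (i, i) = 0"
    using c by (auto simp: alternating_def)
  then have "transpose_mat ?b = - ?b" by (metis uminus_uminus_mat)
  then show ?thesis using t c unfolding alternating_def by auto
qed

context ideal_set
begin

lemma Alt_chi: "chi n \<in> Alt n I"
  by (simp add: Alt_def chi_GL chi_alternating pfaffian_chi)

lemma Alt_mat_sum:
  assumes "A \<in> Alt m I" "B \<in> Alt n I"
  shows "A \<bottom> B \<in> Alt (m + n) I"
proof -
  have "mat_cong I (A \<bottom> B) (chi (m + n))"
    using assms mat_cong_mat_sum[of A "chi m" B "chi n"] by (simp add: Alt_def chi_add)
  moreover have "A \<bottom> B \<in> carrier (GL (2 * (m + n)))"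
    using assms GL_mat_sum(1)[of A "2 * m" B "2 * n"] by (simp add: Alt_def distrib_left)
  ultimately show ?thesis
    using assms alternating_mat_sum[OF Alt_carrier[OF assms(1)] _ Alt_carrier[OF assms(2)]]
      pfaffian_mat_sum[OF Alt_carrier[OF assms(1)] Alt_carrier[OF assms(2)]]
    by (simp add: Alt_def)
qed

lemma Alt_congruence:
  assumes A: "A \<in> Alt n I" and g: "g \<in> SL_rel (2 * n) I"
  shows "transpose_mat g * A * g \<in> Alt n I"
proof -
  let ?N = "2 * n"
  have G: "g \<in> carrier (GL ?N)" "mat_cong I g (1\<^sub>m ?N)" "det g = 1"
    using g by (auto simp: SL_rel_def GL_rel_iff)
  have a: "A \<in> carrier (GL ?N)" "alternating A" "pfaffian n A = 1" "mat_cong I A (chi n)"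
    using A by (auto simp: Alt_def)
  have c: "g \<in> carrier_mat ?N ?N" "A \<in> carrier_mat ?N ?N" "transpose_mat g \<in> carrier_mat ?N ?N"
    using G a by auto
  have "mat_cong I (transpose_mat g * A * g) (transpose_mat (1\<^sub>m ?N) * chi n * 1\<^sub>m ?N)"
    using c by (intro mat_cong_mult mat_cong_transpose G a) auto
  then have "mat_cong I (transpose_mat g * A * g) (chi n)"
    using left_mult_one_mat[OF chi_carrier, of n] right_mult_one_mat[OF chi_carrier, of n] by simp
  moreover have "transpose_mat g * A * g \<in> carrier (GL ?N)"
    using G(1) a(1) by (intro GL_mult) simp_all
  ultimately show ?thesis
    using alternating_congruence[OF c(1,2) a(2)] pfaffian_congruence[OF c(1,2) a(2)] G a by (simp add: Alt_def)
qed

text \<open>The Witt relation at one fixed size, before any padding and for arbitrary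
  matrices.\<close>

definition elem_cong :: "nat \<Rightarrow> 'a mat \<Rightarrow> 'a mat \<Rightarrow> bool" where
  "elem_cong n A B \<longleftrightarrow> (\<exists>\<epsilon> \<in> E_rel n I. A = transpose_mat \<epsilon> * B * \<epsilon>)"

lemma elem_cong_refl:
  assumes "A \<in> carrier_mat n n"
  shows "elem_cong n A A"
  unfolding elem_cong_def
  using left_mult_one_mat[OF assms] right_mult_one_mat[OF assms] by (intro bexI[of _ "1\<^sub>m n"]) simp_all

lemma elem_cong_sym:
  assumes "elem_cong n A B" "B \<in> carrier_mat n n"
  shows "elem_cong n B A"
proof -
  obtain e where e: "e \<in> E_rel n I" "transpose_mat e * B * e = A" using assms by (auto simp: elem_cong_def)
  then have "transpose_mat (inv\<^bsub>GL n\<^esub> e) * A * inv\<^bsub>GL n\<^esub> e = B"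
    using E_rel_GL assms by (intro congruence_inverse) auto
  then show ?thesis using E_rel_inv[OF e(1)] unfolding elem_cong_def by metis
qed

lemma elem_cong_trans:
  assumes "elem_cong n A B" "elem_cong n B C" "C \<in> carrier_mat n n"
  shows "elem_cong n A C"
proof -
  obtain e f where e: "e \<in> E_rel n I" "A = transpose_mat e * B * e" and f: "f \<in> E_rel n I" "B = transpose_mat f * C * f"
    using assms by (auto simp: elem_cong_def)
  have "A = transpose_mat (f * e) * C * (f * e)"
    unfolding e f congruence_mult[OF E_rel_carrier_mat[OF f(1)] E_rel_carrier_mat[OF e(1)] assms(3)] ..
  then show ?thesis using E_rel_mult[OF f(1) e(1)] unfolding elem_cong_def by blast
qed

lemma elem_cong_mat_sum:
  assumes "elem_cong n A B" "B \<in> carrier_mat n n" "C \<in> carrier_mat k k" "D \<in> carrier_mat l l"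
  shows "elem_cong (k + n + l) (C \<bottom> A \<bottom> D) (C \<bottom> B \<bottom> D)"
proof -
  obtain e where e: "e \<in> E_rel n I" "A = transpose_mat e * B * e" using assms by (auto simp: elem_cong_def)
  have c: "e \<in> carrier_mat n n" "transpose_mat e \<in> carrier_mat n n" using E_rel_carrier_mat[OF e(1)] by auto
  have 1: "(1\<^sub>m k \<bottom> transpose_mat e \<bottom> 1\<^sub>m l) * (C \<bottom> B \<bottom> D) = C \<bottom> (transpose_mat e * B) \<bottom> D"
    using c assms mat_sum_mult[of "1\<^sub>m k \<bottom> transpose_mat e" "k + n" "k + n" "C \<bottom> B" "k + n" "1\<^sub>m l" l l D l]
      mat_sum_mult[of "1\<^sub>m k" k k C k "transpose_mat e" n n B n]
      left_mult_one_mat[OF assms(3)] left_mult_one_mat[OF assms(4)]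
    by (simp del: transpose_carrier_mat)
  have tb: "transpose_mat e * B \<in> carrier_mat n n" using c assms by (intro square_mult_closed)
  have 2: "(C \<bottom> (transpose_mat e * B) \<bottom> D) * (1\<^sub>m k \<bottom> e \<bottom> 1\<^sub>m l) = C \<bottom> (transpose_mat e * B * e) \<bottom> D"
    using c assms tb mat_sum_mult[of "C \<bottom> (transpose_mat e * B)" "k + n" "k + n" "1\<^sub>m k \<bottom> e" "k + n" D l l "1\<^sub>m l" l]
      mat_sum_mult[of C k k "1\<^sub>m k" k "transpose_mat e * B" n n e n]
      right_mult_one_mat[OF assms(3)] right_mult_one_mat[OF assms(4)]
    by (simp del: transpose_carrier_mat assoc_mult_mat)
  have "C \<bottom> A \<bottom> D = transpose_mat (1\<^sub>m k \<bottom> e \<bottom> 1\<^sub>m l) * (C \<bottom> B \<bottom> D) * (1\<^sub>m k \<bottom> e \<bottom> 1\<^sub>m l)"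
    unfolding e transpose_mat_sum transpose_one 1 2 ..
  then show ?thesis using E_rel_mat_sum[OF e(1), of k l] unfolding elem_cong_def by blast
qed

lemma elem_cong_sum_right:
  assumes "elem_cong n A B" "B \<in> carrier_mat n n" "D \<in> carrier_mat l l"
  shows "elem_cong (n + l) (A \<bottom> D) (B \<bottom> D)"
  using elem_cong_mat_sum[OF assms(1,2) _ assms(3), of "1\<^sub>m 0" 0] by simp

lemma elem_cong_sum_left:
  assumes "elem_cong n A B" "B \<in> carrier_mat n n" "C \<in> carrier_mat k k"
  shows "elem_cong (k + n) (C \<bottom> A) (C \<bottom> B)"
  using elem_cong_mat_sum[OF assms, of "1\<^sub>m 0" 0] by simp

text \<open>Both forms undergo the same monomial change of basis, so only the conjugated
  \<open>\<epsilon>\<close> has to be elementary. This is how blocks are permuted inside a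
  congruence.\<close>

lemma elem_cong_monomial:
  assumes "elem_cong n A B" "B \<in> carrier_mat n n" "monomial n p d"
  shows "elem_cong n (monomial_conj n p d A) (monomial_conj n p d B)"
proof -
  interpret monomial n p d by fact
  obtain e where e: "e \<in> E_rel n I" "A = transpose_mat e * B * e" using assms by (auto simp: elem_cong_def)
  have c: "e \<in> carrier_mat n n" "transpose_mat e \<in> carrier_mat n n" using E_rel_carrier_mat[OF e(1)] by auto
  have "monomial_conj n p d A =
      transpose_mat (monomial_conj n p d e) * monomial_conj n p d B * monomial_conj n p d e"
    unfolding e(2) monomial_conj_mult[OF square_mult_closed[OF c(2) assms(2)] c(1)]
      monomial_conj_mult[OF c(2) assms(2)] monomial_conj_transpose[OF c(1)] ..
  then show ?thesis
    using monomial_conj_E_rel[OF ideal_set_axioms e(1)] unfolding elem_cong_def by blast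
qed

text \<open>Both \<open>A \<bottom> b\<close> and \<open>X \<bottom> c\<close> are brought to the block matrix with rows \<open>(0, 1)\<close> and \<open>(-1, 0)\<close>
  by block unipotents; only \<open>D\<close> and \<open>c - b\<close> survive in the composition, up to conjugation.\<close>

lemma elem_cong_block_inverse:
  assumes carr: "A \<in> carrier_mat n n" "b \<in> carrier_mat n n" "X \<in> carrier_mat n n" "c \<in> carrier_mat n n" "D \<in> carrier_mat n n"
    and Ab: "A * b = 1\<^sub>m n" "b * A = 1\<^sub>m n" and Xc: "X * c = 1\<^sub>m n" "c * X = 1\<^sub>m n"
    and skew: "transpose_mat b = - b" "transpose_mat c = - c"
    and D: "X + - transpose_mat D + D = A" "\<And>i j. i < n \<Longrightarrow> j < n \<Longrightarrow> D $$ (i, j) \<in> I"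
    and bc: "\<And>i j. i < n \<Longrightarrow> j < n \<Longrightarrow> (c - b) $$ (i, j) \<in> I"
  shows "elem_cong (n + n) (A \<bottom> b) (X \<bottom> c)"
proof -
  let ?\<epsilon> = "upper_block n c * lower_block n D * upper_block n (- b)"
  have carr': "- b \<in> carrier_mat n n" "- c \<in> carrier_mat n n" "c - b \<in> carrier_mat n n" "transpose_mat D \<in> carrier_mat n n"
    using carr by (auto simp: minus_carrier_mat)
  note bl = block_carrier(1)[OF carr(4)] block_carrier(2)[OF carr(5)] block_carrier(1)[OF carr'(1)]
    block_carrier(1)[OF carr'(2)] block_carrier(1)[OF carr'(3)]
  have z: "0\<^sub>m n n \<in> (carrier_mat n n :: 'a mat set)" "1\<^sub>m n \<in> (carrier_mat n n :: 'a mat set)"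
    "- 1\<^sub>m n \<in> (carrier_mat n n :: 'a mat set)" by simp_all
  have "upper_block n c * upper_block n (- c) = 1\<^sub>m (n + n)" "upper_block n (- c) * upper_block n c = 1\<^sub>m (n + n)"
    using carr carr' by (simp_all add: upper_block_mult block_zero)
  then have "upper_block n c * lower_block n D * upper_block n (- c) \<in> E_rel (n + n) I"
    using block_E(1)[OF carr(4)] bl(4) block_E_rel(2)[OF carr(5) D(2)] by (intro conj_E_rel)
  then have "upper_block n c * lower_block n D * upper_block n (- c) * upper_block n (c - b) \<in> E_rel (n + n) I"
    using block_E_rel(1)[OF carr'(3) bc] by (rule E_rel_mult)
  moreover have "- c + (c - b) = - b" using carr by (intro eq_matI) auto
  then have "upper_block n (- c) * upper_block n (c - b) = upper_block n (- b)"
    using upper_block_mult[OF carr'(2,3)] by simp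
  then have "upper_block n c * lower_block n D * upper_block n (- c) * upper_block n (c - b) = ?\<epsilon>"
    using square_mult_assoc[OF square_mult_closed[OF bl(1,2)] bl(4,5)] by (simp only:)
  ultimately have E: "?\<epsilon> \<in> E_rel (n + n) I" by (simp only:)
  let ?F = "\<lambda>B. four_block_mat B (1\<^sub>m n) (- 1\<^sub>m n) (0\<^sub>m n n) :: 'a mat"
  have F1: "transpose_mat (upper_block n c) * (X \<bottom> c) * upper_block n c = ?F X"
  proof -
    have "X \<bottom> c = four_block_mat X (0\<^sub>m n n) (0\<^sub>m n n) c" unfolding mat_sum_def using carr by simp
    moreover have "X * c + 0\<^sub>m n n = 1\<^sub>m n" "transpose_mat c * X + 0\<^sub>m n n = - 1\<^sub>m n"
      using right_add_zero_mat[OF z(2)] right_add_zero_mat[OF z(3)] carr by (simp_all add: skew Xc)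
    moreover have "- 1\<^sub>m n * c + (transpose_mat c * 0\<^sub>m n n + c) = 0\<^sub>m n n"
      using carr left_mult_one_mat[OF carr(4)] left_add_zero_mat[OF carr(4)] right_mult_zero_mat[OF carr(4)]
      by (simp add: skew)
    ultimately show ?thesis using upper_block_congruence[OF carr(4,3) z(1) z(1) carr(4)] by (simp only:)
  qed
  have F2: "transpose_mat (lower_block n D) * ?F X * lower_block n D = ?F A"
  proof -
    have "(X + transpose_mat D * - 1\<^sub>m n) + (1\<^sub>m n + transpose_mat D * 0\<^sub>m n n) * D = A"
      using right_mult_one_mat[OF carr'(4)] left_mult_one_mat[OF carr(5)] right_mult_zero_mat[OF carr'(4)] D(1) carr
      by simp
    moreover have "1\<^sub>m n + transpose_mat D * 0\<^sub>m n n = 1\<^sub>m n" "- 1\<^sub>m n + 0\<^sub>m n n * D = - 1\<^sub>m n"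
      using right_mult_zero_mat[OF carr'(4)] left_mult_zero_mat[OF carr(5)] right_add_zero_mat[OF z(2)] right_add_zero_mat[OF z(3)]
      by simp_all
    ultimately show ?thesis
      using lower_block_congruence[OF carr(5,3) z(2,3,1)] by (simp only:)
  qed
  have F3: "transpose_mat (upper_block n (- b)) * ?F A * upper_block n (- b) = A \<bottom> b"
  proof -
    have "- 0\<^sub>m n n = (0\<^sub>m n n :: 'a mat)" by (intro eq_matI) simp_all
    moreover have "A * - b + 1\<^sub>m n = 0\<^sub>m n n" "transpose_mat (- b) * A + - 1\<^sub>m n = 0\<^sub>m n n"
      using carr by (simp_all add: Ab transpose_uminus skew)
    moreover from calculation(1) have "0\<^sub>m n n * - b + (transpose_mat (- b) * 1\<^sub>m n + 0\<^sub>m n n) = b"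
      using carr right_mult_one_mat[OF carr(2)] left_mult_zero_mat[OF carr(2)] left_add_zero_mat[OF carr(2)]
      by (simp add: transpose_uminus skew)
    moreover have "A \<bottom> b = four_block_mat A (0\<^sub>m n n) (0\<^sub>m n n) b" unfolding mat_sum_def using carr by simp
    ultimately show ?thesis
      using upper_block_congruence[OF carr'(1) carr(1) z(2,3,1)] by (simp only:)
  qed
  have M: "X \<bottom> c \<in> carrier_mat (n + n) (n + n)" using carr by (intro mat_sum_carrier)
  have "transpose_mat ?\<epsilon> * (X \<bottom> c) * ?\<epsilon> = A \<bottom> b"
    unfolding congruence_mult[OF square_mult_closed[OF bl(1,2)] bl(3) M] congruence_mult[OF bl(1,2) M] F1 F2 F3 ..
  then show ?thesis using E unfolding elem_cong_def by metis
qed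

lemma inverse_cong_chi:
  assumes A: "A \<in> Alt n I"
  shows "mat_cong I (inv\<^bsub>GL (2 * n)\<^esub> A) (- chi n)"
proof -
  let ?N = "2 * n" and ?c = "- chi n :: 'a mat" and ?b = "inv\<^bsub>GL (2 * n)\<^esub> A"
  have a: "A \<in> carrier (GL ?N)" "mat_cong I A (chi n)" using A by (auto simp: Alt_def)
  have c: "?b \<in> carrier_mat ?N ?N" "?c \<in> carrier_mat ?N ?N" "A \<in> carrier_mat ?N ?N"
    using a(1) GL_inv[OF a(1)] by auto
  \<comment> \<open>The factor \<open>A\<close> of \<open>inv A * A * - chi\<close> is replaced by
    the congruent \<open>chi\<close>.\<close>
  have "mat_cong I (?b * chi n * ?c) (?b * A * ?c)"
    using carrier_matD[OF c(1)] carrier_matD[OF c(2)] carrier_matD[OF c(3)]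
    by (intro mat_cong_mult mat_cong_refl mat_cong_sym[OF a(2)]) simp_all
  moreover have "?b * chi n * ?c = ?b"
    unfolding square_mult_assoc[OF c(1) chi_carrier c(2)] chi_inverse right_mult_one_mat[OF c(1)] ..
  moreover have "?b * A * ?c = ?c"
    unfolding GL_l_inv[OF a(1)] left_mult_one_mat[OF c(2)] ..
  ultimately show ?thesis by (simp only:)
qed

lemma elem_cong_inverse:
  assumes A: "A \<in> Alt n I"
  shows "elem_cong (2 * n + 2 * n) (A \<bottom> inv\<^bsub>GL (2 * n)\<^esub> A) (chi n \<bottom> - chi n)"
proof -
  let ?N = "2 * n"
  \<comment> \<open>\<open>A - chi n\<close> is alternating with entries in \<open>I\<close>, so it
    equals \<open>D - D^T\<close> for its strictly upper triangular part \<open>D\<close>.\<close>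
  let ?D = "mat ?N ?N (\<lambda>(i, j). if i < j then A $$ (i, j) - chi n $$ (i, j) else 0)"
  have a: "A \<in> carrier (GL ?N)" "alternating A" "mat_cong I A (chi n)" using A by (auto simp: Alt_def)
  have c: "A \<in> carrier_mat ?N ?N" "inv\<^bsub>GL ?N\<^esub> A \<in> carrier_mat ?N ?N" using a(1) GL_inv[OF a(1)] by auto
  show ?thesis
  proof (rule elem_cong_block_inverse[OF c chi_carrier _ _ GL_r_inv[OF a(1)] GL_l_inv[OF a(1)] chi_inverse])
    show "transpose_mat (inv\<^bsub>GL ?N\<^esub> A) = - (inv\<^bsub>GL ?N\<^esub> A)"
      using alternating_inverse[OF a(1,2)] by (simp add: alternating_def)
    show "transpose_mat (- chi n) = - (- chi n)" by (simp add: transpose_uminus chi_transpose)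
    show "chi n + - transpose_mat ?D + ?D = A"
    proof (rule eq_matI)
      fix i j assume "i < dim_row A" "j < dim_col A"
      then have ij: "i < ?N" "j < ?N" using c(1) by auto
      have "chi n $$ (j, i) = - (chi n $$ (i, j) :: 'a)" "chi n $$ (i, i) = (0 :: 'a)"
        by (rule alternating_skew[OF chi_carrier chi_alternating ij] alternating_diag[OF chi_carrier chi_alternating ij(1)])+
      then show "(chi n + - transpose_mat ?D + ?D) $$ (i, j) = A $$ (i, j)"
        using ij alternating_skew[OF c(1) a(2) ij] alternating_diag[OF c(1) a(2) ij(1)]
        by (cases i j rule: linorder_cases) simp_all
    qed (use c in auto)
    show "?D $$ (i, j) \<in> I" if "i < ?N" "j < ?N" for i j
      using a(3) that c(1) by (auto simp: mat_cong_def)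
    show "(- chi n - inv\<^bsub>GL ?N\<^esub> A) $$ (i, j) \<in> I" if "i < ?N" "j < ?N" for i j
      using mat_cong_sym[OF inverse_cong_chi[OF A]] that carrier_matD[OF c(2)] by (simp add: mat_cong_def)
  qed simp_all
qed

end

text \<open>The first block has even size, so the alternating signs on the second block start again
  with 1.\<close>

lemma monomial_conj_sum:
  fixes A B :: "'a::comm_ring_1 mat"
  assumes A: "A \<in> carrier_mat (2 * m) (2 * m)" and B: "B \<in> carrier_mat n n"
  shows "monomial_conj (2 * m + n) (\<lambda>i. i) (\<lambda>i. if i < 2 * m then 1 else (- 1) ^ i) (A \<bottom> B) =
    A \<bottom> monomial_conj n (\<lambda>i. i) (\<lambda>i. (- 1) ^ i) B"
proof (rule eq_matI)
  let ?d = "\<lambda>i. if i < 2 * m then 1 else (- 1 :: 'a) ^ i"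
  have d: "dim_row A = 2 * m" "dim_col A = 2 * m" "dim_row B = n" "dim_col B = n" using A B by auto
  fix i j assume "i < dim_row (A \<bottom> monomial_conj n (\<lambda>i. i) (\<lambda>i. (- 1) ^ i) B)"
    "j < dim_col (A \<bottom> monomial_conj n (\<lambda>i. i) (\<lambda>i. (- 1) ^ i) B)"
  then have ij: "i < 2 * m + n" "j < 2 * m + n" using d by (simp_all add: monomial_conj_def)
  have s: "?d k = (- 1) ^ (k - 2 * m)" if k: "2 * m \<le> k" for k
  proof -
    obtain l where "k = 2 * m + l" using le_Suc_ex[OF k] by blast
    then show ?thesis by (simp add: power_add power_mult)
  qed
  show "monomial_conj (2 * m + n) (\<lambda>i. i) ?d (A \<bottom> B) $$ (i, j) =
      (A \<bottom> monomial_conj n (\<lambda>i. i) (\<lambda>i. (- 1) ^ i) B) $$ (i, j)"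
    using ij d s[of i] s[of j]
    by (cases "i < 2 * m"; cases "j < 2 * m") (simp_all add: monomial_conj_def mat_sum_index)
qed (use A B in \<open>auto simp: monomial_conj_def\<close>)

context ideal_set
begin

lemma elem_cong_pfaffian:
  assumes "elem_cong (2 * n) A B" "B \<in> carrier_mat (2 * n) (2 * n)" "alternating B"
  shows "pfaffian n A = pfaffian n B"
proof -
  obtain e where e: "e \<in> E_rel (2 * n) I" "A = transpose_mat e * B * e" using assms by (auto simp: elem_cong_def)
  show ?thesis
    unfolding e(2) pfaffian_congruence[OF E_rel_carrier_mat[OF e(1)] assms(2,3)] det_E_rel[OF e(1)] by simp
qed

lemma chi_twist: "monomial_conj (2 * n) (\<lambda>i. i) (\<lambda>i. (- 1) ^ i) (- chi n) = chi n"
  by (rule eq_matI) (auto simp: monomial_conj_def chi_index sigma_def elim: oddE)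

lemma twist_elem_cong:
  assumes A: "A \<in> Alt n I"
  shows "elem_cong (2 * (n + n)) (A \<bottom> twist n A) (chi (n + n))"
proof -
  \<comment> \<open>Signs on the second block only: they turn \<open>inv A\<close> into
    \<open>twist n A\<close> and \<open>- chi n\<close> into \<open>chi n\<close>.\<close>
  let ?d = "\<lambda>i. if i < 2 * n then 1 else (- 1 :: 'a) ^ i"
  have mono: "monomial (2 * n + 2 * n) (\<lambda>i. i) ?d"
    by unfold_locales (auto simp: bij_betw_def power_add[symmetric])
  have c: "A \<in> carrier_mat (2 * n) (2 * n)" "inv\<^bsub>GL (2 * n)\<^esub> A \<in> carrier_mat (2 * n) (2 * n)"
    using A GL_inv[of A "2 * n"] by (auto simp: Alt_def)
  have "elem_cong (2 * n + 2 * n)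
      (monomial_conj (2 * n + 2 * n) (\<lambda>i. i) ?d (A \<bottom> inv\<^bsub>GL (2 * n)\<^esub> A))
      (monomial_conj (2 * n + 2 * n) (\<lambda>i. i) ?d (chi n \<bottom> - chi n))"
    by (rule elem_cong_monomial[OF elem_cong_inverse[OF A] _ mono]) (intro mat_sum_carrier; simp)
  then show ?thesis
    unfolding monomial_conj_sum[OF c] monomial_conj_sum[OF chi_carrier uminus_carrier_mat[OF chi_carrier]]
      chi_twist chi_add twist_def[symmetric] distrib_left .
qed

lemma twist_Alt:
  assumes A: "A \<in> Alt n I"
  shows "twist n A \<in> Alt n I"
proof -
  let ?s = "\<lambda>i. (- 1 :: 'a) ^ i" and ?b = "inv\<^bsub>GL (2 * n)\<^esub> A"
  interpret monomial "2 * n" "\<lambda>i. i" ?s by (rule twist_monomial)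
  have a: "A \<in> carrier (GL (2 * n))" "alternating A" "pfaffian n A = 1" using A by (auto simp: Alt_def)
  have c: "?b \<in> carrier_mat (2 * n) (2 * n)" using GL_inv[OF a(1)] by blast
  have tc: "twist n A \<in> carrier_mat (2 * n) (2 * n)" by (simp add: twist_def)
  have alt: "alternating ?b" by (rule alternating_inverse[OF a(1,2)])
  have 1: "twist n A \<in> carrier (GL (2 * n))"
    unfolding twist_def using group_hom.hom_closed[OF monomial_conj_hom GL_inv[OF a(1)]] .
  have 2: "alternating (twist n A)"
    unfolding alternating_iff[OF tc]
  proof (intro conjI allI impI)
    fix i j assume "i < 2 * n" "j < 2 * n"
    then show "twist n A $$ (j, i) = - twist n A $$ (i, j)"
      using alternating_skew[OF c alt, of i j] by (simp add: twist_def monomial_conj_def mult.commute)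
  next
    fix i assume "i < 2 * n"
    then show "twist n A $$ (i, i) = 0"
      using alternating_diag[OF c alt, of i] by (simp add: twist_def monomial_conj_def)
  qed
  have "mat_cong I (twist n A) (monomial_conj (2 * n) (\<lambda>i. i) ?s (- chi n))"
    unfolding mat_cong_def
  proof (intro conjI allI impI)
    fix i j assume "i < dim_row (twist n A)" "j < dim_col (twist n A)"
    then have ij: "i < 2 * n" "j < 2 * n" using tc by auto
    then have "?b $$ (i, j) - (- chi n) $$ (i, j) \<in> I"
      using inverse_cong_chi[OF A] c by (auto simp: mat_cong_def)
    then have "?s i * ?s j * (?b $$ (i, j) - (- chi n) $$ (i, j)) \<in> I" by (rule mult_left)
    then show "twist n A $$ (i, j) - monomial_conj (2 * n) (\<lambda>i. i) ?s (- chi n) $$ (i, j) \<in> I"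
      using ij by (simp add: twist_def monomial_conj_def algebra_simps)
  qed (use tc in \<open>auto simp: monomial_conj_def\<close>)
  then have 3: "mat_cong I (twist n A) (chi n)" by (simp only: chi_twist)
  \<comment> \<open>The Pfaffian of the twist is read off from its sum with \<open>A\<close>:
    elementary congruence preserves Pfaffians, and \<open>A\<close> contributes the factor
    1.\<close>
  have "pfaffian (n + n) (A \<bottom> twist n A) = pfaffian (n + n) (chi (n + n))"
    by (rule elem_cong_pfaffian[OF twist_elem_cong[OF A] chi_carrier chi_alternating])
  then have "pfaffian n (twist n A) = 1"
    using pfaffian_mat_sum[OF Alt_carrier[OF A] tc] a(3) by (simp add: pfaffian_chi)
  then show ?thesis using 1 2 3 by (simp add: Alt_def)
qed

lemma twist_elem_cong':
  assumes A: "A \<in> Alt n I"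
  shows "elem_cong (2 * (n + n)) (twist n A \<bottom> A) (chi (n + n))"
  using twist_elem_cong[OF twist_Alt[OF A]] twist_twist[of A n] A by (simp add: Alt_def)

text \<open>The last two blocks of \<open>A \<bottom> twist n A \<bottom> chi 1\<close> are swapped
  on both sides of the congruence; on the standard side all blocks are \<open>chi\<close>, so the
  swap changes nothing there.\<close>

lemma twist_elem_cong_middle:
  assumes A: "A \<in> Alt n I"
  shows "elem_cong (2 * (n + n + 1)) (A \<bottom> chi 1 \<bottom> twist n A) (chi (n + n + 1))"
proof -
  have c: "A \<in> carrier_mat (2 * n) (2 * n)" "twist n A \<in> carrier_mat (2 * n) (2 * n)" "chi 1 \<in> carrier_mat 2 2"
    using Alt_carrier[OF A] Alt_carrier[OF twist_Alt[OF A]] chi_carrier[of 1] by simp_all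
  have "elem_cong (2 * (n + n) + 2) (A \<bottom> twist n A \<bottom> chi 1) (chi (n + n) \<bottom> chi 1)"
    by (rule elem_cong_sum_right[OF twist_elem_cong[OF A] chi_carrier c(3)])
  then have "elem_cong (2 * n + 2 * n + 2) (A \<bottom> twist n A \<bottom> chi 1) (chi n \<bottom> chi n \<bottom> chi 1)"
    by (simp only: chi_add distrib_left)
  then have "elem_cong (2 * n + 2 * n + 2)
      (monomial_conj (2 * n + 2 * n + 2) (block_swap (2 * n) (2 * n) 2) (\<lambda>i. 1) (A \<bottom> twist n A \<bottom> chi 1))
      (monomial_conj (2 * n + 2 * n + 2) (block_swap (2 * n) (2 * n) 2) (\<lambda>i. 1) (chi n \<bottom> chi n \<bottom> chi 1))"
    by (rule elem_cong_monomial[OF _ _ block_swap_monomial])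
      (intro mat_sum_carrier chi_carrier c(3))
  then have "elem_cong (2 * n + 2 * n + 2) (A \<bottom> chi 1 \<bottom> twist n A) (chi n \<bottom> chi 1 \<bottom> chi n)"
    unfolding block_swap_mat_sum[OF c] block_swap_mat_sum[OF chi_carrier chi_carrier c(3)] .
  moreover have "chi n \<bottom> chi 1 \<bottom> chi n = (chi (n + n + 1) :: 'a mat)"
    unfolding chi_add by (rule arg_cong[where f = chi]) simp
  moreover have "2 * n + 2 * n + 2 = 2 * (n + n + 1)" by simp
  ultimately show ?thesis by (simp only:)
qed

section \<open>The Witt relation and its compatibility with block sums\<close>

lemma W_rel_Alt:
  assumes "(A, B) \<in> W_rel I"
  obtains m n where "A \<in> Alt m I" "B \<in> Alt n I"
  using assms by (auto simp: W_rel_def)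

text \<open>Frees the relation from its prescribed paddings: any \<open>p\<close>, \<open>q\<close>
  that equalise the sizes suffice, because more copies of \<open>chi\<close> may be added on the
  right.\<close>

lemma W_rel_elem_cong:
  assumes A: "A \<in> Alt m I" and B: "B \<in> Alt n I" and mn: "m + p = n + q"
    and "elem_cong (2 * (m + p)) (A \<bottom> chi p) (B \<bottom> chi q)"
  shows "(A, B) \<in> W_rel I"
proof -
  have "B \<bottom> chi q \<in> carrier_mat (2 * (m + p)) (2 * (m + p))"
    unfolding mn distrib_left by (intro mat_sum_carrier Alt_carrier[OF B] chi_carrier)
  \<comment> \<open>\<open>m + n\<close> further planes produce the paddings \<open>n + t\<close>
    and \<open>m + t\<close> with \<open>t = m + p = n + q\<close>.\<close>
  from elem_cong_sum_right[OF assms(4) this chi_carrier, of "m + n"]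
  have "elem_cong (2 * (m + n + (m + p))) (A \<bottom> chi (n + (m + p))) (B \<bottom> chi (m + (m + p)))"
  proof -
    have "p + (m + n) = n + (m + p)" "q + (m + n) = m + (m + p)"
      "2 * (m + p) + 2 * (m + n) = 2 * (m + n + (m + p))"
      using mn by simp_all
    then show "elem_cong (2 * (m + p) + 2 * (m + n)) (A \<bottom> chi p \<bottom> chi (m + n)) (B \<bottom> chi q \<bottom> chi (m + n)) \<Longrightarrow> ?thesis"
      by (simp only: mat_sum_assoc chi_add)
  qed
  then show ?thesis
    using A B unfolding W_rel_def elem_cong_def by blast
qed

lemma W_rel_elim:
  assumes "(A, B) \<in> W_rel I"
  obtains m n p q where "A \<in> Alt m I" "B \<in> Alt n I" "m + p = n + q"
    "elem_cong (2 * (m + p)) (A \<bottom> chi p) (B \<bottom> chi q)"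
proof -
  from assms obtain m n t where "A \<in> Alt m I" "B \<in> Alt n I"
    "elem_cong (2 * (m + n + t)) (A \<bottom> chi (n + t)) (B \<bottom> chi (m + t))"
    unfolding W_rel_def elem_cong_def by blast
  then show ?thesis using that[of m n "n + t" "m + t"] by (simp add: ac_simps)
qed

lemma Alt_sum_chi_carrier: "A \<in> Alt m I \<Longrightarrow> A \<bottom> chi p \<in> carrier_mat (2 * (m + p)) (2 * (m + p))"
  using Alt_carrier[OF Alt_mat_sum[OF _ Alt_chi]] by blast

lemma Alt_unique: "A \<in> Alt m I \<Longrightarrow> A \<in> Alt n I \<Longrightarrow> m = n"
  using Alt_dim(1)[of A m I] Alt_dim(1)[of A n I] by simp

lemma W_rel_refl: "A \<in> Alt m I \<Longrightarrow> (A, A) \<in> W_rel I"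
  using W_rel_elem_cong[of A m A m 0 0] elem_cong_refl[OF Alt_sum_chi_carrier, of A m 0] by simp

lemma W_rel_sym:
  assumes "(A, B) \<in> W_rel I"
  shows "(B, A) \<in> W_rel I"
proof -
  obtain m n p q where AB: "A \<in> Alt m I" "B \<in> Alt n I" "m + p = n + q"
    "elem_cong (2 * (m + p)) (A \<bottom> chi p) (B \<bottom> chi q)"
    using assms by (rule W_rel_elim)
  have "elem_cong (2 * (n + q)) (B \<bottom> chi q) (A \<bottom> chi p)"
    using elem_cong_sym[OF AB(4)] Alt_sum_chi_carrier[OF AB(2), of q] AB(3) by simp
  then show ?thesis by (rule W_rel_elem_cong[OF AB(2,1) AB(3)[symmetric]])
qed

lemma W_rel_trans:
  assumes "(A, B) \<in> W_rel I" "(B, C) \<in> W_rel I"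
  shows "(A, C) \<in> W_rel I"
proof -
  obtain m n p q where AB: "A \<in> Alt m I" "B \<in> Alt n I" "m + p = n + q"
    "elem_cong (2 * (m + p)) (A \<bottom> chi p) (B \<bottom> chi q)"
    using assms(1) by (rule W_rel_elim)
  obtain n' l p' q' where BC: "B \<in> Alt n' I" "C \<in> Alt l I" "n' + p' = l + q'"
    "elem_cong (2 * (n' + p')) (B \<bottom> chi p') (C \<bottom> chi q')"
    using assms(2) by (rule W_rel_elim)
  have n: "n' = n" using Alt_unique[OF BC(1) AB(2)] .
  \<comment> \<open>Each congruence is extended by the padding that \<open>B\<close> has in the
    other, so that \<open>B \<bottom> chi (q + p')\<close> is the common middle term.\<close>
  let ?N = "2 * (m + (p + p'))"
  have N: "2 * (m + p) + 2 * p' = ?N" "2 * (n + p') + 2 * q = ?N" "q' + q + l = m + (p + p')"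
    using AB(3) BC(3) n by simp_all
  have 1: "elem_cong ?N (A \<bottom> chi (p + p')) (B \<bottom> chi (q + p'))"
    using elem_cong_sum_right[OF AB(4) _ chi_carrier[of p']] Alt_sum_chi_carrier[OF AB(2), of q] AB(3)
    unfolding N(1) mat_sum_assoc chi_add by simp
  have 2: "elem_cong ?N (B \<bottom> chi (q + p')) (C \<bottom> chi (q' + q))"
    using elem_cong_sum_right[OF BC(4) _ chi_carrier[of q]] Alt_sum_chi_carrier[OF BC(2), of q'] BC(3)
    unfolding n N(2) mat_sum_assoc chi_add by (simp add: add.commute)
  have N': "m + (p + p') = l + (q' + q)" using N(3) by simp
  have "C \<bottom> chi (q' + q) \<in> carrier_mat ?N ?N"
    unfolding N' by (rule Alt_sum_chi_carrier[OF BC(2)])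
  then have "elem_cong ?N (A \<bottom> chi (p + p')) (C \<bottom> chi (q' + q))"
    by (rule elem_cong_trans[OF 1 2])
  then show ?thesis by (rule W_rel_elem_cong[OF AB(1) BC(2) N'])
qed

lemma W_rel_equiv: "equiv (\<Union>n. Alt n I) (W_rel I)"
proof (rule equivI)
  show "W_rel I \<subseteq> (\<Union>n. Alt n I) \<times> (\<Union>n. Alt n I)" by (auto simp: W_rel_def)
  show "refl_on (\<Union>n. Alt n I) (W_rel I)" by (auto intro: refl_onI W_rel_refl)
  show "sym (W_rel I)" using W_rel_sym by (rule symI)
  show "trans (W_rel I)" using W_rel_trans by (rule transI)
qed

lemma W_rel_cong:
  assumes A: "A \<in> Alt m I" and B: "B \<in> Alt n I" and mn: "m = n" and AB: "elem_cong N A B"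
  shows "(A, B) \<in> W_rel I"
proof (rule W_rel_elem_cong[OF A B, where p = 0 and q = 0])
  obtain e where "e \<in> E_rel N I" "A = transpose_mat e * B * e" using AB by (auto simp: elem_cong_def)
  then have "dim_col A = N" using E_rel_carrier_mat by auto
  then show "elem_cong (2 * (m + 0)) (A \<bottom> chi 0) (B \<bottom> chi 0)" using AB Alt_dim(2)[OF A] by simp
qed (simp add: mn)

lemma W_rel_pad:
  assumes "A \<in> Alt m I"
  shows "(A \<bottom> chi k, A) \<in> W_rel I"
proof (rule W_rel_elem_cong[OF Alt_mat_sum[OF assms Alt_chi] assms, where p = 0 and q = k])
  show "elem_cong (2 * (m + k + 0)) (A \<bottom> chi k \<bottom> chi 0) (A \<bottom> chi k)"
    using elem_cong_refl[OF Alt_sum_chi_carrier[OF assms, of k]] by simp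
qed simp

lemma W_rel_left:
  assumes C: "C \<in> Alt k I" and AB: "(A, B) \<in> W_rel I"
  shows "(C \<bottom> A, C \<bottom> B) \<in> W_rel I"
proof -
  obtain m n p q where *: "A \<in> Alt m I" "B \<in> Alt n I" "m + p = n + q"
    "elem_cong (2 * (m + p)) (A \<bottom> chi p) (B \<bottom> chi q)"
    using AB by (rule W_rel_elim)
  have "elem_cong (2 * k + 2 * (m + p)) (C \<bottom> (A \<bottom> chi p)) (C \<bottom> (B \<bottom> chi q))"
    using elem_cong_sum_left[OF *(4) _ Alt_carrier[OF C]] Alt_sum_chi_carrier[OF *(2), of q] *(3) by simp
  then have "elem_cong (2 * (k + m + p)) (C \<bottom> A \<bottom> chi p) (C \<bottom> B \<bottom> chi q)"
    by (simp add: mat_sum_assoc distrib_left add.assoc)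
  then show ?thesis
    by (rule W_rel_elem_cong[OF Alt_mat_sum[OF C *(1)] Alt_mat_sum[OF C *(2)], rotated]) (use *(3) in simp)
qed

text \<open>Let \<open>A'\<close> be the twist of \<open>A\<close>.  Evaluating \<open>chi 1 \<bottom> A \<bottom> A' \<bottom> A\<close> and \<open>A \<bottom> chi 1 \<bottom> A' \<bottom> A\<close> from the
  left gives the same class, from the right it gives the two sides of the claim.\<close>

lemma W_rel_chi_one_left:
  assumes A: "A \<in> Alt n I"
  shows "(chi 1 \<bottom> A, A) \<in> W_rel I"
proof -
  let ?A' = "twist n A"
  note A' = twist_Alt[OF A] and c = Alt_carrier[OF A]
  have one: "chi 1 \<bottom> (chi (n + n) :: 'a mat) = chi (n + n + 1)"
    unfolding chi_add by (rule arg_cong[where f = chi]) simp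
  have chi1: "chi 1 \<in> Alt 1 I" by (rule Alt_chi)
  have right: "(?A' \<bottom> A, chi (n + n)) \<in> W_rel I"
    by (rule W_rel_cong[OF Alt_mat_sum[OF A' A] Alt_chi refl twist_elem_cong'[OF A]])
  have right': "(C \<bottom> (?A' \<bottom> A), C) \<in> W_rel I" if "C \<in> Alt k I" for C k
    by (rule W_rel_trans[OF W_rel_left[OF that right] W_rel_pad[OF that]])
  have "elem_cong (2 * 1 + 2 * (n + n) + 2 * n) (chi 1 \<bottom> (A \<bottom> ?A') \<bottom> A) (chi 1 \<bottom> chi (n + n) \<bottom> A)"
    by (rule elem_cong_mat_sum[OF twist_elem_cong[OF A] chi_carrier chi_carrier c])
  then have 1: "(chi 1 \<bottom> (A \<bottom> ?A') \<bottom> A, chi (n + n + 1) \<bottom> A) \<in> W_rel I"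
    unfolding one
    by (intro W_rel_cong[OF Alt_mat_sum[OF Alt_mat_sum[OF chi1 Alt_mat_sum[OF A A']] A] Alt_mat_sum[OF Alt_chi A]]) simp_all
  have 2: "(chi 1 \<bottom> (A \<bottom> ?A') \<bottom> A, chi 1 \<bottom> A) \<in> W_rel I"
    using right'[OF Alt_mat_sum[OF chi1 A]] by (simp only: mat_sum_assoc)
  have "elem_cong (2 * (n + n + 1) + 2 * n) (A \<bottom> chi 1 \<bottom> ?A' \<bottom> A) (chi (n + n + 1) \<bottom> A)"
    by (rule elem_cong_sum_right[OF twist_elem_cong_middle[OF A] chi_carrier c])
  then have 3: "(A \<bottom> chi 1 \<bottom> ?A' \<bottom> A, chi (n + n + 1) \<bottom> A) \<in> W_rel I"
    by (intro W_rel_cong[OF Alt_mat_sum[OF Alt_mat_sum[OF Alt_mat_sum[OF A chi1] A'] A] Alt_mat_sum[OF Alt_chi A]]) simp_all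
  have 4: "(A \<bottom> chi 1 \<bottom> ?A' \<bottom> A, A) \<in> W_rel I"
    using W_rel_trans[OF right'[OF Alt_mat_sum[OF A chi1]] W_rel_pad[OF A]] by (simp only: mat_sum_assoc)
  show ?thesis
    using W_rel_trans[OF W_rel_trans[OF W_rel_sym[OF 2] 1] W_rel_trans[OF W_rel_sym[OF 3] 4]] .
qed

lemma W_rel_chi_left:
  assumes A: "A \<in> Alt n I"
  shows "(chi k \<bottom> A, A) \<in> W_rel I"
proof (induction k)
  case 0
  show ?case using W_rel_refl[OF A] by simp
next
  case (Suc k)
  have "chi (Suc k) \<bottom> A = chi 1 \<bottom> (chi k \<bottom> A)"
    unfolding mat_sum_assoc[symmetric] chi_add by simp
  then show ?case
    using W_rel_trans[OF W_rel_chi_one_left[OF Alt_mat_sum[OF Alt_chi A, of k]] Suc] by (simp only:)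
qed

text \<open>Here the padding \<open>chi p\<close> ends up between \<open>A\<close> and
  \<open>C\<close>; \<open>W_rel_chi_left\<close> absorbs it into \<open>C\<close>. On the other
  side, in \<open>W_rel_left\<close>, the padding stays at the outer end.\<close>

lemma W_rel_right:
  assumes C: "C \<in> Alt k I" and AB: "(A, B) \<in> W_rel I"
  shows "(A \<bottom> C, B \<bottom> C) \<in> W_rel I"
proof -
  obtain m n p q where *: "A \<in> Alt m I" "B \<in> Alt n I" "m + p = n + q"
    "elem_cong (2 * (m + p)) (A \<bottom> chi p) (B \<bottom> chi q)"
    using AB by (rule W_rel_elim)
  have "elem_cong (2 * (m + p) + 2 * k) (A \<bottom> chi p \<bottom> C) (B \<bottom> chi q \<bottom> C)"
    using elem_cong_sum_right[OF *(4) _ Alt_carrier[OF C]] Alt_sum_chi_carrier[OF *(2), of q] *(3) by simp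
  then have "(A \<bottom> chi p \<bottom> C, B \<bottom> chi q \<bottom> C) \<in> W_rel I"
    using *(3)
    by (intro W_rel_cong[OF Alt_mat_sum[OF Alt_mat_sum[OF *(1) Alt_chi] C] Alt_mat_sum[OF Alt_mat_sum[OF *(2) Alt_chi] C]]) simp_all
  moreover have "(D \<bottom> chi r \<bottom> C, D \<bottom> C) \<in> W_rel I" if "D \<in> Alt l I" for D l r
    using W_rel_left[OF that W_rel_chi_left[OF C, of r]] by (simp only: mat_sum_assoc)
  ultimately show ?thesis
    using *(1,2) by (meson W_rel_sym W_rel_trans)
qed

lemma W_rel_mat_sum:
  assumes "(A, A') \<in> W_rel I" "(B, B') \<in> W_rel I"
  shows "(A \<bottom> B, A' \<bottom> B') \<in> W_rel I"
proof -
  obtain m where "A' \<in> Alt m I" using assms(1) by (rule W_rel_Alt)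
  moreover obtain n where "B \<in> Alt n I" using assms(2) by (rule W_rel_Alt)
  ultimately show ?thesis using W_rel_trans[OF W_rel_right[OF _ assms(1)] W_rel_left[OF _ assms(2)]] by blast
qed

lemma W_class_eq_iff:
  assumes "A \<in> Alt m I"
  shows "W_class I A = W_class I B \<longleftrightarrow> (A, B) \<in> W_rel I"
proof
  assume "W_class I A = W_class I B"
  then have "(B, A) \<in> W_rel I" using W_rel_refl[OF assms] by auto
  then show "(A, B) \<in> W_rel I" by (rule W_rel_sym)
next
  assume "(A, B) \<in> W_rel I"
  then show "W_class I A = W_class I B" by (rule equiv_class_eq[OF W_rel_equiv])
qed

section \<open>Group structure of W_E\<close>

lemma W_E_mult:
  assumes A: "A \<in> Alt m I" and B: "B \<in> Alt n I"
  shows "W_class I A \<otimes>\<^bsub>W_E I\<^esub> W_class I B = W_class I (A \<bottom> B)"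
proof -
  have "W_class I (A' \<bottom> B') = W_class I (A \<bottom> B)" if "A' \<in> W_class I A" "B' \<in> W_class I B" for A' B'
    using W_rel_mat_sum[of A A' B B'] that W_class_eq_iff[OF Alt_mat_sum[OF A B]] by auto
  moreover have "A \<in> W_class I A" "B \<in> W_class I B" using W_rel_refl A B by auto
  ultimately have "(\<Union>A'\<in>W_class I A. \<Union>B'\<in>W_class I B. W_class I (A' \<bottom> B')) = W_class I (A \<bottom> B)"
    by blast
  then show ?thesis by (simp add: W_E_def)
qed

lemma W_E_carrier: "X \<in> carrier (W_E I) \<longleftrightarrow> (\<exists>A n. A \<in> Alt n I \<and> X = W_class I A)"
  by (auto simp: W_E_def quotient_def)

lemma W_class_chi: "W_class I (chi k) = \<one>\<^bsub>W_E I\<^esub>"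
proof -
  have "(chi k, chi 0) \<in> W_rel I" for k
    using W_rel_pad[OF Alt_chi, of 0 k] by (simp add: chi_add)
  then have "(chi k, chi 1) \<in> W_rel I" using W_rel_trans W_rel_sym by blast
  then show ?thesis using W_class_eq_iff[OF Alt_chi] by (simp add: W_E_def)
qed

theorem W_E_group: "group (W_E I)"
proof (rule groupI)
  fix X Y assume "X \<in> carrier (W_E I)" "Y \<in> carrier (W_E I)"
  then obtain A B m n where "A \<in> Alt m I" "B \<in> Alt n I" "X = W_class I A" "Y = W_class I B"
    by (auto simp: W_E_carrier)
  then have "A \<bottom> B \<in> Alt (m + n) I" "X \<otimes>\<^bsub>W_E I\<^esub> Y = W_class I (A \<bottom> B)"
    using Alt_mat_sum W_E_mult by blast+
  then show "X \<otimes>\<^bsub>W_E I\<^esub> Y \<in> carrier (W_E I)"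
    unfolding W_E_carrier by blast
next
  show "\<one>\<^bsub>W_E I\<^esub> \<in> carrier (W_E I)"
    using W_class_chi[of 1] Alt_chi W_E_carrier by blast
next
  fix X Y Z assume "X \<in> carrier (W_E I)" "Y \<in> carrier (W_E I)" "Z \<in> carrier (W_E I)"
  then obtain A B C l m n where "A \<in> Alt l I" "B \<in> Alt m I" "C \<in> Alt n I"
    "X = W_class I A" "Y = W_class I B" "Z = W_class I C"
    by (auto simp: W_E_carrier)
  then show "X \<otimes>\<^bsub>W_E I\<^esub> Y \<otimes>\<^bsub>W_E I\<^esub> Z = X \<otimes>\<^bsub>W_E I\<^esub> (Y \<otimes>\<^bsub>W_E I\<^esub> Z)"
    by (simp add: W_E_mult[OF Alt_mat_sum] W_E_mult[OF _ Alt_mat_sum] W_E_mult mat_sum_assoc)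
next
  fix X assume "X \<in> carrier (W_E I)"
  then obtain A n where A: "A \<in> Alt n I" "X = W_class I A" by (auto simp: W_E_carrier)
  show "\<one>\<^bsub>W_E I\<^esub> \<otimes>\<^bsub>W_E I\<^esub> X = X"
    unfolding W_class_chi[of 0, symmetric] A(2) W_E_mult[OF Alt_chi A(1)] by simp
  have "(twist n A \<bottom> A, chi (n + n)) \<in> W_rel I"
    by (rule W_rel_cong[OF Alt_mat_sum[OF twist_Alt[OF A(1)] A(1)] Alt_chi refl twist_elem_cong'[OF A(1)]])
  then have "W_class I (twist n A \<bottom> A) = \<one>\<^bsub>W_E I\<^esub>"
    unfolding W_class_chi[of "n + n", symmetric] by (rule equiv_class_eq[OF W_rel_equiv])
  then have "W_class I (twist n A) \<otimes>\<^bsub>W_E I\<^esub> X = \<one>\<^bsub>W_E I\<^esub>"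
    unfolding A(2) W_E_mult[OF twist_Alt[OF A(1)] A(1)] .
  then show "\<exists>Y\<in>carrier (W_E I). Y \<otimes>\<^bsub>W_E I\<^esub> X = \<one>\<^bsub>W_E I\<^esub>"
    using twist_Alt[OF A(1)] W_E_carrier by blast
qed

end

section \<open>Stable groups\<close>

lemma stab_class_self [simp]: "A \<in> stab_class A"
  by (auto simp: stab_class_def)

lemma stab_class_subset:
  assumes "1\<^sub>m k \<bottom> A = 1\<^sub>m l \<bottom> B"
  shows "stab_class A \<subseteq> stab_class B"
proof
  fix C assume "C \<in> stab_class A"
  then obtain a b where C: "1\<^sub>m a \<bottom> A = 1\<^sub>m b \<bottom> C" by (auto simp: stab_class_def)
  have "1\<^sub>m (a + l) \<bottom> B = 1\<^sub>m a \<bottom> (1\<^sub>m k \<bottom> A)" by (simp add: assms)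
  also have "\<dots> = 1\<^sub>m k \<bottom> (1\<^sub>m a \<bottom> A)" by (simp add: add.commute)
  also have "\<dots> = 1\<^sub>m (k + b) \<bottom> C" by (simp add: C)
  finally show "C \<in> stab_class B" unfolding stab_class_def by blast
qed

lemma stab_class_eqI: "1\<^sub>m k \<bottom> A = 1\<^sub>m l \<bottom> B \<Longrightarrow> stab_class A = stab_class B"
  using stab_class_subset[of k A l B] stab_class_subset[of l B k A] by auto

lemma stab_class_one_sum [simp]: "stab_class (1\<^sub>m k \<bottom> A) = stab_class A"
  by (rule stab_class_eqI[of 0 _ k]) simp

lemma stab_class_eqD: "stab_class A = stab_class B \<Longrightarrow> \<exists>k l. 1\<^sub>m k \<bottom> A = 1\<^sub>m l \<bottom> B"
proof -
  assume eq: "stab_class A = stab_class B"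
  have "B \<in> stab_class A" unfolding eq by (rule stab_class_self)
  then show ?thesis unfolding stab_class_def by blast
qed

text \<open>Equal sizes force equal padding, and padding is injective. Equations between classes
  thus become equations between matrices.\<close>

lemma stab_class_inject:
  assumes "A \<in> carrier_mat n n" "B \<in> carrier_mat n n" "stab_class A = stab_class B"
  shows "A = B"
proof -
  obtain k l where kl: "1\<^sub>m k \<bottom> A = 1\<^sub>m l \<bottom> B" using stab_class_eqD[OF assms(3)] by blast
  have "dim_row (1\<^sub>m k \<bottom> A) = k + n" "dim_row (1\<^sub>m l \<bottom> B) = l + n" using assms(1,2) by simp_all
  then have "k = l" using arg_cong[OF kl, of dim_row] by linarith
  then show ?thesis using kl by (simp add: mat_sum_right_inject)
qed

lemma one_sum_mult:
  fixes A B :: "'a::comm_ring_1 mat"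
  assumes "A \<in> carrier_mat n n" "B \<in> carrier_mat n n"
  shows "(1\<^sub>m k \<bottom> A) * (1\<^sub>m k \<bottom> B) = 1\<^sub>m k \<bottom> (A * B)"
  using mat_sum_mult[of "1\<^sub>m k" k k "1\<^sub>m k" k A n n B n] assms by simp

text \<open>Collapses the union in the definition of the product: all pairs of representatives give
  the same class.\<close>

lemma GL_stable_mult:
  fixes A B :: "'a::comm_ring_1 mat"
  assumes A: "A \<in> carrier_mat n n" and B: "B \<in> carrier_mat n n"
  shows "stab_class A \<otimes>\<^bsub>GL_stable\<^esub> stab_class B = stab_class (A * B)"
proof -
  have *: "stab_class (A' * B') = stab_class (A * B)"
    if A': "A' \<in> stab_class A \<inter> carrier_mat m m" and B': "B' \<in> stab_class B \<inter> carrier_mat m m" for A' B' m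
  proof -
    obtain a b where ab: "1\<^sub>m a \<bottom> A = 1\<^sub>m b \<bottom> A'" using A' by (auto simp: stab_class_def)
    obtain c d where cd: "1\<^sub>m c \<bottom> B = 1\<^sub>m d \<bottom> B'" using B' by (auto simp: stab_class_def)
    have c': "A' \<in> carrier_mat m m" "B' \<in> carrier_mat m m" using A' B' by auto
    \<comment> \<open>Both factors must be padded alike: \<open>c + a\<close> identities in front of
      \<open>A\<close> and \<open>B\<close> correspond to \<open>c + b = a + d\<close> in front of
      \<open>A'\<close> and \<open>B'\<close>.\<close>
    have dims: "a + n = b + m" "c + n = d + m"
      using arg_cong[OF ab, of dim_row] arg_cong[OF cd, of dim_row] A B c' by simp_all
    have "1\<^sub>m (c + a) \<bottom> A = 1\<^sub>m (c + b) \<bottom> A'"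
      using arg_cong[OF ab, of "\<lambda>M. 1\<^sub>m c \<bottom> M"] by simp
    moreover have "1\<^sub>m (c + a) \<bottom> B = 1\<^sub>m (c + b) \<bottom> B'"
    proof -
      have "a + d = c + b" using dims by simp
      then show ?thesis using arg_cong[OF cd, of "\<lambda>M. 1\<^sub>m a \<bottom> M"] by (simp add: add.commute)
    qed
    ultimately have "1\<^sub>m (c + a) \<bottom> (A * B) = 1\<^sub>m (c + b) \<bottom> (A' * B')"
      using one_sum_mult[OF A B, of "c + a"] one_sum_mult[OF c', of "c + b"] by simp
    then show ?thesis by (rule stab_class_eqI[symmetric])
  qed
  have "{stab_class (A' * B') | A' B' m. A' \<in> stab_class A \<inter> carrier_mat m m \<and> B' \<in> stab_class B \<inter> carrier_mat m m} =
      {stab_class (A * B)}"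
  proof (intro equalityI subsetI)
    fix X assume "X \<in> {stab_class (A' * B') | A' B' m. A' \<in> stab_class A \<inter> carrier_mat m m \<and> B' \<in> stab_class B \<inter> carrier_mat m m}"
    then show "X \<in> {stab_class (A * B)}" using * by blast
  next
    fix X assume "X \<in> {stab_class (A * B)}"
    then show "X \<in> {stab_class (A' * B') | A' B' m. A' \<in> stab_class A \<inter> carrier_mat m m \<and> B' \<in> stab_class B \<inter> carrier_mat m m}"
      using A B stab_class_self by blast
  qed
  then show ?thesis by (simp add: GL_stable_def)
qed

lemma GL_stable_one: "\<one>\<^bsub>GL_stable\<^esub> = stab_class (1\<^sub>m n)"
proof -
  have "stab_class (1\<^sub>m 1) = stab_class (1\<^sub>m n)" by (rule stab_class_eqI[of n _ 1]) simp
  then show ?thesis by (simp add: GL_stable_def)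
qed

lemma stable_iff: "X \<in> stable G \<longleftrightarrow> (\<exists>n A. A \<in> G n \<and> X = stab_class A)"
  by (auto simp: stable_def)

lemma stable_mono: "(\<And>n. G n \<subseteq> G' (f n)) \<Longrightarrow> stable G \<subseteq> stable G'"
  unfolding stable_def by blast

text \<open>\<open>d\<close> is the number of rows gained per step, 1 for linear and 2 for
  symplectic families, so that both kinds share one treatment.\<close>

locale stable_family =
  fixes G :: "nat \<Rightarrow> 'a::comm_ring_1 mat set" and d :: nat
  assumes subgroup_GL: "subgroup (G n) (GL (d * n))"
    and stabilisation: "A \<in> G n \<Longrightarrow> 1\<^sub>m (d * k) \<bottom> A \<in> G (k + n)"
begin

lemma G_GL: "A \<in> G n \<Longrightarrow> A \<in> carrier (GL (d * n))"
  using subgroup.mem_carrier[OF subgroup_GL] .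

text \<open>Every sufficiently large size carries a representative, so finitely many classes can be
  represented at a common size.\<close>

lemma representative:
  assumes "X \<in> stable G"
  obtains n where "\<forall>m\<ge>n. \<exists>A \<in> G m. X = stab_class A"
proof -
  obtain n A where A: "A \<in> G n" "X = stab_class A" using assms by (auto simp: stable_iff)
  have "\<exists>A \<in> G m. X = stab_class A" if "n \<le> m" for m
    using stabilisation[OF A(1), of "m - n"] that A(2)
    by (intro bexI[of _ "1\<^sub>m (d * (m - n)) \<bottom> A"]) simp_all
  then show ?thesis using that by blast
qed

end

interpretation GL: stable_family "\<lambda>n. carrier (GL n :: 'a::comm_ring_1 mat monoid)" 1
proof (rule stable_family.intro)
  show "subgroup (carrier (GL n)) (GL (1 * n))" for n
    using group.subgroup_self[OF GL_group] by simp
  show "1\<^sub>m (1 * k) \<bottom> A \<in> carrier (GL (k + n))" if "A \<in> carrier (GL n)" for A :: "'a mat" and n k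
    using GL_mat_sum(1)[OF GL_one that] by simp
qed

lemma GL_stable_carrier: "carrier GL_stable = stable (\<lambda>n. carrier (GL n))"
  by (simp add: GL_stable_def)

lemma stab_class_GL: "A \<in> carrier (GL n) \<Longrightarrow> stab_class A \<in> carrier GL_stable"
  unfolding GL_stable_carrier stable_iff by blast

theorem GL_stable_group: "group (GL_stable :: 'a::comm_ring_1 mat set monoid)"
proof (rule groupI)
  fix X Y :: "'a mat set" assume X: "X \<in> carrier GL_stable" and Y: "Y \<in> carrier GL_stable"
  obtain k where k: "\<forall>m\<ge>k. \<exists>A \<in> carrier (GL m). X = stab_class A"
    using X[unfolded GL_stable_carrier] by (rule GL.representative)
  obtain l where l: "\<forall>m\<ge>l. \<exists>A \<in> carrier (GL m). Y = stab_class A"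
    using Y[unfolded GL_stable_carrier] by (rule GL.representative)
  obtain A where A: "A \<in> carrier (GL (k + l))" "X = stab_class A" using k[rule_format, of "k + l"] by auto
  obtain B where B: "B \<in> carrier (GL (k + l))" "Y = stab_class B" using l[rule_format, of "k + l"] by auto
  have XY: "X \<otimes>\<^bsub>GL_stable\<^esub> Y = stab_class (A * B)"
    unfolding A B by (rule GL_stable_mult[OF GL_carrier_mat[OF A(1)] GL_carrier_mat[OF B(1)]])
  then show "X \<otimes>\<^bsub>GL_stable\<^esub> Y \<in> carrier GL_stable"
    using stab_class_GL[OF GL_mult[OF A(1) B(1)]] by simp
  fix Z :: "'a mat set" assume Z: "Z \<in> carrier GL_stable"
  obtain n where n: "\<forall>m\<ge>n. \<exists>A \<in> carrier (GL m). Z = stab_class A"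
    using Z[unfolded GL_stable_carrier] by (rule GL.representative)
  obtain A where A: "A \<in> carrier (GL (k + l + n))" "X = stab_class A" using k[rule_format, of "k + l + n"] by auto
  obtain B where B: "B \<in> carrier (GL (k + l + n))" "Y = stab_class B" using l[rule_format, of "k + l + n"] by auto
  obtain C where C: "C \<in> carrier (GL (k + l + n))" "Z = stab_class C" using n[rule_format, of "k + l + n"] by auto
  note c = GL_carrier_mat[OF A(1)] GL_carrier_mat[OF B(1)] GL_carrier_mat[OF C(1)]
  show "X \<otimes>\<^bsub>GL_stable\<^esub> Y \<otimes>\<^bsub>GL_stable\<^esub> Z = X \<otimes>\<^bsub>GL_stable\<^esub> (Y \<otimes>\<^bsub>GL_stable\<^esub> Z)"
    unfolding A B C GL_stable_mult[OF c(1,2)] GL_stable_mult[OF c(2,3)]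
      GL_stable_mult[OF square_mult_closed[OF c(1,2)] c(3)] GL_stable_mult[OF c(1) square_mult_closed[OF c(2,3)]]
      square_mult_assoc[OF c] ..
next
  show "\<one>\<^bsub>GL_stable\<^esub> \<in> carrier (GL_stable :: 'a mat set monoid)"
    unfolding GL_stable_one[of 0] by (rule stab_class_GL[OF GL_one])
next
  fix X :: "'a mat set" assume X: "X \<in> carrier GL_stable"
  then obtain n A where A: "A \<in> carrier (GL n)" "X = stab_class A"
    by (auto simp: GL_stable_carrier stable_iff)
  note c = GL_carrier_mat[OF A(1)] GL_carrier_mat[OF GL_inv[OF A(1)]]
  show "\<one>\<^bsub>GL_stable\<^esub> \<otimes>\<^bsub>GL_stable\<^esub> X = X"
    unfolding A GL_stable_one[of n] GL_stable_mult[OF one_carrier_mat c(1)] left_mult_one_mat[OF c(1)] ..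
  have "stab_class (inv\<^bsub>GL n\<^esub> A) \<otimes>\<^bsub>GL_stable\<^esub> X = \<one>\<^bsub>GL_stable\<^esub>"
    unfolding A(2) GL_stable_one[of n] GL_stable_mult[OF c(2,1)] GL_l_inv[OF A(1)] ..
  then show "\<exists>Y\<in>carrier GL_stable. Y \<otimes>\<^bsub>GL_stable\<^esub> X = \<one>\<^bsub>GL_stable\<^esub>"
    using stab_class_GL[OF GL_inv[OF A(1)]] by blast
qed

lemma GL_stable_inv:
  assumes "A \<in> carrier (GL n)"
  shows "inv\<^bsub>GL_stable\<^esub> (stab_class A) = stab_class (inv\<^bsub>GL n\<^esub> A)"
proof (rule group.inv_equality[OF GL_stable_group])
  show "stab_class (inv\<^bsub>GL n\<^esub> A) \<otimes>\<^bsub>GL_stable\<^esub> stab_class A = \<one>\<^bsub>GL_stable\<^esub>"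
    unfolding GL_stable_one[of n] GL_stable_mult[OF GL_carrier_mat[OF GL_inv[OF assms]] GL_carrier_mat[OF assms]]
      GL_l_inv[OF assms] ..
qed (use assms in \<open>auto intro: stab_class_GL\<close>)

context stable_family
begin

lemma stable_subgroup: "subgroup (stable G) GL_stable"
proof (rule group.subgroupI[OF GL_stable_group])
  show "stable G \<subseteq> carrier GL_stable"
  proof
    fix X assume "X \<in> stable G"
    then obtain n A where "A \<in> G n" "X = stab_class A" unfolding stable_iff by blast
    then show "X \<in> carrier GL_stable" using stab_class_GL[OF G_GL] by simp
  qed
  show "stable G \<noteq> {}"
    using subgroup.one_closed[OF subgroup_GL[of 0]] unfolding stable_def by blast
  fix X assume X: "X \<in> stable G"
  then obtain n A where A: "A \<in> G n" "X = stab_class A" by (auto simp: stable_iff)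
  show "inv\<^bsub>GL_stable\<^esub> X \<in> stable G"
    unfolding A(2) GL_stable_inv[OF G_GL[OF A(1)]]
    using subgroup.m_inv_closed[OF subgroup_GL A(1)] unfolding stable_iff by blast
  fix Y assume Y: "Y \<in> stable G"
  obtain k where k: "\<forall>m\<ge>k. \<exists>A \<in> G m. X = stab_class A" using X by (rule representative)
  obtain l where l: "\<forall>m\<ge>l. \<exists>A \<in> G m. Y = stab_class A" using Y by (rule representative)
  obtain A where A: "A \<in> G (k + l)" "X = stab_class A" using k[rule_format, of "k + l"] by auto
  obtain B where B: "B \<in> G (k + l)" "Y = stab_class B" using l[rule_format, of "k + l"] by auto
  have AB: "A * B \<in> G (k + l)" using subgroup.m_closed[OF subgroup_GL A(1) B(1)] by simp
  have XY: "X \<otimes>\<^bsub>GL_stable\<^esub> Y = stab_class (A * B)"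
    unfolding A(2) B(2) by (rule GL_stable_mult[OF GL_carrier_mat[OF G_GL[OF A(1)]] GL_carrier_mat[OF G_GL[OF B(1)]]])
  show "X \<otimes>\<^bsub>GL_stable\<^esub> Y \<in> stable G"
    unfolding XY stable_iff using AB by blast
qed

end

context ideal_set
begin

section \<open>The relative stable groups and normality\<close>

lemma SL_rel_subgroup: "subgroup (SL_rel n I) (GL n)"
proof -
  have "SL_rel n I = GL_rel n I \<inter> {A \<in> carrier (GL n). det A = 1}"
    by (auto simp: SL_rel_def GL_rel_iff)
  then show ?thesis using group.subgroups_Inter_pair[OF GL_group GL_rel_subgroup SL_subgroup] by simp
qed

lemma SL_rel_GL: "A \<in> SL_rel n I \<Longrightarrow> A \<in> carrier (GL n)"
  using subgroup.mem_carrier[OF SL_rel_subgroup] .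

lemma E_rel_SL_rel: "E_rel n I \<subseteq> SL_rel n I"
  using E_rel_subset_GL_rel[of n] det_E_rel by (auto simp: SL_rel_def)

lemma SL_rel_one_sum: "A \<in> SL_rel n I \<Longrightarrow> 1\<^sub>m k \<bottom> A \<in> SL_rel (k + n) I"
  using GL_rel_mat_sum[OF GL_rel_one, of A n k] det_one_mat_sum[of A n k] by (auto simp: SL_rel_def GL_rel_iff)

lemma Sp_rel_SL_rel: "Sp_rel n I \<subseteq> SL_rel (2 * n) I"
  using det_Sp by (auto simp: Sp_rel_iff SL_rel_def)

lemma congruence_mat_sum:
  fixes A B :: "'a mat"
  assumes "A \<in> carrier_mat (2 * m) (2 * m)" "B \<in> carrier_mat (2 * n) (2 * n)"
  shows "transpose_mat (A \<bottom> B) * chi (m + n) * (A \<bottom> B) =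
    (transpose_mat A * chi m * A) \<bottom> (transpose_mat B * chi n * B)"
proof -
  have c: "transpose_mat A \<in> carrier_mat (2 * m) (2 * m)" "transpose_mat B \<in> carrier_mat (2 * n) (2 * n)"
    using assms by simp_all
  show ?thesis
    unfolding chi_add[symmetric] transpose_mat_sum mat_sum_mult[OF c(1) chi_carrier c(2) chi_carrier]
      mat_sum_mult[OF square_mult_closed[OF c(1) chi_carrier] assms(1) square_mult_closed[OF c(2) chi_carrier] assms(2)] ..
qed

lemma congruence_one: "transpose_mat (1\<^sub>m (2 * k)) * chi k * 1\<^sub>m (2 * k) = (chi k :: 'a mat)"
  unfolding transpose_one left_mult_one_mat[OF chi_carrier] right_mult_one_mat[OF chi_carrier] ..

lemma Sp_rel_one_sum:
  assumes A: "A \<in> Sp_rel n I"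
  shows "1\<^sub>m (2 * k) \<bottom> A \<in> Sp_rel (k + n) I"
proof -
  have a: "A \<in> GL_rel (2 * n) I" "transpose_mat A * chi n * A = chi n" using A by (auto simp: Sp_rel_def)
  then have c: "A \<in> carrier_mat (2 * n) (2 * n)" by (auto simp: GL_rel_iff)
  have "transpose_mat (1\<^sub>m (2 * k) \<bottom> A) * chi (k + n) * (1\<^sub>m (2 * k) \<bottom> A) = chi (k + n)"
    unfolding congruence_mat_sum[OF one_carrier_mat c] congruence_one a(2) chi_add ..
  then show ?thesis
    using GL_rel_mat_sum[OF GL_rel_one a(1), of "2 * k"] by (simp add: Sp_rel_def distrib_left)
qed

lemma Sp_rel_subgroup: "subgroup (Sp_rel n I) (GL (2 * n))"
proof -
  have "Sp_rel n I = GL_rel (2 * n) I \<inter> Sp n" by (auto simp: Sp_rel_iff)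
  then show ?thesis using group.subgroups_Inter_pair[OF GL_group GL_rel_subgroup Sp_subgroup] by simp
qed

sublocale SL: stable_family "\<lambda>n. SL_rel n I" 1
  by (rule stable_family.intro) (simp_all add: SL_rel_subgroup SL_rel_one_sum)

sublocale E: stable_family "\<lambda>n. E_rel n I" 1
  by (rule stable_family.intro) (simp_all add: E_rel_subgroup E_rel_one_sum)

sublocale Sp: stable_family "\<lambda>n. Sp_rel n I" 2
  by (rule stable_family.intro) (simp_all add: Sp_rel_subgroup Sp_rel_one_sum)

sublocale ESp: stable_family "\<lambda>n. ESp_rel n I" 2
  by (rule stable_family.intro) (simp_all add: ESp_rel_subgroup ESp_rel_one_sum[OF ideal_set_axioms])

lemma stable_inclusions:
  "E_st I \<subseteq> SL_st I" "ESp_st I \<subseteq> Sp_st I" "ESp_st I \<subseteq> E_st I" "Sp_st I \<subseteq> SL_st I"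
proof -
  show "E_st I \<subseteq> SL_st I" by (rule stable_mono[where f = "\<lambda>n. n"]) (rule E_rel_SL_rel)
  show "ESp_st I \<subseteq> Sp_st I" by (rule stable_mono[where f = "\<lambda>n. n"]) (rule ESp_rel_Sp_rel[OF ideal_set_axioms])
  show "ESp_st I \<subseteq> E_st I" by (rule stable_mono[where f = "\<lambda>n. 2 * n"]) (rule ESp_rel_E_rel[OF ideal_set_axioms])
  show "Sp_st I \<subseteq> SL_st I" by (rule stable_mono[where f = "\<lambda>n. 2 * n"]) (rule Sp_rel_SL_rel)
qed

lemma stab_class_conj:
  assumes "A \<in> carrier (GL n)" "B \<in> carrier (GL n)"
  shows "stab_class A \<otimes>\<^bsub>GL_stable\<^esub> stab_class B \<otimes>\<^bsub>GL_stable\<^esub> inv\<^bsub>GL_stable\<^esub> stab_class A =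
    stab_class (A * B * inv\<^bsub>GL n\<^esub> A)"
  unfolding GL_stable_inv[OF assms(1)] GL_stable_mult[OF GL_carrier_mat[OF assms(1)] GL_carrier_mat[OF assms(2)]]
    GL_stable_mult[OF GL_carrier_mat[OF GL_mult[OF assms]] GL_carrier_mat[OF GL_inv[OF assms(1)]]] ..

text \<open>Conjugation may leave \<open>E_rel\<close> at the given size, but
  \<open>E_rel_stably_normal\<close> brings the result back after padding, which does not change its
  class.\<close>

lemma E_st_normal: "E_st I \<lhd> (GL_stable :: 'a mat set monoid)"
  unfolding group.normal_inv_iff[OF GL_stable_group]
proof (intro conjI ballI E.stable_subgroup)
  fix X Y :: "'a mat set" assume X: "X \<in> carrier GL_stable" and Y: "Y \<in> E_st I"
  obtain k where k: "\<forall>m\<ge>k. \<exists>A \<in> carrier (GL m). X = stab_class A"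
    using X[unfolded GL_stable_carrier] by (rule GL.representative)
  obtain l where l: "\<forall>m\<ge>l. \<exists>A \<in> E_rel m I. Y = stab_class A" using Y by (rule E.representative)
  obtain A where A: "A \<in> carrier (GL (k + l))" "X = stab_class A" using k[rule_format, of "k + l"] by auto
  obtain B where B: "B \<in> E_rel (k + l) I" "Y = stab_class B" using l[rule_format, of "k + l"] by auto
  have "X \<otimes>\<^bsub>GL_stable\<^esub> Y \<otimes>\<^bsub>GL_stable\<^esub> inv\<^bsub>GL_stable\<^esub> X =
      stab_class (1\<^sub>m (k + l) \<bottom> (A * B * inv\<^bsub>GL (k + l)\<^esub> A))"
    unfolding A(2) B(2) using stab_class_conj[OF A(1) subsetD[OF E_rel_GL B(1)]] by simp
  then show "X \<otimes>\<^bsub>GL_stable\<^esub> Y \<otimes>\<^bsub>GL_stable\<^esub> inv\<^bsub>GL_stable\<^esub> X \<in> E_st I"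
    using E_rel_stably_normal[OF A(1) B(1)] unfolding stable_iff by blast
qed

lemma Sp_st_group: "group (GL_stable\<lparr>carrier := Sp_st I\<rparr>)"
  by (rule group.subgroup_imp_group[OF GL_stable_group Sp.stable_subgroup])

lemma E_st_normal_SL: "E_st I \<lhd> GL_stable\<lparr>carrier := SL_st I\<rparr>"
  by (rule group.normal_restrict_supergroup[OF GL_stable_group SL.stable_subgroup E_st_normal stable_inclusions(1)])

lemma ESp_st_normal: "ESp_st I \<lhd> GL_stable\<lparr>carrier := Sp_st I\<rparr>"
  unfolding group.normal_inv_iff[OF Sp_st_group]
proof (intro conjI ballI)
  show "subgroup (ESp_st I) (GL_stable\<lparr>carrier := Sp_st I\<rparr>)"
    by (rule group.subgroup_incl[OF GL_stable_group ESp.stable_subgroup Sp.stable_subgroup stable_inclusions(2)])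
  fix X Y assume "X \<in> carrier (GL_stable\<lparr>carrier := Sp_st I\<rparr>)" and Y: "Y \<in> ESp_st I"
  then have X: "X \<in> Sp_st I" by simp
  obtain k where k: "\<forall>m\<ge>k. \<exists>A \<in> Sp_rel m I. X = stab_class A" using X by (rule Sp.representative)
  obtain l where l: "\<forall>m\<ge>l. \<exists>A \<in> ESp_rel m I. Y = stab_class A" using Y by (rule ESp.representative)
  obtain A where A: "A \<in> Sp_rel (k + l) I" "X = stab_class A" using k[rule_format, of "k + l"] by auto
  obtain B where B: "B \<in> ESp_rel (k + l) I" "Y = stab_class B" using l[rule_format, of "k + l"] by auto
  have "X \<otimes>\<^bsub>GL_stable\<^esub> Y \<otimes>\<^bsub>GL_stable\<^esub> inv\<^bsub>GL_stable\<^esub> X =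
      stab_class (1\<^sub>m 2 \<bottom> (A * B * inv\<^bsub>GL (2 * (k + l))\<^esub> A))"
    unfolding A(2) B(2) using stab_class_conj[OF Sp.G_GL[OF A(1)] ESp.G_GL[OF B(1)]] by simp
  moreover have "1\<^sub>m 2 \<bottom> (A * B * inv\<^bsub>GL (2 * (k + l))\<^esub> A) \<in> ESp_rel (Suc (k + l)) I"
    using A(1) B(1) by (intro ESp_rel_stably_normal) (simp_all add: Sp_rel_iff)
  ultimately have "X \<otimes>\<^bsub>GL_stable\<^esub> Y \<otimes>\<^bsub>GL_stable\<^esub> inv\<^bsub>GL_stable\<^esub> X \<in> ESp_st I"
    unfolding stable_iff by blast
  moreover have "inv\<^bsub>GL_stable\<lparr>carrier := Sp_st I\<rparr>\<^esub> X = inv\<^bsub>GL_stable\<^esub> X"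
    by (rule group.m_inv_consistent[OF GL_stable_group Sp.stable_subgroup X])
  ultimately show "X \<otimes>\<^bsub>GL_stable\<lparr>carrier := Sp_st I\<rparr>\<^esub> Y \<otimes>\<^bsub>GL_stable\<lparr>carrier := Sp_st I\<rparr>\<^esub>
      inv\<^bsub>GL_stable\<lparr>carrier := Sp_st I\<rparr>\<^esub> X \<in> ESp_st I"
    by simp
qed

section \<open>The quotient groups and the map induced by inclusion\<close>

lemma SK1_group: "group (SK1 I)"
  unfolding SK1_def by (rule normal.factorgroup_is_group[OF E_st_normal_SL])

lemma K1Sp_group: "group (K1Sp I)"
  unfolding K1Sp_def by (rule normal.factorgroup_is_group[OF ESp_st_normal])

text \<open>Cosets are formed in \<open>GL_stable\<close>; a right coset only uses the
  multiplication, so restricting the carrier does not affect it.\<close>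

abbreviation E_coset :: "'a mat set \<Rightarrow> 'a mat set set" where
  "E_coset X \<equiv> E_st I #>\<^bsub>GL_stable\<^esub> X"

abbreviation ESp_coset :: "'a mat set \<Rightarrow> 'a mat set set" where
  "ESp_coset X \<equiv> ESp_st I #>\<^bsub>GL_stable\<^esub> X"

lemma SK1_carrier: "carrier (SK1 I) = E_coset ` SL_st I"
  by (auto simp: SK1_def FactGroup_def RCOSETS_def)

lemma K1Sp_carrier: "carrier (K1Sp I) = ESp_coset ` Sp_st I"
  by (auto simp: K1Sp_def FactGroup_def RCOSETS_def)

lemma SK1_mult:
  assumes "X \<in> SL_st I" "Y \<in> SL_st I"
  shows "E_coset X \<otimes>\<^bsub>SK1 I\<^esub> E_coset Y = E_coset (X \<otimes>\<^bsub>GL_stable\<^esub> Y)"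
  using normal.rcos_sum[OF E_st_normal_SL, of X Y] assms by (simp add: SK1_def FactGroup_def)

lemma K1Sp_mult:
  assumes "X \<in> Sp_st I" "Y \<in> Sp_st I"
  shows "ESp_coset X \<otimes>\<^bsub>K1Sp I\<^esub> ESp_coset Y = ESp_coset (X \<otimes>\<^bsub>GL_stable\<^esub> Y)"
  using normal.rcos_sum[OF ESp_st_normal, of X Y] assms by (simp add: K1Sp_def FactGroup_def)

lemma SL_st_GL_stable: "X \<in> SL_st I \<Longrightarrow> X \<in> carrier GL_stable"
  using subgroup.mem_carrier[OF SL.stable_subgroup] .

lemma E_coset_left:
  assumes e: "e \<in> E_st I" and X: "X \<in> carrier GL_stable"
  shows "E_coset (e \<otimes>\<^bsub>GL_stable\<^esub> X) = E_coset X"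
proof -
  interpret group GL_stable by (rule GL_stable_group)
  have "e \<in> carrier GL_stable" using subgroup.mem_carrier[OF E.stable_subgroup e] .
  then show ?thesis
    using coset_mult_assoc[OF subgroup.subset[OF E.stable_subgroup] _ X, of e] coset_join2[OF _ E.stable_subgroup e]
    by simp
qed

lemma E_coset_right:
  assumes e: "e \<in> E_st I" and X: "X \<in> carrier GL_stable"
  shows "E_coset (X \<otimes>\<^bsub>GL_stable\<^esub> e) = E_coset X"
proof -
  interpret group GL_stable by (rule GL_stable_group)
  have c: "e \<in> carrier GL_stable" using subgroup.mem_carrier[OF E.stable_subgroup e] .
  have "X \<otimes>\<^bsub>GL_stable\<^esub> e \<otimes>\<^bsub>GL_stable\<^esub> inv\<^bsub>GL_stable\<^esub> X \<in> E_st I"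
    using E_st_normal e X unfolding normal_inv_iff by blast
  from E_coset_left[OF this X] show ?thesis using c X by (simp add: m_assoc)
qed

text \<open>Well-definedness: representatives of an \<open>ESp\<close> coset differ by elements of
  \<open>E_st I\<close>, so the union runs over equal cosets.\<close>

lemma K1Sp_to_SK1_coset:
  assumes X: "X \<in> Sp_st I"
  shows "K1Sp_to_SK1 I (ESp_coset X) = E_coset X"
proof -
  have XG: "X \<in> carrier GL_stable" using X stable_inclusions(4) SL_st_GL_stable by blast
  have "E_coset Y = E_coset X" if "Y \<in> ESp_coset X" for Y
  proof -
    obtain e where "e \<in> ESp_st I" "Y = e \<otimes>\<^bsub>GL_stable\<^esub> X" using \<open>Y \<in> ESp_coset X\<close> by (auto simp: r_coset_def)
    then show ?thesis using E_coset_left[OF _ XG] stable_inclusions(3) by blast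
  qed
  moreover have "X \<in> ESp_coset X" using group.rcos_self[OF GL_stable_group XG ESp.stable_subgroup] .
  ultimately show ?thesis unfolding K1Sp_to_SK1_def by blast
qed

lemma K1Sp_to_SK1_hom: "group_hom (K1Sp I) (SK1 I) (K1Sp_to_SK1 I)"
proof (intro group_hom.intro group_hom_axioms.intro K1Sp_group SK1_group homI)
  fix X Y assume "X \<in> carrier (K1Sp I)" "Y \<in> carrier (K1Sp I)"
  then obtain A B where A: "A \<in> Sp_st I" "X = ESp_coset A" and B: "B \<in> Sp_st I" "Y = ESp_coset B"
    by (auto simp: K1Sp_carrier)
  have AB: "A \<otimes>\<^bsub>GL_stable\<^esub> B \<in> Sp_st I" using subgroup.m_closed[OF Sp.stable_subgroup A(1) B(1)] .
  have S: "A \<in> SL_st I" "B \<in> SL_st I" using A B stable_inclusions(4) by blast+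
  show "K1Sp_to_SK1 I X \<in> carrier (SK1 I)"
    unfolding A(2) K1Sp_to_SK1_coset[OF A(1)] SK1_carrier using S by blast
  show "K1Sp_to_SK1 I (X \<otimes>\<^bsub>K1Sp I\<^esub> Y) = K1Sp_to_SK1 I X \<otimes>\<^bsub>SK1 I\<^esub> K1Sp_to_SK1 I Y"
    unfolding A(2) B(2) K1Sp_mult[OF A(1) B(1)] K1Sp_to_SK1_coset[OF AB] K1Sp_to_SK1_coset[OF A(1)]
      K1Sp_to_SK1_coset[OF B(1)] SK1_mult[OF S] ..
qed


section \<open>The map to the Witt group and exactness\<close>

definition witt_form :: "nat \<Rightarrow> 'a mat \<Rightarrow> 'a mat" where
  "witt_form n A = transpose_mat A * chi n * A"

lemma witt_form_Alt: "A \<in> SL_rel (2 * n) I \<Longrightarrow> witt_form n A \<in> Alt n I"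
  unfolding witt_form_def by (rule Alt_congruence[OF Alt_chi])

lemma SL_rel_carrier_mat: "A \<in> SL_rel n I \<Longrightarrow> A \<in> carrier_mat n n"
  using GL_carrier_mat[OF SL_rel_GL] .

text \<open>The elementary factor stands on the left, but a congruence of forms needs it on the
  right: \<open>e B' = B' (B'^-1 e B')\<close>. The conjugate is known to be elementary only after
  padding, whence the block matrix \<open>f\<close>.\<close>

lemma witt_form_E_rel:
  assumes A: "A \<in> SL_rel (2 * m) I" and B: "B \<in> SL_rel (2 * n) I"
    and e: "e \<in> E_rel (2 * (k + m)) I" and mn: "k + m = l + n"
    and eq: "1\<^sub>m (2 * k) \<bottom> A = e * (1\<^sub>m (2 * l) \<bottom> B)"
  shows "(witt_form m A, witt_form n B) \<in> W_rel I"
proof -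
  let ?N = "2 * (k + m)"
  define A' B' where "A' = 1\<^sub>m (2 * k) \<bottom> A" and "B' = 1\<^sub>m (2 * l) \<bottom> B"
  have S: "A' \<in> SL_rel ?N I"
    using SL_rel_one_sum[OF A, of "2 * k"] unfolding A'_def distrib_left .
  have S': "B' \<in> SL_rel ?N I"
    using SL_rel_one_sum[OF B, of "2 * l"] unfolding B'_def mn distrib_left .
  have G: "B' \<in> carrier (GL ?N)" "inv\<^bsub>GL ?N\<^esub> B' \<in> carrier (GL ?N)" using SL_rel_GL[OF S'] by auto
  note c = GL_carrier_mat[OF G(1)] GL_carrier_mat[OF G(2)] E_rel_carrier_mat[OF e]
  define f where "f = 1\<^sub>m ?N \<bottom> (inv\<^bsub>GL ?N\<^esub> B' * e * B')"
  have f: "f \<in> E_rel (?N + ?N) I"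
    using E_rel_stably_normal[OF G(2) e] group.inv_inv[OF GL_group G(1)] by (simp add: f_def)
  have conj: "inv\<^bsub>GL ?N\<^esub> B' * e * B' \<in> carrier_mat ?N ?N"
    by (rule square_mult_closed[OF square_mult_closed[OF c(2,3)] c(1)])
  have "(1\<^sub>m ?N \<bottom> B') * f = 1\<^sub>m ?N \<bottom> (B' * (inv\<^bsub>GL ?N\<^esub> B' * e * B'))"
    unfolding f_def by (rule one_sum_mult[OF c(1) conj])
  also have "B' * (inv\<^bsub>GL ?N\<^esub> B' * e * B') = B' * (inv\<^bsub>GL ?N\<^esub> B' * (e * B'))"
    unfolding square_mult_assoc[OF c(2,3,1)] ..
  also have "\<dots> = A'"
    unfolding mult_left_inverse_cancel[OF c(1,2) square_mult_closed[OF c(3,1)] GL_r_inv[OF G(1)]]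
    using eq by (simp add: A'_def B'_def)
  finally have eq': "1\<^sub>m ?N \<bottom> A' = (1\<^sub>m ?N \<bottom> B') * f" ..
  have N: "?N + ?N = 2 * (k + m + (k + m))" by simp
  have sum: "witt_form (k + m + (k + m)) (1\<^sub>m ?N \<bottom> (1\<^sub>m (2 * j) \<bottom> C)) = chi (k + m + j) \<bottom> witt_form i C"
    if C: "C \<in> carrier_mat (2 * i) (2 * i)" and ji: "j + i = k + m" for j i C
  proof -
    have C': "1\<^sub>m ?N \<bottom> (1\<^sub>m (2 * j) \<bottom> C) = 1\<^sub>m (2 * (k + m + j)) \<bottom> C"
      by (simp add: mat_sum_assoc[symmetric] one_mat_sum_one distrib_left)
    have i: "k + m + (k + m) = k + m + j + i" using ji by linarith
    show ?thesis
      unfolding C' i witt_form_def congruence_mat_sum[OF one_carrier_mat C] congruence_one ..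
  qed
  have cB: "1\<^sub>m ?N \<bottom> B' \<in> carrier_mat (?N + ?N) (?N + ?N)" using c(1) by (intro mat_sum_carrier) simp_all
  have eqf: "witt_form (k + m + (k + m)) (1\<^sub>m ?N \<bottom> A') = transpose_mat f * witt_form (k + m + (k + m)) (1\<^sub>m ?N \<bottom> B') * f"
    unfolding eq' witt_form_def
    by (rule congruence_mult[OF cB E_rel_carrier_mat[OF f]]) (unfold N, rule chi_carrier)
  have forms: "witt_form (k + m + (k + m)) (1\<^sub>m ?N \<bottom> A') = chi (k + m + k) \<bottom> witt_form m A"
    "witt_form (k + m + (k + m)) (1\<^sub>m ?N \<bottom> B') = chi (k + m + l) \<bottom> witt_form n B"
    unfolding A'_def B'_def
    by (rule sum[OF SL_rel_carrier_mat[OF A] refl], rule sum[OF SL_rel_carrier_mat[OF B] mn[symmetric]])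
  have cong: "elem_cong (?N + ?N) (chi (k + m + k) \<bottom> witt_form m A) (chi (k + m + l) \<bottom> witt_form n B)"
    using eqf f unfolding elem_cong_def forms by blast
  note wA = witt_form_Alt[OF A] and wB = witt_form_Alt[OF B]
  have "(chi (k + m + k) \<bottom> witt_form m A, chi (k + m + l) \<bottom> witt_form n B) \<in> W_rel I"
    using mn by (intro W_rel_cong[OF Alt_mat_sum[OF Alt_chi wA] Alt_mat_sum[OF Alt_chi wB] _ cong]) simp
  then show ?thesis
    using W_rel_trans[OF W_rel_sym[OF W_rel_chi_left[OF wA]] W_rel_trans[OF _ W_rel_chi_left[OF wB]]] by blast
qed

text \<open>Well-definedness of the map to the Witt group: the union that defines it consists of
  equal classes.\<close>

lemma SK1_to_W_E_coset:
  assumes A: "A \<in> SL_rel (2 * n) I"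
  shows "SK1_to_W_E I (E_coset (stab_class A)) = W_class I (witt_form n A)"
proof -
  have AG: "stab_class A \<in> carrier GL_stable" using stab_class_GL[OF SL_rel_GL[OF A]] .
  have "W_class I (witt_form m B) = W_class I (witt_form n A)"
    if B: "B \<in> SL_rel (2 * m) I" and BA: "stab_class B \<in> E_coset (stab_class A)" for B m
  proof -
    obtain Y where Y: "Y \<in> E_st I" "stab_class B = Y \<otimes>\<^bsub>GL_stable\<^esub> stab_class A"
      using BA by (auto simp: r_coset_def)
    obtain k where k: "\<forall>m\<ge>k. \<exists>e \<in> E_rel m I. Y = stab_class e" using Y(1) by (rule E.representative)
    \<comment> \<open>An even size with room for representatives of \<open>Y\<close>,
      \<open>A\<close> and \<open>B\<close>.\<close>
    let ?N = "2 * (k + n + m)"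
    obtain e where e: "e \<in> E_rel ?N I" "Y = stab_class e" using k[rule_format, of ?N] by auto
    have N: "2 * (k + n) + 2 * m = ?N" "2 * (k + m) + 2 * n = ?N" by simp_all
    have c: "1\<^sub>m (2 * (k + n)) \<bottom> B \<in> carrier_mat ?N ?N" "1\<^sub>m (2 * (k + m)) \<bottom> A \<in> carrier_mat ?N ?N"
      using mat_sum_carrier[OF one_carrier_mat[of "2 * (k + n)"] SL_rel_carrier_mat[OF B]]
        mat_sum_carrier[OF one_carrier_mat[of "2 * (k + m)"] SL_rel_carrier_mat[OF A]] unfolding N .
    have "stab_class (1\<^sub>m (2 * (k + n)) \<bottom> B) = stab_class (e * (1\<^sub>m (2 * (k + m)) \<bottom> A))"
      using Y(2) GL_stable_mult[OF E_rel_carrier_mat[OF e(1)] c(2)] e(2) by simp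
    then have "1\<^sub>m (2 * (k + n)) \<bottom> B = e * (1\<^sub>m (2 * (k + m)) \<bottom> A)"
      by (rule stab_class_inject[OF c(1) square_mult_closed[OF E_rel_carrier_mat[OF e(1)] c(2)]])
    then have "(witt_form m B, witt_form n A) \<in> W_rel I"
      by (rule witt_form_E_rel[OF B A e(1), rotated]) simp
    then show ?thesis by (rule equiv_class_eq[OF W_rel_equiv])
  qed
  moreover have "stab_class A \<in> E_coset (stab_class A)"
    using group.rcos_self[OF GL_stable_group AG E.stable_subgroup] .
  ultimately have "{W_class I (transpose_mat B * chi m * B) | B m. B \<in> SL_rel (2 * m) I \<and> stab_class B \<in> E_coset (stab_class A)} =
      {W_class I (witt_form n A)}"
    unfolding witt_form_def[symmetric] using A by blast
  then show ?thesis unfolding SK1_to_W_E_def by (simp only: cSup_singleton)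
qed

lemma even_representative:
  assumes "X \<in> SL_st I"
  obtains n where "\<forall>m\<ge>n. \<exists>A \<in> SL_rel (2 * m) I. X = stab_class A"
proof -
  obtain n where n: "\<forall>m\<ge>n. \<exists>A \<in> SL_rel m I. X = stab_class A" using assms by (rule SL.representative)
  have "\<exists>A \<in> SL_rel (2 * m) I. X = stab_class A" if "n \<le> m" for m using n[rule_format, of "2 * m"] that by simp
  then show ?thesis using that by blast
qed

text \<open>\<open>A \<bottom> B = (A * B \<bottom> 1) * (inv B \<bottom> B)\<close> with an
  elementary last factor. The form of the left side is the sum of the two forms, that of
  \<open>A * B \<bottom> 1\<close> is the form of \<open>A * B\<close> padded by
  \<open>chi n\<close>.\<close>

lemma SK1_to_W_E_hom: "group_hom (SK1 I) (W_E I) (SK1_to_W_E I)"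
proof (intro group_hom.intro group_hom_axioms.intro SK1_group W_E_group homI)
  fix X Y assume "X \<in> carrier (SK1 I)" "Y \<in> carrier (SK1 I)"
  then obtain P Q where P: "P \<in> SL_st I" "X = E_coset P" and Q: "Q \<in> SL_st I" "Y = E_coset Q"
    by (auto simp: SK1_carrier)
  obtain k where k: "\<forall>m\<ge>k. \<exists>A \<in> SL_rel (2 * m) I. P = stab_class A" using P(1) by (rule even_representative)
  obtain l where l: "\<forall>m\<ge>l. \<exists>A \<in> SL_rel (2 * m) I. Q = stab_class A" using Q(1) by (rule even_representative)
  define n where "n = k + l"
  obtain A where A: "A \<in> SL_rel (2 * n) I" "P = stab_class A" using k[rule_format, of n] by (auto simp: n_def)
  obtain B where B: "B \<in> SL_rel (2 * n) I" "Q = stab_class B" using l[rule_format, of n] by (auto simp: n_def)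
  note cA = SL_rel_carrier_mat[OF A(1)] and cB = SL_rel_carrier_mat[OF B(1)]
  have AB: "A * B \<in> SL_rel (2 * n) I" using subgroup.m_closed[OF SL_rel_subgroup A(1) B(1)] by simp
  note wA = witt_form_Alt[OF A(1)] and wB = witt_form_Alt[OF B(1)] and wAB = witt_form_Alt[OF AB]
  show "SK1_to_W_E I X \<in> carrier (W_E I)"
    unfolding P(2) A(2) SK1_to_W_E_coset[OF A(1)] W_E_carrier using wA by blast
  let ?b = "inv\<^bsub>GL (2 * n)\<^esub> B"
  have cb: "?b \<in> carrier_mat (2 * n) (2 * n)" using GL_carrier_mat[OF GL_inv[OF SL_rel_GL[OF B(1)]]] .
  have e: "?b \<bottom> B \<in> E_rel (2 * n + 2 * n) I"
    using B(1) by (intro relative_whitehead') (simp add: SL_rel_def)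
  have "A * B * ?b = A"
    unfolding square_mult_assoc[OF cA cB cb] GL_r_inv[OF SL_rel_GL[OF B(1)]] by (rule right_mult_one_mat[OF cA])
  then have "A \<bottom> B = (A * B \<bottom> 1\<^sub>m (2 * n)) * (?b \<bottom> B)"
    using mat_sum_mult[OF square_mult_closed[OF cA cB] cb one_carrier_mat cB] left_mult_one_mat[OF cB] by simp
  then have "witt_form (n + n) (A \<bottom> B) = transpose_mat (?b \<bottom> B) * witt_form (n + n) (A * B \<bottom> 1\<^sub>m (2 * n)) * (?b \<bottom> B)"
    unfolding witt_form_def
    using congruence_mult[OF mat_sum_carrier[OF square_mult_closed[OF cA cB] one_carrier_mat] mat_sum_carrier[OF cb cB], of "chi (n + n)"]
      chi_carrier[of "n + n"] by (simp only: distrib_left)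
  then have "elem_cong (2 * n + 2 * n) (witt_form (n + n) (A \<bottom> B)) (witt_form (n + n) (A * B \<bottom> 1\<^sub>m (2 * n)))"
    using e unfolding elem_cong_def by blast
  moreover have "witt_form (n + n) (A \<bottom> B) = witt_form n A \<bottom> witt_form n B"
    unfolding witt_form_def by (rule congruence_mat_sum[OF cA cB])
  moreover have "witt_form (n + n) (A * B \<bottom> 1\<^sub>m (2 * n)) = witt_form n (A * B) \<bottom> chi n"
    unfolding witt_form_def congruence_mat_sum[OF square_mult_closed[OF cA cB] one_carrier_mat] congruence_one ..
  ultimately have "(witt_form n A \<bottom> witt_form n B, witt_form n (A * B) \<bottom> chi n) \<in> W_rel I"
    by (intro W_rel_cong[OF Alt_mat_sum[OF wA wB] Alt_mat_sum[OF wAB Alt_chi] refl]) (simp only:)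
  then have "(witt_form n A \<bottom> witt_form n B, witt_form n (A * B)) \<in> W_rel I"
    using W_rel_trans W_rel_pad[OF wAB] by blast
  then have "W_class I (witt_form n A \<bottom> witt_form n B) = W_class I (witt_form n (A * B))"
    by (rule equiv_class_eq[OF W_rel_equiv])
  then show "SK1_to_W_E I (X \<otimes>\<^bsub>SK1 I\<^esub> Y) = SK1_to_W_E I X \<otimes>\<^bsub>W_E I\<^esub> SK1_to_W_E I Y"
    unfolding P(2) Q(2) SK1_mult[OF P(1) Q(1)]
    unfolding A(2) B(2) GL_stable_mult[OF cA cB] SK1_to_W_E_coset[OF AB] SK1_to_W_E_coset[OF A(1)] SK1_to_W_E_coset[OF B(1)] W_E_mult[OF wA wB] by simp
qed

text \<open>\<open>B \<bottom> 1 = (B \<bottom> inv B) * (1 \<bottom> B)\<close>, and the first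
  factor is elementary. Padding \<open>A\<close> on the left to size \<open>p\<close> makes the two
  blocks equally large.\<close>

lemma E_coset_right_stabilisation:
  assumes A: "A \<in> SL_rel n I" and p: "n \<le> p"
  shows "E_coset (stab_class (A \<bottom> 1\<^sub>m p)) = E_coset (stab_class A)"
proof -
  define B where "B = 1\<^sub>m (p - n) \<bottom> A"
  have B: "B \<in> SL_rel p I" using SL_rel_one_sum[OF A, of "p - n"] p by (simp add: B_def)
  have G: "B \<in> carrier (GL p)" using SL_rel_GL[OF B] .
  note c = GL_carrier_mat[OF G] GL_carrier_mat[OF GL_inv[OF G]]
  have e: "B \<bottom> inv\<^bsub>GL p\<^esub> B \<in> E_rel (p + p) I"
    using B by (intro relative_whitehead) (simp add: SL_rel_def)
  have "B \<bottom> 1\<^sub>m p = (B \<bottom> inv\<^bsub>GL p\<^esub> B) * (1\<^sub>m p \<bottom> B)"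
    using mat_sum_mult[OF c(1) one_carrier_mat c(2,1)] right_mult_one_mat[OF c(1)] G by simp
  then have "stab_class (B \<bottom> 1\<^sub>m p) = stab_class (B \<bottom> inv\<^bsub>GL p\<^esub> B) \<otimes>\<^bsub>GL_stable\<^esub> stab_class (1\<^sub>m p \<bottom> B)"
    using GL_stable_mult[OF E_rel_carrier_mat[OF e] mat_sum_carrier[OF one_carrier_mat[of p] c(1)]] by (simp only:)
  moreover have "stab_class (B \<bottom> inv\<^bsub>GL p\<^esub> B) \<in> E_st I" using e unfolding stable_iff by blast
  ultimately have "E_coset (stab_class (B \<bottom> 1\<^sub>m p)) = E_coset (stab_class (1\<^sub>m p \<bottom> B))"
    using E_coset_left[OF _ stab_class_GL[OF GL_mat_sum(1)[OF GL_one G]]] by (simp only:)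
  then show ?thesis by (simp add: B_def mat_sum_assoc)
qed

theorem exactness: "K1Sp_to_SK1 I ` carrier (K1Sp I) = kernel (SK1 I) (W_E I) (SK1_to_W_E I)"
proof (intro equalityI subsetI)
  fix X assume "X \<in> K1Sp_to_SK1 I ` carrier (K1Sp I)"
  then obtain P where P: "P \<in> Sp_st I" "X = E_coset P"
    by (auto simp: K1Sp_carrier K1Sp_to_SK1_coset)
  then obtain n A where A: "A \<in> Sp_rel n I" "P = stab_class A" by (auto simp: stable_iff)
  have S: "A \<in> SL_rel (2 * n) I" using A(1) Sp_rel_SL_rel by blast
  have "witt_form n A = chi n" using A(1) by (simp add: witt_form_def Sp_rel_def)
  then have "SK1_to_W_E I X = \<one>\<^bsub>W_E I\<^esub>"
    unfolding P(2) A(2) SK1_to_W_E_coset[OF S] using W_class_chi[of n] by simp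
  moreover have "X \<in> carrier (SK1 I)" unfolding SK1_carrier P(2) using P(1) stable_inclusions(4) by blast
  ultimately show "X \<in> kernel (SK1 I) (W_E I) (SK1_to_W_E I)" by (simp add: kernel_def)
next
  fix X assume "X \<in> kernel (SK1 I) (W_E I) (SK1_to_W_E I)"
  then have X: "X \<in> carrier (SK1 I)" "SK1_to_W_E I X = \<one>\<^bsub>W_E I\<^esub>" by (auto simp: kernel_def)
  obtain P where P: "P \<in> SL_st I" "X = E_coset P" using X(1) by (auto simp: SK1_carrier)
  obtain n where "\<exists>A \<in> SL_rel (2 * n) I. P = stab_class A" using even_representative[OF P(1)] by blast
  then obtain A where A: "A \<in> SL_rel (2 * n) I" "P = stab_class A" by blast
  note c = SL_rel_carrier_mat[OF A(1)] and wA = witt_form_Alt[OF A(1)]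
  \<comment> \<open>With the empty matrix \<open>chi 0\<close> as representative of the identity,
    the right side of the congruence is a plain \<open>chi\<close>.\<close>
  have "W_class I (witt_form n A) = W_class I (chi 0)"
    using X(2) W_class_chi[of 0] unfolding P(2) A(2) SK1_to_W_E_coset[OF A(1)] by (simp only:)
  then have "(witt_form n A, chi 0) \<in> W_rel I" using W_class_eq_iff[OF wA] by blast
  then obtain m l p q where *: "witt_form n A \<in> Alt m I" "chi 0 \<in> Alt l I" "m + p = l + q"
    "elem_cong (2 * (m + p)) (witt_form n A \<bottom> chi p) (chi 0 \<bottom> chi q)"
    by (rule W_rel_elim)
  have "m = n" "l = 0" using Alt_unique[OF *(1) wA] Alt_unique[OF *(2) Alt_chi] .
  then have cong: "elem_cong (2 * (n + p)) (witt_form n A \<bottom> chi p) (chi (n + p))"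
    using *(3,4) by (simp only: chi_add add_0)
  \<comment> \<open>Another \<open>n\<close> planes ensure \<open>2 * n \<le> 2 * r\<close>, which
    \<open>E_coset_right_stabilisation\<close> requires.\<close>
  define r where "r = p + n"
  let ?N = "2 * (n + r)"
  have "elem_cong (2 * (n + p) + 2 * n) (witt_form n A \<bottom> chi p \<bottom> chi n) (chi (n + p) \<bottom> chi n)"
    by (rule elem_cong_sum_right[OF cong chi_carrier chi_carrier])
  moreover have "2 * (n + p) + 2 * n = ?N" "n + p + n = n + r" by (simp_all add: r_def)
  ultimately have "elem_cong ?N (witt_form n A \<bottom> chi r) (chi (n + r))"
    by (simp only: mat_sum_assoc chi_add r_def)
  moreover have "witt_form n A \<bottom> chi r = witt_form (n + r) (A \<bottom> 1\<^sub>m (2 * r))"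
    unfolding witt_form_def congruence_mat_sum[OF c one_carrier_mat] congruence_one ..
  ultimately obtain e where e: "e \<in> E_rel ?N I"
    "witt_form (n + r) (A \<bottom> 1\<^sub>m (2 * r)) = transpose_mat e * chi (n + r) * e"
    unfolding elem_cong_def by auto
  let ?A = "A \<bottom> 1\<^sub>m (2 * r)" and ?e = "inv\<^bsub>GL ?N\<^esub> e"
  have eG: "e \<in> carrier (GL ?N)" and ie: "?e \<in> E_rel ?N I" using e(1) E_rel_GL E_rel_inv by blast+
  have AG: "?A \<in> GL_rel ?N I"
    using GL_rel_mat_sum[OF _ GL_rel_one, of A "2 * n" "2 * r"] A(1) by (simp add: SL_rel_def distrib_left)
  then have AG': "?A \<in> carrier (GL ?N)" by (simp add: GL_rel_iff)
  note c' = GL_carrier_mat[OF AG'] GL_carrier_mat[OF GL_inv[OF eG]]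
  let ?g = "?A * ?e"
  have "transpose_mat ?g * chi (n + r) * ?g = transpose_mat ?e * (transpose_mat e * chi (n + r) * e) * ?e"
    unfolding congruence_mult[OF c' chi_carrier] using e(2) by (simp only: witt_form_def)
  also have "\<dots> = chi (n + r)" by (rule congruence_inverse[OF eG chi_carrier refl])
  finally have "?g \<in> Sp_rel (n + r) I"
    using GL_rel_mult[OF AG subsetD[OF E_rel_subset_GL_rel ie]] by (simp add: Sp_rel_def)
  then have g: "stab_class ?g \<in> Sp_st I" unfolding stable_iff by blast
  have "E_coset (stab_class ?g) = E_coset (stab_class ?A)"
    unfolding GL_stable_mult[OF c', symmetric]
    using ie by (intro E_coset_right stab_class_GL[OF AG']) (auto simp: stable_iff)
  also have "\<dots> = X"
    unfolding P(2) A(2) by (rule E_coset_right_stabilisation[OF A(1)]) (simp add: r_def)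
  finally have "X = K1Sp_to_SK1 I (ESp_coset (stab_class ?g))"
    unfolding K1Sp_to_SK1_coset[OF g] ..
  then show "X \<in> K1Sp_to_SK1 I ` carrier (K1Sp I)"
    unfolding K1Sp_carrier using g by blast
qed

end

lemma ideal_set_if_ideal:
  assumes "ideal I (class_ring :: 'a::comm_ring_1 ring)"
  shows "ideal_set I"
proof
  interpret ideal I "class_ring :: 'a ring" by fact
  show "0 \<in> I" using zero_closed by (simp add: class_ring_simps)
  show "a + b \<in> I" if "a \<in> I" "b \<in> I" for a b using a_closed[OF that] by (simp add: class_ring_simps)
  show "r * a \<in> I" if "a \<in> I" for a r using I_l_closed[OF that, of r] by (simp add: class_ring_simps)
qed

theorem corollary6p13:
  fixes I :: "'a::comm_ring_1 set"
  assumes "ideal I (class_ring :: 'a ring)"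
  shows "group_hom (K1Sp I) (SK1 I) (K1Sp_to_SK1 I) \<and>
    group_hom (SK1 I) (W_E I) (SK1_to_W_E I) \<and>
    K1Sp_to_SK1 I ` carrier (K1Sp I) = kernel (SK1 I) (W_E I) (SK1_to_W_E I)"
proof -
  interpret ideal_set I by (rule ideal_set_if_ideal[OF assms])
  show ?thesis by (intro conjI K1Sp_to_SK1_hom SK1_to_W_E_hom exactness)
qed

end
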